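(* Let $\epsilon\mapsto(\bm u^\epsilon,\wp^\epsilon,\eta^\epsilon)\in C^2_+(\overline\Omega;\mathbb R^3)\times C^2_+(\overline\Omega)\times C^2_+(\mathbb R^2)$ be a $C^2$-curve, defined in a neighborhood of $\epsilon=0$, of solutions of the flattened capillary-gravity water wave problem (defined in the context), such that $$(\bm u^0,\wp^0,\eta^0)=\big((U(x_3),0,0),\,0,\,0\big)$$ for some non-constant function $U\in C^2([-d,0])$ (real-valued) having no zeros in $[-d,0]$. Write the expansions $$\eta^\epsilon=\epsilon\,\eta^{(1)}+\epsilon^2\eta^{(2)}+o(\epsilon^2),\qquad \wp^\epsilon=\epsilon\,\wp^{(1)}+\epsilon^2\wp^{(2)}+o(\epsilon^2),\qquad \bm u^\epsilon=\bm u^0+\epsilon\,\bm u^{(1)}+\epsilon^2\bm u^{(2)}+o(\epsilon^2)$$ as $\epsilon\to0$. Then necessarily $$u^{(1)}_2\equiv0\qquad\text{and}\qquad \partial_2 u^{(1)}_3\equiv0,\quad \partial_2\wp^{(1)}\equiv0,\quad\partial_2\eta^{(1)}\equiv0 .$$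
   Context: Fix constants $d,g,\sigma>0$ and wavelengths $\lambda_1,\lambda_2>0$, and let $\Lambda=\lambda_1\mathbb Z\times\lambda_2\mathbb Z$. Points are $\bm x=(\bm x',x_3)=(x_1,x_2,x_3)$. Let $\Omega=\mathbb R^2\times(-d,0)$, with top $S=\{x_3=0\}$ and bottom $B=\{x_3=-d\}$, so $\partial\Omega=S\cup B$. Symmetry. $R_j$ ($j=1,2$) denotes reflection of the $j$th coordinate. A vector field $\bm v$ is $(+)$-symmetric if $\bm v(R_j\bm x)=(-1)^jR_j\bm v(\bm x)$ for $j=1,2$ (that is, $v_1$ is even in $x_1$ and in $x_2$; $v_2$ is odd in $x_1$ and in $x_2$; $v_3$ is odd in $x_1$ and even in $x_2$). A scalar function $f$ is $(+)$-symmetric if $f(R_j\,\cdot)=f$ for $j=1,2$. The subscript $+$ on a function space means that its elements are $(+)$-symmetric and $\Lambda$-periodic in $\bm x'$. Flattened capillary-gravity water wave problem. For $\eta=\eta(\bm x')$ with $\eta>-d$, set $\varphi(\bm x)=(1+x_3/d)\,\eta(\bm x')$, $\rho=1+\eta/d$, and $$M=\frac1\rho\begin{pmatrix}1&0&0\\0&1&0\\\partial_1\varphi&\partial_2\varphi&\rho\end{pmatrix}.$$ A triple $(\bm u,\wp,\eta)$ ($\bm u$ the flattened velocity, $\wp$ the flattened dynamic pressure, $\eta$ the surface elevation) is a solution if $$M^\top(\bm u\cdot\nabla)(M\bm u)+\nabla\wp=0,\qquad \nabla\cdot\bm u=0\qquad\text{in }\Omega,$$ $$u_3=0\ \text{ on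 }\partial\Omega,\qquad \wp-g\eta+\sigma\nabla\cdot\Big(\frac{\nabla\eta}{\sqrt{1+|\nabla\eta|^2}}\Big)=0\ \text{ on }S.$$ *)

theory Defs
  imports "HOL-Analysis.Analysis" "HOL-Library.Landau_Symbols"
begin

text \<open>
  Derivatives are taken within a set, so that one notion covers open sets, closed slabs
  and compact intervals: in the interior it is the ordinary derivative, and on the flat
  boundary of a slab it is the one-sided (continuous) extension of the interior derivative.
  On every set used below the derivative of a differentiable function is unique.
\<close>

definition dirderiv ::
  "'a::euclidean_space set \<Rightarrow> 'a \<Rightarrow> ('a \<Rightarrow> 'b::real_normed_vector) \<Rightarrow> 'a \<Rightarrow> 'b" where
  "dirderiv D b f x = frechet_derivative f (at x within D) b"

abbreviation pd ::
  "(real^'n) set \<Rightarrow> 'n \<Rightarrow> (real^'n \<Rightarrow> 'b::real_normed_vector) \<Rightarrow> real^'n \<Rightarrow> 'b" where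
  "pd D i \<equiv> dirderiv D (axis i 1)"

definition grad :: "(real^'n) set \<Rightarrow> (real^'n \<Rightarrow> real) \<Rightarrow> real^'n \<Rightarrow> real^'n" where
  "grad D f x = (\<chi> i. pd D i f x)"

definition divergence :: "(real^'n) set \<Rightarrow> (real^'n \<Rightarrow> real^'n) \<Rightarrow> real^'n \<Rightarrow> real" where
  "divergence D v x = (\<Sum>i\<in>UNIV. pd D i (\<lambda>y. v y $ i) x)"

definition C2_on :: "'a::euclidean_space set \<Rightarrow> ('a \<Rightarrow> 'b::real_normed_vector) \<Rightarrow> bool" where
  "C2_on D f \<longleftrightarrow> f differentiable_on D \<and>
     (\<forall>b\<in>Basis. dirderiv D b f differentiable_on D \<and>
        (\<forall>c\<in>Basis. continuous_on D (dirderiv D c (dirderiv D b f))))"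

text \<open>
  The values of a function outside \<open>D\<close> do not enter the norm.  It is finite on the periodic
  \<open>C\<^sup>2\<close> functions, to which alone it is applied, and it is the usual norm up to equivalence.
\<close>

definition C2_norm :: "'a::euclidean_space set \<Rightarrow> ('a \<Rightarrow> 'b::real_normed_vector) \<Rightarrow> real" where
  "C2_norm D f = (SUP x\<in>D. norm (f x) + (\<Sum>b\<in>Basis. norm (dirderiv D b f x))
     + (\<Sum>b\<in>Basis. \<Sum>c\<in>Basis. norm (dirderiv D c (dirderiv D b f) x)))"

definition reflect :: "'n::finite \<Rightarrow> real^'n \<Rightarrow> real^'n" where
  "reflect j x = (\<chi> i. if i = j then - (x $ i) else x $ i)"

definition periodic_on ::
  "real \<Rightarrow> real \<Rightarrow> (real^('n::{finite,numeral})) set \<Rightarrow> (real^('n::{finite,numeral}) \<Rightarrow> 'b) \<Rightarrow> bool" where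
  "periodic_on l1 l2 D f \<longleftrightarrow> (\<forall>x\<in>D. \<forall>(k::int) (m::int).
     f (x + axis 1 (l1 * of_int k) + axis 2 (l2 * of_int m)) = f x)"

definition sym_scalar :: "(real^('n::{finite,numeral})) set \<Rightarrow> (real^('n::{finite,numeral}) \<Rightarrow> real) \<Rightarrow> bool" where
  "sym_scalar D f \<longleftrightarrow> (\<forall>x\<in>D. f (reflect 1 x) = f x \<and> f (reflect 2 x) = f x)"

text \<open>
  The cases \<open>j = 1, 2\<close> of \<open>v (R\<^sub>j x) = (-1)^j R\<^sub>j v(x)\<close>; the sign makes this different from
  equivariance for \<open>j = 1\<close>.
\<close>

definition sym_vector :: "(real^3) set \<Rightarrow> (real^3 \<Rightarrow> real^3) \<Rightarrow> bool" where
  "sym_vector D v \<longleftrightarrow>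
     (\<forall>x\<in>D. v (reflect 1 x) = - reflect 1 (v x) \<and> v (reflect 2 x) = reflect 2 (v x))"

definition C2p_scalar ::
  "real \<Rightarrow> real \<Rightarrow> (real^('n::{finite,numeral})) set \<Rightarrow> (real^('n::{finite,numeral}) \<Rightarrow> real) set" where
  "C2p_scalar l1 l2 D = {f. C2_on D f \<and> periodic_on l1 l2 D f \<and> sym_scalar D f}"

definition C2p_vector ::
  "real \<Rightarrow> real \<Rightarrow> (real^3) set \<Rightarrow> (real^3 \<Rightarrow> real^3) set" where
  "C2p_vector l1 l2 D = {v. C2_on D v \<and> periodic_on l1 l2 D v \<and> sym_vector D v}"

definition Omega :: "real \<Rightarrow> (real^3) set" where
  "Omega d = {x. - d < x $ 3 \<and> x $ 3 < 0}"

definition Omega_closed :: "real \<Rightarrow> (real^3) set" where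
  "Omega_closed d = {x. - d \<le> x $ 3 \<and> x $ 3 \<le> 0}"

definition horiz :: "real^3 \<Rightarrow> real^2" where
  "horiz x = vector [x $ 1, x $ 2]"

definition phi :: "real \<Rightarrow> (real^2 \<Rightarrow> real) \<Rightarrow> real^3 \<Rightarrow> real" where
  "phi d \<eta> x = (1 + x $ 3 / d) * \<eta> (horiz x)"

definition rho :: "real \<Rightarrow> (real^2 \<Rightarrow> real) \<Rightarrow> real^3 \<Rightarrow> real" where
  "rho d \<eta> x = 1 + \<eta> (horiz x) / d"

definition Mmat :: "real \<Rightarrow> (real^2 \<Rightarrow> real) \<Rightarrow> real^3 \<Rightarrow> real^3^3" where
  "Mmat d \<eta> x = (1 / rho d \<eta> x) *\<^sub>R
     vector [vector [1, 0, 0],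
             vector [0, 1, 0],
             vector [pd UNIV 1 (phi d \<eta>) x, pd UNIV 2 (phi d \<eta>) x, rho d \<eta> x]]"

definition advect ::
  "(real^'n) set \<Rightarrow> (real^'n \<Rightarrow> real^'n) \<Rightarrow> (real^'n \<Rightarrow> real^'m) \<Rightarrow> real^'n \<Rightarrow> real^'m" where
  "advect D u w x = (\<Sum>j\<in>UNIV. (u x $ j) *\<^sub>R pd D j w x)"

definition flattened_solution ::
  "real \<Rightarrow> real \<Rightarrow> real \<Rightarrow> (real^3 \<Rightarrow> real^3) \<Rightarrow> (real^3 \<Rightarrow> real) \<Rightarrow> (real^2 \<Rightarrow> real) \<Rightarrow> bool" where
  "flattened_solution d g \<sigma> u p \<eta> \<longleftrightarrow>
     (\<forall>y. \<eta> y > - d) \<and>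
     (\<forall>x\<in>Omega d.
        transpose (Mmat d \<eta> x) *v advect (Omega d) u (\<lambda>y. Mmat d \<eta> y *v u y) x
          + grad (Omega d) p x = 0 \<and>
        divergence (Omega d) u x = 0) \<and>
     (\<forall>x. x $ 3 = 0 \<or> x $ 3 = - d \<longrightarrow> u x $ 3 = 0) \<and>
     (\<forall>x. x $ 3 = 0 \<longrightarrow>
        p x - g * \<eta> (horiz x)
          + \<sigma> * divergence UNIV
              (\<lambda>y. (1 / sqrt (1 + (norm (grad UNIV \<eta> y))\<^sup>2)) *\<^sub>R grad UNIV \<eta> y) (horiz x) = 0)"

text \<open>
  Curves in a function space are given as families of functions, and \<open>N\<close> is the norm
  of that space.  A curve in a product of spaces is treated componentwise.
\<close>

definition curve_has_deriv ::
  "(('a \<Rightarrow> 'b::real_vector) \<Rightarrow> real) \<Rightarrow> (real \<Rightarrow> 'a \<Rightarrow> 'b) \<Rightarrow> ('a \<Rightarrow> 'b) \<Rightarrow> real \<Rightarrow> bool" where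
  "curve_has_deriv N \<gamma> v s \<longleftrightarrow>
     (\<lambda>h. N (\<lambda>x. \<gamma> (s + h) x - \<gamma> s x - h *\<^sub>R v x)) \<in> o[at 0](\<lambda>h. h)"

definition C2_curve ::
  "real set \<Rightarrow> ('a \<Rightarrow> 'b::real_vector) set \<Rightarrow> (('a \<Rightarrow> 'b) \<Rightarrow> real) \<Rightarrow> (real \<Rightarrow> 'a \<Rightarrow> 'b) \<Rightarrow> bool" where
  "C2_curve I X N \<gamma> \<longleftrightarrow> \<gamma> ` I \<subseteq> X \<and>
     (\<exists>\<gamma>' \<gamma>''. \<gamma>' ` I \<subseteq> X \<and> \<gamma>'' ` I \<subseteq> X \<and>
        (\<forall>s\<in>I. curve_has_deriv N \<gamma> (\<gamma>' s) s \<and> curve_has_deriv N \<gamma>' (\<gamma>'' s) s \<and>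
           ((\<lambda>t. N (\<lambda>x. \<gamma>'' t x - \<gamma>'' s x)) \<longlongrightarrow> 0) (at s)))"

definition expands2 ::
  "(('a \<Rightarrow> 'b::real_vector) \<Rightarrow> real) \<Rightarrow> (real \<Rightarrow> 'a \<Rightarrow> 'b) \<Rightarrow>
   ('a \<Rightarrow> 'b) \<Rightarrow> ('a \<Rightarrow> 'b) \<Rightarrow> ('a \<Rightarrow> 'b) \<Rightarrow> bool" where
  "expands2 N \<gamma> f0 f1 f2 \<longleftrightarrow>
     (\<lambda>\<epsilon>. N (\<lambda>x. \<gamma> \<epsilon> x - (f0 x + \<epsilon> *\<^sub>R f1 x + \<epsilon>\<^sup>2 *\<^sub>R f2 x))) \<in> o[at 0](\<lambda>\<epsilon>. \<epsilon>\<^sup>2)"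

end

theory Submission
  imports Defs
begin

text \<open>Let \<open>b\<close> and \<open>v\<close> be the first-order horizontal and vertical cross-flow velocities (the latter in physical,
  unflattened form) and \<open>p\<close> the first-order pressure. The linearized equations give \<open>U \<partial>\<^sub>1 b = - \<partial>\<^sub>2 p\<close> and
  \<open>U \<partial>\<^sub>1 v = - \<partial>\<^sub>3 p\<close>, and each horizontal Fourier mode with wave numbers \<open>k, l\<close> satisfies a linear ODE in \<open>x\<^sub>3\<close>
  depending only on \<open>k\<^sup>2 + l\<^sup>2\<close>; by surface tension only finitely many modes are active. Averaged over \<open>x\<^sub>1\<close>, the
  second-order equations are solvable only if \<open>p\<^sup>2/U\<^sup>2 + b\<^sup>2 + v\<^sup>2\<close> has a mean independent of \<open>x\<^sub>2\<close> wherever \<open>U' \<noteq> 0\<close>.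
  If \<open>L > 0\<close> is the largest active transverse wave number, the harmonic \<open>cos (2 L x\<^sub>2)\<close> of this mean only sees the modes
  with \<open>l = L\<close>, and its vanishing is a quadratic relation between their profiles. Differentiating it shows that it can
  neither stop at an interior zero of \<open>U'\<close> nor persist down to the bottom, where the vertical velocity vanishes. Hence no
  mode depends on \<open>x\<^sub>2\<close>.\<close>

section \<open>Fourier coefficients on a rectangle\<close>

text \<open>The relation that comes out at second order is indefinite: in the harmonic cos (2 L x_2)
  the cosine modes of p and v count with a plus sign and the sine modes of b with a minus sign,
  which leaves the coefficient k^2 - l^2 in front of the squared pressure profile. No sign argument
  applies to it directly. In its vertical derivative the terms with l^2 cancel, and what is left
  pairs each pressure profile with its rescaled vertical velocity; that product is strictly positive
  above the bottom because the bottom is impermeable. The highest transverse wave number is singled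
  out because products of modes with wave numbers up to L reach the harmonic 2 L only if both have l
  = L; this is why only finitely many modes may be active. The symmetry in x_1 excludes modes of b
  and v that are independent of x_1: the linearized equations would admit them, since the transverse
  and vertical momentum balances control only the x_1-derivatives of b and v. The absence of zeros
  of U keeps the mode equations regular, so that Cauchy data determine a profile and no singular
  layer occurs.\<close>

abbreviation volume :: "(real \<times> real) set \<Rightarrow> real" where
  "volume \<equiv> Henstock_Kurzweil_Integration.content"

text \<open>Large powers of \<open>K\<close> concentrate at its peak: the integral gains at least a
  multiple of \<open>k2 ^ N\<close> near \<open>y0\<close> and loses at most a multiple of
  \<open>k1 ^ N\<close> away from it, with \<open>k1 < k2\<close>.\<close>

lemma peak_kernel_positive:
  fixes f K :: "real \<times> real \<Rightarrow> real"
  assumes cf: "continuous_on (cbox a b) f" and cK: "continuous_on (cbox a b) K"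
    and y0: "y0 \<in> box a b" and f0: "f y0 > 0"
    and K0: "\<And>y. y \<in> cbox a b \<Longrightarrow> 0 \<le> K y"
    and pk: "\<And>y. y \<in> cbox a b \<Longrightarrow> y \<noteq> y0 \<Longrightarrow> K y < K y0"
  shows "\<exists>N. integral (cbox a b) (\<lambda>y. f y * K y ^ N) > 0"
proof -
  let ?B = "cbox a b"
  have y0B: "y0 \<in> ?B" using y0 box_subset_cbox by blast
  have fb: "continuous_on (box a b) f" "continuous_on (box a b) K"
    using cf cK box_subset_cbox continuous_on_subset by blast+
  have isf: "isCont f y0" "isCont K y0"
    using fb y0 continuous_on_eq_continuous_at open_box by blast+
  have "\<forall>\<^sub>F y in at y0. f y > f y0 / 2"
    using isf(1) f0 unfolding isCont_def by (intro order_tendstoD(1)[of f "f y0"]) auto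
  then obtain r1 where r1: "r1 > 0" "\<And>y. dist y y0 < r1 \<Longrightarrow> f y > f y0 / 2"
    unfolding eventually_at using f0 by (metis UNIV_I dist_nz field_sum_of_halves less_add_same_cancel1 half_gt_zero)
  obtain r2 where r2: "r2 > 0" "ball y0 r2 \<subseteq> box a b" using y0 open_box open_contains_ball by blast
  define r where "r = min r1 r2"
  have r: "r > 0" "ball y0 r \<subseteq> ?B" "\<And>y. y \<in> ball y0 r \<Longrightarrow> f y > f y0 / 2"
    using r1 r2 box_subset_cbox[of a b] unfolding r_def by (force simp: dist_commute)+
  define S where "S = ?B - ball y0 r"
  have cS: "compact S" unfolding S_def by (simp add: compact_diff)
  \<comment> \<open>Off the ball the kernel stays below its peak by compactness. If nothing lies off
    the ball, \<open>k1 = 0\<close> serves: \<open>K y0 > 0\<close> because \<open>K\<close> is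
    smaller, yet nonnegative, at some other point.\<close>
  have "\<exists>k1\<ge>0. k1 < K y0 \<and> (\<forall>y\<in>S. K y \<le> k1)"
  proof (cases "S = {}")
    case True
    obtain y1 where "y1 \<in> ball y0 r" "y1 \<noteq> y0"
    proof -
      have "(fst y0 + r/2, snd y0) \<in> ball y0 r" using r(1) by (auto simp: dist_prod_def dist_real_def)
      moreover have "(fst y0 + r/2, snd y0) \<noteq> y0" using r(1) by (auto simp: prod_eq_iff)
      ultimately show ?thesis using that by blast
    qed
    then have "K y0 > 0" using pk[of y1] K0[of y1] r by force
    then show ?thesis using True by (intro exI[of _ 0]) auto
  next
    case False
    have "continuous_on S K" using cK unfolding S_def by (meson Diff_subset continuous_on_subset)
    then obtain m where m: "m \<in> S" "\<forall>y\<in>S. K y \<le> K m"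
      using continuous_attains_sup[OF cS False] by blast
    have "m \<in> ?B" "m \<noteq> y0" using m r unfolding S_def by auto
    then show ?thesis using m pk K0 by blast
  qed
  then obtain k1 where k1: "k1 \<ge> 0" "k1 < K y0" "\<And>y. y \<in> S \<Longrightarrow> K y \<le> k1" by blast
  obtain k2 where k2: "k1 < k2" "k2 < K y0" using dense k1 by blast
  have "\<forall>\<^sub>F y in at y0. K y > k2"
    using isf(2) k2 unfolding isCont_def by (intro order_tendstoD(1)[of K "K y0"]) auto
  then obtain r3 where r3: "r3 > 0" "\<And>y. dist y y0 < r3 \<Longrightarrow> K y > k2"
    unfolding eventually_at using k2 by (metis UNIV_I dist_nz)
  define R where "R = min r r3"
  have R0: "R > 0" using r r3 R_def by auto
  obtain p q where pq: "y0 \<in> box p q" "cbox p q \<subseteq> ball y0 R"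
    using open_contains_cbox[of "ball y0 R"] R0 by (metis centre_in_ball open_ball)
  define W where "W = cbox p q"
  have Wr: "W \<subseteq> ball y0 r" using pq unfolding W_def R_def by (meson ball_min_Int inf.bounded_iff order_trans subset_ball min.cobounded1)
  then have WB: "W \<subseteq> ?B" using r by blast
  have WK: "K y > k2" if "y \<in> W" for y
  proof -
    have "y \<in> ball y0 R" using that pq unfolding W_def by blast
    then show ?thesis using r3(2)[of y] by (simp add: R_def dist_commute)
  qed
  have cW: "volume W > 0" unfolding W_def using pq(1) by (metis content_pos_lt_eq empty_iff box_ne_empty(2))
  obtain M where M: "\<And>y. y \<in> ?B \<Longrightarrow> \<bar>f y\<bar> \<le> M" "M \<ge> 0"
  proof -
    have "compact (f ` ?B)" using cf compact_cbox compact_continuous_image by blast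
    then obtain M where "\<forall>x\<in>f ` ?B. norm x \<le> M" using compact_imp_bounded bounded_iff by blast
    then have "\<And>y. y \<in> ?B \<Longrightarrow> \<bar>f y\<bar> \<le> M" by auto
    then show ?thesis using that y0B abs_ge_zero order_trans by blast
  qed
  have lower: "integral ?B (\<lambda>y. f y * K y ^ N) \<ge> f y0/2 * k2^N * volume W - M * k1^N * volume ?B" for N
  proof -
    \<comment> \<open>\<open>?g\<close> is a minorant: on \<open>W\<close> the kernel exceeds
      \<open>k2\<close>, on \<open>S\<close> the product is at least \<open>- M * k1 ^ N\<close>,
      and on the rest of the ball it is nonnegative since \<open>f > 0\<close> there.\<close>
    let ?g = "\<lambda>y. f y0/2 * k2^N * indicator W y - M * k1^N"
    have iW: "((indicator W :: _ \<Rightarrow> real) has_integral volume W) ?B"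
    proof -
      have "((\<lambda>y. 1::real) has_integral volume W) W"
        unfolding W_def using has_integral_const[of "1::real" p q] by simp
      then have "((\<lambda>y. if y \<in> W then 1 else 0::real) has_integral volume W) ?B"
        by (subst has_integral_restrict[OF WB])
      then show ?thesis by (simp add: indicator_def[abs_def] of_bool_def)
    qed
    have g: "(?g has_integral (f y0/2 * k2^N * volume W - M * k1^N * volume ?B)) ?B"
      using has_integral_diff[OF has_integral_mult_right[OF iW, of "f y0/2 * k2^N"] has_integral_const[of "M * k1^N" a b]]
      by (simp add: mult_ac)
    have i: "(\<lambda>y. f y * K y ^ N) integrable_on ?B"
      by (intro integrable_continuous continuous_intros cf cK)
    have "?g y \<le> f y * K y ^ N" if y: "y \<in> ?B" for y
    proof (cases "y \<in> W")
      case True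
      have "f y0/2 * k2^N \<le> f y * K y ^ N"
        using True WK[OF True] r(3)[of y] Wr k1 k2 f0 by (intro mult_mono power_mono) auto
      moreover have "M * k1^N \<ge> 0" using M k1 by simp
      ultimately show ?thesis using True by simp
    next
      case False
      show ?thesis
      proof (cases "y \<in> S")
        case True
        have "\<bar>f y * K y ^ N\<bar> \<le> M * k1^N"
          unfolding abs_mult power_abs using M(1)[OF y] k1(3)[OF True] K0[OF y] M(2)
          by (intro mult_mono power_mono) auto
        then show ?thesis using False by simp
      next
        case 2: False
        then have "f y > 0" using y r(3)[of y] f0 unfolding S_def by auto
        then have "f y * K y ^ N \<ge> 0" using K0[OF y] by simp
        moreover have "M * k1^N \<ge> 0" using M k1 by simp
        ultimately show ?thesis using False by (simp add: indicator_def; linarith)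
      qed
    qed
    then show ?thesis
      using has_integral_le[OF g integrable_integral[OF i]] by blast
  qed
  have "(\<lambda>N. M * (k1/k2)^N * volume ?B) \<longlonglongrightarrow> M * 0 * volume ?B"
    using k1 k2 by (intro tendsto_intros LIMSEQ_power_zero) auto
  moreover have "f y0 / 2 * volume W > 0" using f0 cW by simp
  ultimately have "\<forall>\<^sub>F N in sequentially. M * (k1/k2)^N * volume ?B < f y0 / 2 * volume W"
    by (intro order_tendstoD(2)) auto
  then obtain N where N: "M * (k1/k2)^N * volume ?B < f y0 / 2 * volume W"
    by (meson eventually_happens sequentially_bot)
  have "k2^N > 0" using k1 k2 by simp
  then have "M * k1^N * volume ?B < f y0/2 * k2^N * volume W"
    using N by (simp add: power_divide field_simps)
  then show ?thesis using lower[of N] by (intro exI[of _ N]) linarith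
qed

lemma cos_less_one: "cos x < 1" if "x \<noteq> 0" "\<bar>x\<bar> < 2 * pi" for x :: real
proof -
  have "sin \<bar>x/2\<bar> > 0" using that by (intro sin_gt_zero) auto
  then have "sin (x/2) \<noteq> 0" by (auto simp: abs_if split: if_splits)
  then have "(sin (x/2))\<^sup>2 > 0" by simp
  moreover have "cos x = 1 - 2 * (sin (x/2))\<^sup>2" using cos_double_sin[of "x/2"] by simp
  ultimately show ?thesis by linarith
qed

text \<open>If all coefficients of \<open>f\<close> vanish, \<open>f\<close> is orthogonal to the powers of a kernel that peaks at a single point.\<close>

lemma fourier_zero_times_kernel:
  fixes f :: "real \<times> real \<Rightarrow> real" and B :: "(real \<times> real) set"
  assumes cf: "continuous_on B f" and B: "B = cbox lo hi"
    and H: "\<And>(m::int) (n::int) \<theta> \<tau>. integral B (\<lambda>y. f y * (cos (m * (\<omega> * fst y) + \<theta>) * cos (n * (\<nu> * snd y) + \<tau>))) = 0"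
  shows "integral B (\<lambda>y. f y * (cos (of_int m * (\<omega> * fst y) + \<theta>) * cos (of_int n * (\<nu> * snd y) + \<tau>))
     * (2 + cos (\<omega> * fst y - \<omega> * s0) + cos (\<nu> * snd y - \<nu> * t0)) ^ N) = 0"
proof (induction N arbitrary: m n \<theta> \<tau>)
  case 0
  show ?case using H[of m \<theta> n \<tau>] by simp
next
  case (Suc N)
  define T where "T m n \<theta> \<tau> y = f y * (cos (of_int m * (\<omega> * fst y) + \<theta>) * cos (of_int n * (\<nu> * snd y) + \<tau>))
     * (2 + cos (\<omega> * fst y - \<omega> * s0) + cos (\<nu> * snd y - \<nu> * t0)) ^ N" for m n :: int and \<theta> \<tau> y
  have I: "integral B (T m n \<theta> \<tau>) = 0" for m n \<theta> \<tau> using Suc unfolding T_def by simp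
  have ii: "T m n \<theta> \<tau> integrable_on B" for m n \<theta> \<tau>
    unfolding T_def B by (intro integrable_continuous continuous_intros cf[unfolded B])
  \<comment> \<open>Multiplication by a shifted cosine moves the frequency up and down by one and
    changes the phase; arbitrary phases in the hypothesis let the induction on \<open>N\<close>
    close.\<close>
  have cc: "cos (of_int m * x + \<theta>) * cos (x - x0) =
      (cos (of_int (m+1) * x + (\<theta> - x0)) + cos (of_int (m-1) * x + (\<theta> + x0))) / 2" for m :: int and x \<theta> x0 :: real
    by (subst cos_times_cos) (simp add: algebra_simps)
  have eq: "f y * (cos (of_int m * (\<omega> * fst y) + \<theta>) * cos (of_int n * (\<nu> * snd y) + \<tau>))
     * (2 + cos (\<omega> * fst y - \<omega> * s0) + cos (\<nu> * snd y - \<nu> * t0)) ^ Suc N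
    = 2 * T m n \<theta> \<tau> y + (1/2) * (T (m+1) n (\<theta> - \<omega> * s0) \<tau> y + T (m-1) n (\<theta> + \<omega> * s0) \<tau> y)
      + (1/2) * (T m (n+1) \<theta> (\<tau> - \<nu> * t0) y + T m (n-1) \<theta> (\<tau> + \<nu> * t0) y)" for y
  proof -
    let ?K = "f y * (2 + cos (\<omega> * fst y - \<omega> * s0) + cos (\<nu> * snd y - \<nu> * t0)) ^ N"
    let ?c = "cos (of_int m * (\<omega> * fst y) + \<theta>)" and ?e = "cos (of_int n * (\<nu> * snd y) + \<tau>)"
    have "f y * (?c * ?e) * (2 + cos (\<omega> * fst y - \<omega> * s0) + cos (\<nu> * snd y - \<nu> * t0)) ^ Suc N
      = 2 * (?K * ?c * ?e) + ?K * ?e * (?c * cos (\<omega> * fst y - \<omega> * s0)) + ?K * ?c * (?e * cos (\<nu> * snd y - \<nu> * t0))"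
      by (simp add: algebra_simps)
    then show ?thesis unfolding cc T_def by (simp add: algebra_simps add_divide_distrib)
  qed
  have "((\<lambda>y. 2 * T m n \<theta> \<tau> y + (1/2) * (T (m+1) n (\<theta> - \<omega> * s0) \<tau> y + T (m-1) n (\<theta> + \<omega> * s0) \<tau> y)
      + (1/2) * (T m (n+1) \<theta> (\<tau> - \<nu> * t0) y + T m (n-1) \<theta> (\<tau> + \<nu> * t0) y)) has_integral 
     (2 * 0 + (1/2) * (0 + 0) + (1/2) * (0 + 0))) B"
    using integrable_integral[OF ii] I by (intro has_integral_add has_integral_mult_right) metis+
  then show ?case unfolding eq by (simp add: integral_unique)
qed

text \<open>Centred at an interior point where \<open>f\<close> is positive, the kernel
  \<open>2 + cos + cos\<close> is nonnegative and has no other maximum in the closed cell, so its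
  powers detect the sign. Centred at a boundary point it would peak on the opposite side as well;
  boundary values therefore come by continuity.\<close>

lemma fourier_complete:
  fixes f :: "real \<times> real \<Rightarrow> real"
  assumes cf: "continuous_on (cbox (-a,-b) (a,b)) f" and ab: "a > 0" "b > 0"
    and H: "\<And>(m::int) (n::int) \<theta> \<tau>. integral (cbox (-a,-b) (a,b)) (\<lambda>y. f y * (cos (m * (pi / a * fst y) + \<theta>) * cos (n * (pi / b * snd y) + \<tau>))) = 0"
    and y: "y \<in> cbox (-a,-b) (a,b)"
  shows "f y = 0"
proof -
  have le: "f y0 \<le> 0" if cf: "continuous_on (cbox (-a,-b) (a,b)) f" and
   H: "\<And>(m::int) (n::int) \<theta> \<tau>. integral (cbox (-a,-b) (a,b)) (\<lambda>y. f y * (cos (m * (pi / a * fst y) + \<theta>) * cos (n * (pi / b * snd y) + \<tau>))) = 0"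
    and y0: "y0 \<in> box (-a,-b) (a,b)" for f :: "real \<times> real \<Rightarrow> real" and y0
  proof (rule ccontr)
    assume "\<not> f y0 \<le> 0"
    then have f0: "f y0 > 0" by simp
    let ?K = "\<lambda>y. 2 + cos (pi/a * fst y - pi/a * fst y0) + cos (pi/b * snd y - pi/b * snd y0)"
    have c1: "cos (pi/e * x - pi/e * x0) < 1" if "e > 0" "x \<noteq> x0" "-e < x0" "x0 < e" "-e \<le> x" "x \<le> e" for e x x0 :: real
    proof (rule cos_less_one)
      have *: "pi/e * x - pi/e * x0 = pi/e * (x - x0)" by (simp add: right_diff_distrib)
      show "pi/e * x - pi/e * x0 \<noteq> 0" using that unfolding * by simp
      have "\<bar>x - x0\<bar> < 2 * e" using that by auto
      then have "pi/e * \<bar>x - x0\<bar> < pi/e * (2*e)" using that by (intro mult_strict_left_mono) auto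
      then show "\<bar>pi/e * x - pi/e * x0\<bar> < 2 * pi" unfolding * abs_mult using that by simp
    qed
    have "\<exists>N. integral (cbox (-a,-b) (a,b)) (\<lambda>y. f y * ?K y ^ N) > 0"
    proof (rule peak_kernel_positive[where ?y0.0 = y0])
      show "continuous_on (cbox (-a,-b) (a,b)) ?K" by (intro continuous_intros)
      show "0 \<le> ?K y" for y
        using cos_ge_minus_one[of "pi/a * fst y - pi/a * fst y0"] cos_ge_minus_one[of "pi/b * snd y - pi/b * snd y0"] by linarith
      fix y assume y: "y \<in> cbox (-a,-b) (a,b)" "y \<noteq> y0"
      obtain s t where st: "y = (s,t)" by force
      obtain s0 t0 where st0: "y0 = (s0,t0)" by force
      have r: "-a \<le> s" "s \<le> a" "-b \<le> t" "t \<le> b" "-a < s0" "s0 < a" "-b < t0" "t0 < b"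
        using y y0 unfolding st st0 by (auto simp: mem_box Basis_prod_def)
      show "?K y < ?K y0"
      proof (cases "s = s0")
        case True
        then have "t \<noteq> t0" using y st st0 by auto
        then show ?thesis using c1[of b t t0] r ab True st st0 by simp
      next
        case False
        then have "cos (pi/a * s - pi/a * s0) < 1" using c1[of a s s0] r ab by simp
        then show ?thesis using cos_le_one[of "pi/b * t - pi/b * t0"] unfolding st st0 fst_conv snd_conv cos_zero diff_self by linarith
      qed
    qed (use cf y0 f0 in auto)
    then obtain N where N: "integral (cbox (-a,-b) (a,b)) (\<lambda>y. f y * ?K y ^ N) > 0" by blast
    have "integral (cbox (-a,-b) (a,b)) (\<lambda>y. f y * ?K y ^ N) = 0"
      using fourier_zero_times_kernel[OF cf refl H, where m = 0 and n = 0 and \<theta> = 0 and \<tau> = 0 and ?s0.0 = "fst y0" and ?t0.0 = "snd y0" and N = N]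
      by simp
    then show False using N by simp
  qed
  have z: "f y = 0" if "y \<in> box (-a,-b) (a,b)" for y
  proof -
    have "- f y \<le> 0"
      by (rule le[of "\<lambda>y. - f y"]) (use cf H that in \<open>auto intro!: continuous_intros\<close>)
    then show ?thesis using le[OF cf H that] by simp
  qed
  have cl: "closure (box (-a,-b) (a,b)) = cbox (-a,-b) (a,b)"
    by (rule closure_box) (use ab in \<open>auto simp: box_ne_empty Basis_prod_def\<close>)
  show ?thesis
    by (rule continuous_constant_on_closure[of "box (-a,-b) (a,b)" f 0]) (use cf z y cl in auto)
qed

section \<open>Sine and cosine coefficients, finite Fourier sums, squares\<close>

definition tr :: "bool \<Rightarrow> real \<Rightarrow> real" where
  "tr c x = (if c then cos x else sin x)"

text \<open>\<open>a * wt c n\<close> is the squared norm of the \<open>n\<close>-th function on \<open>{-a..a}\<close>. It is \<open>0\<close> for \<open>sin 0\<close>; in the expansion below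
  the quotient by it is then \<open>0\<close>, as is the coefficient.\<close>

definition wt :: "bool \<Rightarrow> nat \<Rightarrow> real" where
  "wt c n = (if n = 0 then (if c then 2 else 0) else 1)"

lemma continuous_on_tr [continuous_intros]:
  fixes g :: "'a::t2_space \<Rightarrow> real"
  shows "continuous_on A g \<Longrightarrow> continuous_on A (\<lambda>x. tr c (g x))"
  unfolding tr_def by (cases c) (auto intro: continuous_on_cos continuous_on_sin)

lemma integral_cos_period:
  assumes "a > 0"
  shows "((\<lambda>x. cos (of_int k * (pi / a * x))) has_integral (if k = 0 then 2 * a else 0)) {-a..a::real}"
proof (cases "k = 0")
  case True
  then show ?thesis using has_integral_const_real[of "1::real" "-a" a] assms by simp
next
  case False
  let ?F = "\<lambda>x. sin (of_int k * (pi / a * x)) / (of_int k * (pi / a))"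
  have "((\<lambda>x. cos (of_int k * (pi / a * x))) has_integral (?F a - ?F (-a))) {-a..a::real}"
    by (rule fundamental_theorem_of_calculus)
       (use assms False in \<open>auto intro!: derivative_eq_intros simp: has_real_derivative_iff_has_vector_derivative[symmetric]\<close>)
  moreover have "of_int k * (pi / a * a) = pi * of_int k" "of_int k * (pi / a * - a) = - (pi * of_int k)"
    using assms by auto
  ultimately show ?thesis using False by (simp only: sin_minus sin_npi_int) simp
qed

lemma integral_sin_period:
  assumes "a > 0"
  shows "((\<lambda>x. sin (of_int k * (pi / a * x))) has_integral 0) {-a..a::real}"
proof (cases "k = 0")
  case True
  then show ?thesis by simp
next
  case False
  let ?F = "\<lambda>x. - cos (of_int k * (pi / a * x)) / (of_int k * (pi / a))"
  have "((\<lambda>x. sin (of_int k * (pi / a * x))) has_integral (?F a - ?F (-a))) {-a..a::real}"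
    by (rule fundamental_theorem_of_calculus)
       (use assms False in \<open>auto intro!: derivative_eq_intros simp: has_real_derivative_iff_has_vector_derivative[symmetric]\<close>)
  then show ?thesis by simp
qed

lemma tr_times_tr:
  "tr True x * tr True y = (tr True (x - y) + tr True (x + y)) / 2"
  "tr False x * tr False y = (tr True (x - y) - tr True (x + y)) / 2"
  "tr False x * tr True y = (tr False (x + y) + tr False (x - y)) / 2"
  "tr True x * tr False y = (tr False (x + y) - tr False (x - y)) / 2"
  by (simp_all add: tr_def cos_times_cos sin_times_sin sin_times_cos cos_times_sin)

lemma trig_orthogonal:
  assumes a: "a > 0"
  shows "((\<lambda>x. tr c (real m * (pi / a * x)) * tr e (real n * (pi / a * x)))
    has_integral (if m = n \<and> c = e then a * wt c m else 0)) {-a..a}"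
proof -
  have d: "real m * x - real n * x = of_int (int m - int n) * x"
    and s: "real m * x + real n * x = of_int (int m + int n) * x" for x :: real
    by (simp_all add: algebra_simps)
  have C: "((\<lambda>x. tr True (of_int k * (pi / a * x))) has_integral (if k = 0 then 2 * a else 0)) {-a..a}"
    and S: "((\<lambda>x. tr False (of_int k * (pi / a * x))) has_integral 0) {-a..a}" for k
    using integral_cos_period[OF a] integral_sin_period[OF a] by (simp_all add: tr_def)
  note hi = has_integral_divide[OF has_integral_add[OF C C], of _ _ 2] has_integral_divide[OF has_integral_diff[OF C C], of _ _ 2]
    has_integral_divide[OF has_integral_add[OF S S], of _ _ 2] has_integral_divide[OF has_integral_diff[OF S S], of _ _ 2]
  have T: "c \<Longrightarrow> tr c = tr True" "\<not> c \<Longrightarrow> tr c = tr False" for c by simp_all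
  show ?thesis
  proof (cases c; cases e)
    assume *: "c" "e"
    show ?thesis unfolding T(1)[OF *(1)] T(1)[OF *(2)] tr_times_tr d s
      using hi(1)[of "int m - int n" "int m + int n"] * by (elim has_integral_eq_rhs) (auto simp: wt_def)
  next
    assume *: "\<not> c" "\<not> e"
    show ?thesis unfolding T(2)[OF *(1)] T(2)[OF *(2)] tr_times_tr d s
      using hi(2)[of "int m - int n" "int m + int n"] * by (elim has_integral_eq_rhs) (auto simp: wt_def)
  next
    assume *: "\<not> c" "e"
    show ?thesis unfolding T(2)[OF *(1)] T(1)[OF *(2)] tr_times_tr d s
      using hi(3)[of "int m + int n" "int m - int n"] * by (elim has_integral_eq_rhs) auto
  next
    assume *: "c" "\<not> e"
    show ?thesis unfolding T(1)[OF *(1)] T(2)[OF *(2)] tr_times_tr d s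
      using hi(4)[of "int m + int n" "int m - int n"] * by (elim has_integral_eq_rhs) auto
  qed
qed

lemma integral_cell_product:
  fixes g h :: "real \<Rightarrow> real"
  assumes "continuous_on {-a..a} g" "continuous_on {-b..b} h"
  shows "integral (cbox (-a,-b) (a,b)) (\<lambda>y. g (fst y) * h (snd y)) = integral {-a..a} g * integral {-b..b} h"
proof -
  have "continuous_on (cbox (-a,-b) (a,b)) (\<lambda>y. g (fst y) * h (snd y))"
    by (intro continuous_on_mult continuous_on_compose2[OF assms(1)] continuous_on_compose2[OF assms(2)] continuous_intros)
       (auto simp: cbox_Pair_eq)
  from integral_prod_continuous[OF this] show ?thesis
    by simp
qed

text \<open>Not normalized. The Booleans pick the parity in each variable (true for cosine, false
  for sine), so that the four families of products are treated at once and a symmetry of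
  \<open>f\<close> in both variables becomes the vanishing of three of them.\<close>

definition co :: "real \<Rightarrow> real \<Rightarrow> (real \<times> real \<Rightarrow> real) \<Rightarrow> bool \<Rightarrow> bool \<Rightarrow> nat \<Rightarrow> nat \<Rightarrow> real" where
  "co a b f c e m n = integral (cbox (-a,-b) (a,b))
     (\<lambda>y. f y * (tr c (real m * (pi / a * fst y)) * tr e (real n * (pi / b * snd y))))"

lemma co_integrable:
  assumes "continuous_on (cbox (-a,-b) (a,b)) f"
  shows "(\<lambda>y. f y * (tr c (u * (p * fst y)) * tr e (w * (q * snd y)))) integrable_on (cbox (-a,-b) (a,b))"
  by (intro integrable_continuous continuous_intros assms)

lemma fourier_coefficients_zero:
  fixes f :: "real \<times> real \<Rightarrow> real"
  assumes cf: "continuous_on (cbox (-a,-b) (a,b)) f" and ab: "a > 0" "b > 0"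
    and H: "\<And>c e m n. co a b f c e m n = 0" and y: "y \<in> cbox (-a,-b) (a,b)"
  shows "f y = 0"
proof (rule fourier_complete[OF cf ab _ y])
  fix m n :: int and \<theta> \<tau> :: real
  \<comment> \<open>Frequencies are natural numbers in \<open>co\<close> but integers here; the sign
    \<open>?s\<close> restores the oddness of the sine when \<open>k\<close> is replaced by its
    modulus.\<close>
  let ?s = "\<lambda>k::int. if k < 0 then -1 else 1::real"
  have e: "cos (of_int k * x + \<phi>) = cos \<phi> * tr True (real (nat \<bar>k\<bar>) * x) - ?s k * sin \<phi> * tr False (real (nat \<bar>k\<bar>) * x)"
    for k :: int and x \<phi> :: real
    by (simp add: tr_def cos_add)
  let ?T = "\<lambda>c d y. f y * (tr c (real (nat \<bar>m\<bar>) * (pi / a * fst y)) * tr d (real (nat \<bar>n\<bar>) * (pi / b * snd y)))"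
  have I: "(?T c d has_integral 0) (cbox (-a,-b) (a,b))" for c d
    by (subst H[of c d "nat \<bar>m\<bar>" "nat \<bar>n\<bar>", unfolded co_def, symmetric], rule integrable_integral, rule co_integrable[OF cf])
  have "((\<lambda>y. cos \<theta> * cos \<tau> * ?T True True y - cos \<theta> * ?s n * sin \<tau> * ?T True False y
     - ?s m * sin \<theta> * cos \<tau> * ?T False True y + ?s m * sin \<theta> * ?s n * sin \<tau> * ?T False False y)
     has_integral (cos \<theta> * cos \<tau> * 0 - cos \<theta> * ?s n * sin \<tau> * 0
     - ?s m * sin \<theta> * cos \<tau> * 0 + ?s m * sin \<theta> * ?s n * sin \<tau> * 0)) (cbox (-a,-b) (a,b))"
    by (intro has_integral_add has_integral_diff has_integral_mult_right I)
  then have "integral (cbox (-a,-b) (a,b)) (\<lambda>y. cos \<theta> * cos \<tau> * ?T True True y - cos \<theta> * ?s n * sin \<tau> * ?T True False y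
     - ?s m * sin \<theta> * cos \<tau> * ?T False True y + ?s m * sin \<theta> * ?s n * sin \<tau> * ?T False False y) = 0"
    by (simp add: integral_unique)
  moreover have "(\<lambda>y. f y * (cos (m * (pi / a * fst y) + \<theta>) * cos (n * (pi / b * snd y) + \<tau>)))
     = (\<lambda>y. cos \<theta> * cos \<tau> * ?T True True y - cos \<theta> * ?s n * sin \<tau> * ?T True False y
     - ?s m * sin \<theta> * cos \<tau> * ?T False True y + ?s m * sin \<theta> * ?s n * sin \<tau> * ?T False False y)"
    unfolding e by (intro ext) (simp only: algebra_simps)
  ultimately show "integral (cbox (-a,-b) (a,b)) (\<lambda>y. f y * (cos (m * (pi / a * fst y) + \<theta>) * cos (n * (pi / b * snd y) + \<tau>))) = 0"
    by simp
qed

text \<open>By orthogonality the difference of both sides has only zero coefficients: outside the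
  given parity and band by hypothesis, inside by the choice of the quotients.\<close>

lemma finite_fourier_expansion:
  fixes f :: "real \<times> real \<Rightarrow> real"
  assumes cf: "continuous_on (cbox (-a,-b) (a,b)) f" and ab: "a > 0" "b > 0"
    and H: "\<And>c' e' m n. \<not> (c' = c \<and> e' = e \<and> m \<le> N \<and> n \<le> L) \<Longrightarrow> co a b f c' e' m n = 0"
    and y: "y \<in> cbox (-a,-b) (a,b)"
  shows "f y = (\<Sum>m\<le>N. \<Sum>n\<le>L. co a b f c e m n / (a * wt c m * (b * wt e n)) *
     (tr c (real m * (pi / a * fst y)) * tr e (real n * (pi / b * snd y))))" (is "_ = ?S y")
proof -
  let ?B = "cbox (-a,-b) (a,b)"
  let ?t = "\<lambda>c e m n y. tr c (real m * (pi / a * fst y)) * tr e (real n * (pi / b * snd y))"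
  let ?A = "\<lambda>m n. co a b f c e m n / (a * wt c m * (b * wt e n))"
  have tt: "integral ?B (\<lambda>y. ?t c e m n y * ?t c' e' m' n' y)
      = (if m = m' \<and> c = c' then a * wt c m else 0) * (if n = n' \<and> e = e' then b * wt e n else 0)" for c' e' m n m' n'
  proof -
    have "integral ?B (\<lambda>y. ?t c e m n y * ?t c' e' m' n' y) =
       integral ?B (\<lambda>y. (\<lambda>x. tr c (real m * (pi / a * x)) * tr c' (real m' * (pi / a * x))) (fst y) *
          (\<lambda>x. tr e (real n * (pi / b * x)) * tr e' (real n' * (pi / b * x))) (snd y))"
      by (simp add: mult_ac)
    also have "\<dots> = integral {-a..a} (\<lambda>x. tr c (real m * (pi / a * x)) * tr c' (real m' * (pi / a * x))) *
         integral {-b..b} (\<lambda>x. tr e (real n * (pi / b * x)) * tr e' (real n' * (pi / b * x)))"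
      by (intro integral_cell_product continuous_intros)
    finally show ?thesis
      by (simp only: integral_unique[OF trig_orthogonal[OF ab(1)]] integral_unique[OF trig_orthogonal[OF ab(2)]])
  qed
  \<comment> \<open>For a sine of frequency zero the weight is 0, and so is the quotient, by the
    convention for division by zero; the identity survives because such a coefficient is 0
    too.\<close>
  have A: "?A m n * (a * wt c m * (b * wt e n)) = co a b f c e m n" for m n
  proof (cases "wt c m = 0 \<or> wt e n = 0")
    case True
    then have "(m = 0 \<and> \<not> c) \<or> (n = 0 \<and> \<not> e)" by (auto simp: wt_def split: if_splits)
    then have "co a b f c e m n = 0" unfolding co_def tr_def by auto
    then show ?thesis by simp
  next
    case False
    then show ?thesis using ab by simp
  qed
  have "f y - ?S y = 0"
  proof (rule fourier_coefficients_zero[of a b "\<lambda>y. f y - ?S y", OF _ ab _ y])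
    show "continuous_on ?B (\<lambda>y. f y - ?S y)" by (intro continuous_intros cf)
    fix c' e' m' n'
    have "co a b (\<lambda>y. f y - ?S y) c' e' m' n' = integral ?B (\<lambda>y. f y * ?t c' e' m' n' y - (\<Sum>m\<le>N. \<Sum>n\<le>L. ?A m n * (?t c e m n y * ?t c' e' m' n' y)))"
      unfolding co_def by (intro arg_cong2[of _ _ _ _ integral] refl ext) (simp add: left_diff_distrib sum_distrib_right mult.assoc)
    also have "\<dots> = co a b f c' e' m' n' - (\<Sum>m\<le>N. \<Sum>n\<le>L. ?A m n * integral ?B (\<lambda>y. ?t c e m n y * ?t c' e' m' n' y))"
      unfolding co_def
      by (intro integral_unique has_integral_diff has_integral_sum has_integral_mult_right integrable_integral
            finite_atMost integrable_continuous continuous_intros cf)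
    also have "\<dots> = 0"
    proof (cases "c' = c \<and> e' = e \<and> m' \<le> N \<and> n' \<le> L")
      case True
      then show ?thesis unfolding tt
        using A[of m' n'] by (simp add: if_distrib[of "\<lambda>x. _ * x"] if_distrib[of "\<lambda>x. x * _"] sum.delta cong: if_cong)
    next
      case False
      have "integral ?B (\<lambda>y. ?t c e m n y * ?t c' e' m' n' y) = 0" if "m \<le> N" "n \<le> L" for m n
        unfolding tt using that False by auto
      then show ?thesis using H[OF False] by simp
    qed
    finally show "co a b (\<lambda>y. f y - ?S y) c' e' m' n' = 0" .
  qed
  then show ?thesis by simp
qed

text \<open>Multiplication by the cosine of frequency \<open>2 * L\<close> sends frequency
  \<open>n\<close> to \<open>2 * L + n\<close> and \<open>2 * L - n\<close>; for \<open>n\<close> in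
  the band only \<open>n = L\<close> leads back into it. The sign is that of cos 2x in cos^2 x = (1
  + cos 2x) / 2 and sin^2 x = (1 - cos 2x) / 2. \<open>H0\<close> removes \<open>m = 0\<close>,
  where the weight is not 1.\<close>

lemma top_harmonic_of_square:
  fixes f :: "real \<times> real \<Rightarrow> real"
  assumes cf: "continuous_on (cbox (-a,-b) (a,b)) f" and ab: "a > 0" "b > 0"
    and H: "\<And>c' e' m n. \<not> (c' = c \<and> e' = e \<and> m \<le> N \<and> n \<le> L) \<Longrightarrow> co a b f c' e' m n = 0"
    and H0: "co a b f c e 0 L = 0" and L: "L \<ge> 1"
  shows "integral (cbox (-a,-b) (a,b)) (\<lambda>y. (f y)\<^sup>2 * cos (real (2 * L) * (pi / b * snd y)))
     = (if e then 1 else -1) / (2 * a * b) * (\<Sum>m=1..N. (co a b f c e m L)\<^sup>2)"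
proof -
  let ?B = "cbox (-a,-b) (a,b)"
  let ?t = "\<lambda>c e m n y. tr c (real m * (pi / a * fst y)) * tr e (real n * (pi / b * snd y))"
  let ?A = "\<lambda>m n. co a b f c e m n / (a * wt c m * (b * wt e n))"
  let ?sg = "if e then 1 else -1::real"
  let ?C = "\<lambda>y. cos (real (2 * L) * (pi / b * snd y))"
  have tc: "tr e (real n * x) * cos (real (2*L) * x) = (tr e (real (n + 2*L) * x) + ?sg * tr e (real (2*L - n) * x)) / 2"
    if "n \<le> L" for n and x :: real
  proof -
    have "real (n + 2*L) * x = real n * x + real (2*L) * x" "real (2*L - n) * x = real (2*L) * x - real n * x"
      using that by (simp_all add: algebra_simps of_nat_diff)
    then show ?thesis by (simp add: tr_def cos_add cos_diff sin_add sin_diff)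
  qed
  have J: "integral ?B (\<lambda>y. f y * ?t c e m n y * ?C y) = (if n = L then ?sg * co a b f c e m L / 2 else 0)" if n: "n \<le> L" for m n
  proof -
    have "integral ?B (\<lambda>y. f y * ?t c e m n y * ?C y)
       = integral ?B (\<lambda>y. (f y * ?t c e m (n + 2*L) y + ?sg * (f y * ?t c e m (2*L - n) y)) / 2)"
    proof (intro arg_cong2[of _ _ _ _ integral] refl ext)
      fix y
      have "f y * ?t c e m n y * ?C y = f y * tr c (real m * (pi / a * fst y)) * (tr e (real n * (pi / b * snd y)) * ?C y)"
        by (simp add: mult_ac)
      then show "f y * ?t c e m n y * ?C y = (f y * ?t c e m (n + 2*L) y + ?sg * (f y * ?t c e m (2*L - n) y)) / 2"
        unfolding tc[OF n] by (simp add: algebra_simps)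
    qed
    also have "\<dots> = (co a b f c e m (n + 2*L) + ?sg * co a b f c e m (2*L - n)) / 2"
      unfolding co_def
      by (intro integral_unique has_integral_divide has_integral_add has_integral_mult_right integrable_integral co_integrable[OF cf])
    also have "co a b f c e m (n + 2*L) = 0" using L by (intro H) auto
    also have "co a b f c e m (2*L - n) = (if n = L then co a b f c e m L else 0)"
      using n by (auto intro!: H)
    finally show ?thesis by auto
  qed
  \<comment> \<open>Only one factor of the square is expanded; with the other left as
    \<open>f\<close>, each summand integrates to a combination of coefficients again.\<close>
  have "integral ?B (\<lambda>y. (f y)\<^sup>2 * ?C y) = integral ?B (\<lambda>y. \<Sum>m\<le>N. \<Sum>n\<le>L. ?A m n * (f y * ?t c e m n y * ?C y))"
  proof (rule integral_cong)
    fix y assume y: "y \<in> ?B"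
    have "(f y)\<^sup>2 * ?C y = f y * ?C y * f y" by (simp add: power2_eq_square)
    also have "\<dots> = f y * ?C y * (\<Sum>m\<le>N. \<Sum>n\<le>L. ?A m n * ?t c e m n y)"
      by (rule arg_cong[OF finite_fourier_expansion[OF cf ab H y]])
    finally show "(f y)\<^sup>2 * ?C y = (\<Sum>m\<le>N. \<Sum>n\<le>L. ?A m n * (f y * ?t c e m n y * ?C y))"
      by (simp add: sum_distrib_left mult_ac)
  qed
  also have "\<dots> = (\<Sum>m\<le>N. \<Sum>n\<le>L. ?A m n * integral ?B (\<lambda>y. f y * ?t c e m n y * ?C y))"
    by (intro integral_unique has_integral_sum has_integral_mult_right integrable_integral
          finite_atMost integrable_continuous continuous_intros cf)
  also have "\<dots> = (\<Sum>m\<le>N. ?A m L * (?sg * co a b f c e m L / 2))"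
  proof (intro sum.cong refl)
    fix m
    have "(\<Sum>n\<le>L. ?A m n * integral ?B (\<lambda>y. f y * ?t c e m n y * ?C y))
       = (\<Sum>n\<le>L. if n = L then ?A m L * (?sg * co a b f c e m L / 2) else 0)"
    proof (intro sum.cong refl)
      fix n assume "n \<in> {..L}"
      then show "?A m n * integral ?B (\<lambda>y. f y * ?t c e m n y * ?C y) = (if n = L then ?A m L * (?sg * co a b f c e m L / 2) else 0)"
        by (subst J) auto
    qed
    then show "(\<Sum>n\<le>L. ?A m n * integral ?B (\<lambda>y. f y * ?t c e m n y * ?C y)) = ?A m L * (?sg * co a b f c e m L / 2)"
      by (simp add: sum.delta)
  qed
  also have "\<dots> = (\<Sum>m=1..N. ?A m L * (?sg * co a b f c e m L / 2))"
    using H0 by (intro sum.mono_neutral_right) (auto simp: not_le)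
  also have "\<dots> = (\<Sum>m=1..N. ?sg / (2 * a * b) * (co a b f c e m L)\<^sup>2)"
    using L by (intro sum.cong) (auto simp: wt_def power2_eq_square)
  finally show ?thesis by (simp add: sum_distrib_left)
qed

section \<open>Vertical mode profiles in a shear flow\<close>

lemma mono_within_interval:
  fixes F :: "real \<Rightarrow> real"
  assumes "\<And>z. z \<in> {a..b} \<Longrightarrow> (F has_real_derivative F' z) (at z within {a..b})"
    and "\<And>z. z \<in> {a..b} \<Longrightarrow> F' z \<ge> 0" and "a \<le> x" "x \<le> y" "y \<le> b"
  shows "F x \<le> F y"
proof (rule DERIV_nonneg_imp_increasing_open[OF assms(4)])
  show "\<exists>w. (F has_real_derivative w) (at z) \<and> w \<ge> 0" if "x < z" "z < y" for z
    using assms(1,2)[of z] assms(3-5) that by (intro exI[of _ "F' z"]) (auto simp: at_within_interior[of z "{a..b}"])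
  have "continuous_on {a..b} F" by (rule DERIV_continuous_on) (use assms(1) in blast)
  then show "continuous_on {x..y} F" by (rule continuous_on_subset) (use assms(3-5) in auto)
qed

locale shear_flow =
  fixes d :: real and U U' :: "real \<Rightarrow> real"
  assumes d: "d > 0"
    and dU: "\<And>z. z \<in> {-d..0} \<Longrightarrow> (U has_real_derivative U' z) (at z within {-d..0})"
    and cU': "continuous_on {-d..0} U'"
    and U0: "\<And>z. z \<in> {-d..0} \<Longrightarrow> U z \<noteq> 0"
begin

lemma cU: "continuous_on {-d..0} U"
  by (rule DERIV_continuous_on) (use dU in blast)

lemma U_bounds: obtains m M where "m > 0" "\<And>z. z \<in> {-d..0} \<Longrightarrow> m \<le> (U z)\<^sup>2" "\<And>z. z \<in> {-d..0} \<Longrightarrow> (U z)\<^sup>2 \<le> M" "M > 0"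
proof -
  have c: "continuous_on {-d..0} (\<lambda>z. (U z)\<^sup>2)" by (intro continuous_intros cU)
  have ne: "{-d..0} \<noteq> {}" using d by auto
  obtain x where x: "x \<in> {-d..0}" "\<And>z. z \<in> {-d..0} \<Longrightarrow> (U x)\<^sup>2 \<le> (U z)\<^sup>2"
    using continuous_attains_inf[OF compact_Icc ne c] by blast
  obtain y where y: "y \<in> {-d..0}" "\<And>z. z \<in> {-d..0} \<Longrightarrow> (U z)\<^sup>2 \<le> (U y)\<^sup>2"
    using continuous_attains_sup[OF compact_Icc ne c] by blast
  show ?thesis using that[of "(U x)\<^sup>2" "(U y)\<^sup>2"] x y U0[OF x(1)] U0[OF y(1)] by simp
qed

text \<open>\<open>f\<close> is a Fourier mode of the pressure and \<open>r = - k v / U\<close> the rescaled mode of the vertical velocity.\<close>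

definition mode :: "real \<Rightarrow> (real \<Rightarrow> real) \<Rightarrow> (real \<Rightarrow> real) \<Rightarrow> bool" where
  "mode \<kappa> f r \<longleftrightarrow> (\<forall>z\<in>{-d..0}. (f has_real_derivative (U z)\<^sup>2 * r z) (at z within {-d..0}) \<and>
      (r has_real_derivative \<kappa> * f z / (U z)\<^sup>2) (at z within {-d..0})) \<and> r (-d) = 0"

lemma modeD:
  assumes "mode \<kappa> f r"
  shows "z \<in> {-d..0} \<Longrightarrow> (f has_real_derivative (U z)\<^sup>2 * r z) (at z within {-d..0})"
    "z \<in> {-d..0} \<Longrightarrow> (r has_real_derivative \<kappa> * f z / (U z)\<^sup>2) (at z within {-d..0})"
    "r (-d) = 0"
  using assms unfolding mode_def by auto

lemma mode_continuous:
  assumes "mode \<kappa> f r" shows "continuous_on {-d..0} f" "continuous_on {-d..0} r"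
  by (rule DERIV_continuous_on, use modeD[OF assms] in blast)+

text \<open>Gronwall for \<open>y = f^2 + r^2\<close>: since |y'| is at most \<open>C * y\<close>,
  the function \<open>y * exp (- C * z)\<close> is decreasing and \<open>y * exp (C * z)\<close> is
  increasing, which carries the zero at \<open>z0\<close> upwards and downwards.\<close>

lemma mode_unique:
  assumes m: "mode \<kappa> f r" and \<kappa>: "\<kappa> \<ge> 0" and z0: "z0 \<in> {-d..0}" "f z0 = 0" "r z0 = 0" and z: "z \<in> {-d..0}"
  shows "f z = 0 \<and> r z = 0"
proof -
  obtain mm M where b: "mm > 0" "\<And>z. z \<in> {-d..0} \<Longrightarrow> mm \<le> (U z)\<^sup>2" "\<And>z. z \<in> {-d..0} \<Longrightarrow> (U z)\<^sup>2 \<le> M" "M > 0"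
    using U_bounds by blast
  \<comment> \<open>Bounds the factor \<open>U^2 + \<kappa> / U^2\<close> that multiplies
    \<open>2 * f * r\<close> in \<open>y'\<close>; the positive lower bound \<open>mm\<close> exists
    because \<open>U\<close> has no zeros.\<close>
  define C where "C = M + \<kappa> / mm"
  define y where "y z = (f z)\<^sup>2 + (r z)\<^sup>2" for z
  define y' where "y' z = 2 * f z * ((U z)\<^sup>2 * r z) + 2 * r z * (\<kappa> * f z / (U z)\<^sup>2)" for z
  have dy: "(y has_real_derivative y' z) (at z within {-d..0})" if "z \<in> {-d..0}" for z
    unfolding y_def y'_def using modeD(1,2)[OF m that]
    by (auto intro!: derivative_eq_intros simp: algebra_simps)
  have bnd: "\<bar>y' z\<bar> \<le> C * y z" if z: "z \<in> {-d..0}" for z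
  proof -
    have U2: "0 \<le> (U z)\<^sup>2" "(U z)\<^sup>2 \<le> M" "mm \<le> (U z)\<^sup>2" using b z by auto
    have "\<kappa> / (U z)\<^sup>2 \<le> \<kappa> / mm" "\<kappa> / (U z)\<^sup>2 \<ge> 0" using U2 b(1) \<kappa> by (auto intro!: divide_left_mono mult_pos_pos)
    then have c: "0 \<le> (U z)\<^sup>2 + \<kappa> / (U z)\<^sup>2" "(U z)\<^sup>2 + \<kappa> / (U z)\<^sup>2 \<le> C" using U2 unfolding C_def by auto
    have "y' z = (2 * f z * r z) * ((U z)\<^sup>2 + \<kappa> / (U z)\<^sup>2)" unfolding y'_def by (simp add: algebra_simps)
    then have "\<bar>y' z\<bar> = \<bar>2 * f z * r z\<bar> * ((U z)\<^sup>2 + \<kappa> / (U z)\<^sup>2)" using c by (simp add: abs_mult)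
    also have "\<dots> \<le> y z * C"
    proof (intro mult_mono c)
      have "0 \<le> (f z - r z)\<^sup>2" "0 \<le> (f z + r z)\<^sup>2" by simp_all
      then show "\<bar>2 * f z * r z\<bar> \<le> y z" unfolding y_def by (auto simp: power2_eq_square algebra_simps abs_if)
    qed (auto simp: y_def)
    finally show ?thesis by (simp add: mult.commute)
  qed
  have "y z = 0"
  proof (cases "z \<ge> z0")
    case True
    have "- (y z0 * exp (- C * z0)) \<le> - (y z * exp (- C * z))"
    proof (rule mono_within_interval[of "-d" 0 "\<lambda>z. - (y z * exp (- C * z))" "\<lambda>z. (C * y z - y' z) * exp (- C * z)"])
      fix z assume zz: "z \<in> {-d..0}"
      show "((\<lambda>z. - (y z * exp (- C * z))) has_real_derivative (C * y z - y' z) * exp (- C * z)) (at z within {-d..0})"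
        using dy[OF zz] by (auto intro!: derivative_eq_intros simp: algebra_simps)
      show "0 \<le> (C * y z - y' z) * exp (- C * z)" using bnd[OF zz] by (simp add: abs_le_iff)
    qed (use z z0 True in auto)
    moreover have "y z0 = 0" using z0 by (simp add: y_def)
    ultimately have "y z \<le> 0" by (simp add: mult_le_0_iff)
    moreover have "y z \<ge> 0" by (simp add: y_def)
    ultimately show ?thesis by simp
  next
    case False
    have "y z * exp (C * z) \<le> y z0 * exp (C * z0)"
    proof (rule mono_within_interval[of "-d" 0 "\<lambda>z. y z * exp (C * z)" "\<lambda>z. (C * y z + y' z) * exp (C * z)"])
      fix z assume zz: "z \<in> {-d..0}"
      show "((\<lambda>z. y z * exp (C * z)) has_real_derivative (C * y z + y' z) * exp (C * z)) (at z within {-d..0})"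
        using dy[OF zz] by (auto intro!: derivative_eq_intros simp: algebra_simps)
      show "0 \<le> (C * y z + y' z) * exp (C * z)" using bnd[OF zz] by (simp add: abs_le_iff)
    qed (use z z0 False in auto)
    moreover have "y z0 = 0" using z0 by (simp add: y_def)
    ultimately have "y z \<le> 0" by (simp add: mult_le_0_iff)
    moreover have "y z \<ge> 0" by (simp add: y_def)
    ultimately show ?thesis by simp
  qed
  then show ?thesis unfolding y_def by (simp add: sum_power2_eq_zero_iff)
qed

text \<open>The quantity \<open>f r - \<alpha> f\<^sup>2\<close>, with \<open>\<alpha>\<close> growing linearly from \<open>0\<close> at the bottom to \<open>1/\<sigma>\<close> at the
  top, is increasing once \<open>\<kappa>\<close> is large; at the top this contradicts the dynamic condition.\<close>

lemma high_modes_vanish: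
  assumes "g > 0" "\<sigma> > 0"
  obtains K0 where "\<And>\<kappa> k f r z. mode \<kappa> f r \<Longrightarrow> \<kappa> \<ge> K0 \<Longrightarrow> \<kappa> \<ge> 0 \<Longrightarrow> k\<^sup>2 \<le> \<kappa> \<Longrightarrow>
      k\<^sup>2 * f 0 = (g + \<sigma> * \<kappa>) * r 0 \<Longrightarrow> z \<in> {-d..0} \<Longrightarrow> f z = 0 \<and> r z = 0"
proof -
  obtain mm M where b: "mm > 0" "\<And>z. z \<in> {-d..0} \<Longrightarrow> mm \<le> (U z)\<^sup>2" "\<And>z. z \<in> {-d..0} \<Longrightarrow> (U z)\<^sup>2 \<le> M" "M > 0"
    using U_bounds by blast
  \<comment> \<open>Chosen so that \<open>\<kappa> / U^2\<close> dominates
    \<open>\<alpha>^2 * U^2 + 1 / (\<sigma> * d)\<close> whenever \<open>U^2 \<le> M\<close> and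
    \<open>\<alpha> \<le> 1 / \<sigma>\<close>; here \<open>1 / (\<sigma> * d)\<close> is the slope
    of \<open>\<alpha>\<close>. This makes the coefficient of \<open>f^2\<close> in
    \<open>?\<Phi>'\<close> nonnegative.\<close>
  define K0 where "K0 = M * (M / \<sigma>\<^sup>2 + 1 / (\<sigma> * d))"
  have "f z = 0 \<and> r z = 0" if m: "mode \<kappa> f r" and \<kappa>: "\<kappa> \<ge> K0" "\<kappa> \<ge> 0" "k\<^sup>2 \<le> \<kappa>"
    and bc: "k\<^sup>2 * f 0 = (g + \<sigma> * \<kappa>) * r 0" and z: "z \<in> {-d..0}" for \<kappa> k f r z
  proof -
    define \<alpha> where "\<alpha> z = (z + d) / (d * \<sigma>)" for z
    let ?\<Phi> = "\<lambda>z. f z * r z - \<alpha> z * (f z)\<^sup>2"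
    let ?\<Phi>' = "\<lambda>z. (U z)\<^sup>2 * (r z - \<alpha> z * f z)\<^sup>2 + (f z)\<^sup>2 * (\<kappa> / (U z)\<^sup>2 - (\<alpha> z)\<^sup>2 * (U z)\<^sup>2 - 1 / (\<sigma> * d))"
    have "?\<Phi> (-d) \<le> ?\<Phi> 0"
    proof (rule mono_within_interval[of "-d" 0 ?\<Phi> ?\<Phi>'])
      fix z assume zz: "z \<in> {-d..0}"
      have "(\<alpha> has_real_derivative 1 / (\<sigma> * d)) (at z within {-d..0})"
        unfolding \<alpha>_def using d assms by (auto intro!: derivative_eq_intros simp: field_simps)
      then have "(?\<Phi> has_real_derivative (f z * (\<kappa> * f z / (U z)\<^sup>2) + (U z)\<^sup>2 * r z * r z) -
          (\<alpha> z * (2 * f z * ((U z)\<^sup>2 * r z)) + 1 / (\<sigma> * d) * (f z)\<^sup>2)) (at z within {-d..0})"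
        using modeD(1,2)[OF m zz] by (auto intro!: derivative_eq_intros)
      then show "(?\<Phi> has_real_derivative ?\<Phi>' z) (at z within {-d..0})"
        by (rule DERIV_cong) (simp add: power2_eq_square algebra_simps)
      have U2: "(U z)\<^sup>2 > 0" "(U z)\<^sup>2 \<le> M" using b(3)[OF zz] U0[OF zz] by auto
      have "0 \<le> \<alpha> z" "\<alpha> z \<le> 1 / \<sigma>" using zz d assms unfolding \<alpha>_def by (auto simp: field_simps mult_nonneg_nonpos)
      then have "(\<alpha> z)\<^sup>2 * (U z)\<^sup>2 \<le> (1/\<sigma>)\<^sup>2 * M" using U2 by (intro mult_mono power_mono) auto
      moreover have "\<kappa> / (U z)\<^sup>2 \<ge> K0 / M"
      proof -
        have "K0 / M \<le> \<kappa> / M" using \<kappa> b by (intro divide_right_mono) auto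
        also have "\<dots> \<le> \<kappa> / (U z)\<^sup>2" using \<kappa> U2 b by (intro divide_left_mono) auto
        finally show ?thesis .
      qed
      moreover have "K0 / M = (1/\<sigma>)\<^sup>2 * M + 1 / (\<sigma> * d)" using b unfolding K0_def by (simp add: power_divide)
      ultimately show "0 \<le> ?\<Phi>' z" by (intro add_nonneg_nonneg mult_nonneg_nonneg) auto
    qed (use d in auto)
    \<comment> \<open>\<open>?\<Phi>\<close> vanishes at the bottom, and \<open>\<alpha>\<close> is
      \<open>1 / \<sigma>\<close> at the top. Together with the boundary condition and
      \<open>k^2 \<le> \<kappa>\<close> this leaves \<open>g / \<sigma> * (f 0)^2 \<le> 0\<close>:
      the surface tension terms balance and gravity decides.\<close>
    then have fr: "f 0 * r 0 \<ge> (f 0)\<^sup>2 / \<sigma>" using modeD(3)[OF m] d by (simp add: \<alpha>_def)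
    have s: "g + \<sigma> * \<kappa> > 0" using assms \<kappa> by (simp add: add_pos_nonneg)
    have "(g + \<sigma> * \<kappa>) * ((f 0)\<^sup>2 / \<sigma>) \<le> (g + \<sigma> * \<kappa>) * (f 0 * r 0)" using fr s by (intro mult_left_mono) auto
    also have "\<dots> = k\<^sup>2 * (f 0)\<^sup>2" using bc by (simp add: power2_eq_square algebra_simps)
    also have "\<dots> \<le> \<kappa> * (f 0)\<^sup>2" using \<kappa> by (intro mult_right_mono) auto
    finally have "g / \<sigma> * (f 0)\<^sup>2 \<le> 0" using assms by (simp add: field_simps)
    then have "(f 0)\<^sup>2 \<le> 0" using assms by (simp add: divide_le_0_iff mult_le_0_iff)
    then have f0: "f 0 = 0" by simp
    then have "r 0 = 0" using bc s by simp
    then show ?thesis using mode_unique[OF m \<kappa>(2) _ f0 _ z] d by simp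
  qed
  then show ?thesis using that by blast
qed

text \<open>\<open>f * r\<close> has the nonnegative derivative
  \<open>U^2 r^2 + \<kappa> f^2 / U^2\<close> and starts from 0 at the bottom. Were it not positive
  at \<open>z\<close>, it would be constant below \<open>z\<close>; then both profiles vanish at a
  point there, and by uniqueness everywhere.\<close>

lemma mode_positive:
  assumes m: "mode \<kappa> f r" and \<kappa>: "\<kappa> > 0" and nz: "\<exists>z\<in>{-d..0}. f z \<noteq> 0" and z: "-d < z" "z \<le> 0"
  shows "f z * r z > 0"
proof (rule ccontr)
  assume neg: "\<not> f z * r z > 0"
  let ?e = "\<lambda>z. f z * r z"
  let ?e' = "\<lambda>z. (U z)\<^sup>2 * (r z)\<^sup>2 + \<kappa> * (f z)\<^sup>2 / (U z)\<^sup>2"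
  have de: "(?e has_real_derivative ?e' z) (at z within {-d..0})" if "z \<in> {-d..0}" for z
    using modeD(1,2)[OF m that] by (auto intro!: derivative_eq_intros simp: power2_eq_square)
  have mono: "?e x \<le> ?e y" if "-d \<le> x" "x \<le> y" "y \<le> 0" for x y
    by (rule mono_within_interval[of "-d" 0 ?e ?e']) (use de that \<kappa> in auto)
  have e0: "?e w = 0" if "-d \<le> w" "w \<le> z" for w
    using mono[of "-d" w] mono[of w z] that z modeD(3)[OF m] neg by (intro antisym) (simp_all add: not_less)
  define w where "w = (z - d) / 2"
  have w: "-d < w" "w < z" using z unfolding w_def by auto
  have "(?e has_real_derivative ?e' w) (at w)"
    using de[of w] w z by (simp add: at_within_interior[of w "{-d..0}"])
  moreover have "(?e has_real_derivative 0) (at w)"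
  proof -
    have "\<forall>\<^sub>F x in nhds w. ?e x = 0"
      by (rule eventually_mono[OF eventually_nhds_in_open[of "{-d<..<z}" w]]) (use w e0 in \<open>auto simp del: mult_eq_0_iff\<close>)
    then show ?thesis using DERIV_cong_ev[OF refl, of ?e "\<lambda>_. 0" w 0 0] by simp
  qed
  ultimately have "?e' w = 0" using DERIV_unique by blast
  moreover have "(U w)\<^sup>2 * (r w)\<^sup>2 \<ge> 0" "\<kappa> * (f w)\<^sup>2 / (U w)\<^sup>2 \<ge> 0" using \<kappa> by auto
  ultimately have "(U w)\<^sup>2 * (r w)\<^sup>2 = 0" "\<kappa> * (f w)\<^sup>2 / (U w)\<^sup>2 = 0" by linarith+
  then have "f w = 0" "r w = 0" using U0[of w] w z \<kappa> by auto
  then show False using mode_unique[OF m less_imp_le[OF \<kappa>], of w] nz w z by auto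
qed

text \<open>Where \<open>U' \<noteq> 0\<close>, differentiating the balance gives \<open>\<Sum> f r = - U U' \<Sum> r\<^sup>2 / k\<^sup>2\<close>. The left side is positive above
  the bottom, so \<open>U'\<close> cannot reach \<open>0\<close> there and the identity extends to the whole interval. At the bottom
  \<open>r\<close> vanishes to first order and \<open>f\<close> does not, so the right side is of higher order than the left.\<close>

lemma no_balanced_modes:
  fixes k :: "nat \<Rightarrow> real"
  assumes fin: "finite S" "S \<noteq> {}" and k: "\<And>i. i \<in> S \<Longrightarrow> k i > 0"
    and m: "\<And>i. i \<in> S \<Longrightarrow> mode ((k i)\<^sup>2 + l\<^sup>2) (f i) (r i)"
    and nz: "\<And>i. i \<in> S \<Longrightarrow> \<exists>z\<in>{-d..0}. f i z \<noteq> 0"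
    and bal: "\<And>z. -d < z \<Longrightarrow> z < 0 \<Longrightarrow> U' z \<noteq> 0 \<Longrightarrow>
       (\<Sum>i\<in>S. (((k i)\<^sup>2 - l\<^sup>2) * (f i z)\<^sup>2 + (U z)^4 * (r i z)\<^sup>2) / (k i)\<^sup>2) = 0"
  shows "U constant_on {-d..0}"
proof -
  define X where "X z = (\<Sum>i\<in>S. f i z * r i z + U z * U' z * (r i z)\<^sup>2 / (k i)\<^sup>2)" for z
  define T where "T z = (\<Sum>i\<in>S. (((k i)\<^sup>2 - l\<^sup>2) * (f i z)\<^sup>2 + (U z)^4 * (r i z)\<^sup>2) / (k i)\<^sup>2)" for z
  define Z where "Z = {z \<in> {-d<..<0}. U' z \<noteq> 0}"
  have \<kappa>: "(k i)\<^sup>2 + l\<^sup>2 > 0" if "i \<in> S" for i using k[OF that] by (simp add: add_pos_nonneg)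
  have Zeq: "Z = {-d<..<0} \<inter> U' -` (-{0})" unfolding Z_def by auto
  have cU'o: "continuous_on {-d<..<0} U'" using cU' by (rule continuous_on_subset) auto
  have oZ: "openin (top_of_set {-d<..<0}) Z"
    unfolding Zeq by (intro continuous_openin_preimage_gen cU'o) auto
  then have opZ: "open Z" using openin_open_trans open_greaterThanLessThan by blast
  \<comment> \<open>The contribution \<open>- 2 l^2 U^2 f r\<close> of the squared pressure and
    \<open>+ 2 l^2 U^2 f r\<close> of the squared velocity cancel, so \<open>X\<close> does not
    contain \<open>l\<close>.\<close>
  have dT: "(T has_real_derivative 4 * (U z)\<^sup>2 * X z) (at z)" if z: "z \<in> {-d<..<0}" for z
  proof -
    have zz: "z \<in> {-d..0}" "at z within {-d..0} = at z" using z by (auto simp: at_within_interior[of z "{-d..0}"])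
    have t: "((\<lambda>z. (((k i)\<^sup>2 - l\<^sup>2) * (f i z)\<^sup>2 + (U z)^4 * (r i z)\<^sup>2) / (k i)\<^sup>2) has_real_derivative
       4 * (U z)\<^sup>2 * (f i z * r i z + U z * U' z * (r i z)\<^sup>2 / (k i)\<^sup>2)) (at z)" if i: "i \<in> S" for i
    proof -
      have ki: "k i \<noteq> 0" and Uz: "U z \<noteq> 0" using k[OF i] U0[OF zz(1)] by auto
      note dd = modeD(1,2)[OF m[OF i] zz(1), unfolded zz(2)] dU[OF zz(1), unfolded zz(2)]
      have "((\<lambda>z. (((k i)\<^sup>2 - l\<^sup>2) * (f i z)\<^sup>2 + (U z)^4 * (r i z)\<^sup>2) / (k i)\<^sup>2) has_real_derivative
       (((k i)\<^sup>2 - l\<^sup>2) * (2 * f i z * ((U z)\<^sup>2 * r i z)) + (4 * (U z)^3 * U' z * (r i z)\<^sup>2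
         + (U z)^4 * (2 * r i z * (((k i)\<^sup>2 + l\<^sup>2) * f i z / (U z)\<^sup>2)))) / (k i)\<^sup>2) (at z)"
        using dd ki by (auto intro!: derivative_eq_intros simp: field_simps)
      moreover have "(U z)^4 * (2 * r i z * (((k i)\<^sup>2 + l\<^sup>2) * f i z / (U z)\<^sup>2)) = (U z)\<^sup>2 * (2 * r i z * (((k i)\<^sup>2 + l\<^sup>2) * f i z))"
        using Uz by (simp add: power4_eq_xxxx power2_eq_square)
      ultimately show ?thesis using ki
        by (elim DERIV_cong) (simp add: field_simps power2_eq_square power3_eq_cube)
    qed
    show ?thesis unfolding T_def[abs_def] X_def sum_distrib_left by (intro DERIV_sum t)
  qed
  have X0: "X z = 0" if z: "z \<in> Z" for z
  proof -
    have zi: "z \<in> {-d<..<0}" using z Z_def by auto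
    have "\<forall>\<^sub>F w in nhds z. T w = 0"
      using eventually_nhds_in_open[OF opZ z] by eventually_elim (use bal in \<open>auto simp: T_def Z_def\<close>)
    then have "(T has_real_derivative 0) (at z)"
      using DERIV_cong_ev[OF refl, of T "\<lambda>_. 0" z 0 0] by simp
    then have "4 * (U z)\<^sup>2 * X z = 0" using dT[OF zi] DERIV_unique by blast
    then show ?thesis using U0[of z] zi by simp
  qed
  have pos: "(\<Sum>i\<in>S. f i z * r i z) > 0" if "z \<in> {-d<..<0}" for z
    using fin that by (intro sum_pos mode_positive[OF m \<kappa> nz]) auto
  have cX: "continuous_on {-d..0} X"
    unfolding X_def[abs_def] using fin mode_continuous[OF m] k
    by (intro continuous_intros cU cU') (auto simp: less_le)
  \<comment> \<open>At a zero of \<open>U'\<close> the value of \<open>X\<close> is the positive sum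
    of the products \<open>f r\<close>. Hence the open set \<open>Z\<close> is also the zero set of
    a continuous function and relatively closed; connectedness leaves the empty set or the whole
    interval.\<close>
  have Zc: "Z = {z \<in> {-d<..<0}. X z = 0}"
  proof -
    have "X z \<noteq> 0" if "z \<in> {-d<..<0}" "U' z = 0" for z using pos[OF that(1)] that unfolding X_def by simp
    then show ?thesis using X0 unfolding Z_def by auto
  qed
  have "continuous_on {-d<..<0} X" by (rule continuous_on_subset[OF cX]) auto
  then have "closedin (top_of_set {-d<..<0}) Z"
    unfolding Zc by (rule continuous_closedin_preimage_constant)
  then have "Z = {} \<or> Z = {-d<..<0}"
    using oZ connected_Ioo[of "-d" 0] unfolding connected_clopen by blast
  then show ?thesis
  proof
    assume "Z = {}"
    then have z: "U' z = 0" if "z \<in> {-d<..<0}" for z using that Z_def by auto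
    have "U x = U (-d)" if "x \<in> {-d..0}" for x
    proof (cases "x = -d")
      case False
      then have "-d < x" using that by auto
      then show ?thesis
      proof (rule DERIV_isconst_end)
        show "continuous_on {-d..x} U" using cU by (rule continuous_on_subset) (use that in auto)
        fix w assume "-d < w" "w < x"
        then have w: "w \<in> {-d<..<0}" using that by auto
        then show "(U has_real_derivative 0) (at w)"
          using dU[of w] z[OF w] by (simp add: at_within_interior[of w "{-d..0}"])
      qed
    qed auto
    then show ?thesis unfolding constant_on_def by blast
  next
    assume "Z = {-d<..<0}"
    then have X0: "X z = 0" if "z \<in> {-d<..<0}" for z using X0 that by auto
    \<comment> \<open>\<open>X\<close> tends to 0 at the bottom because every \<open>r\<close> does,
      so it is divided by \<open>z + d\<close>: the quotient \<open>r / (z + d)\<close> tends to a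
      positive multiple of \<open>f (- d)\<close>, while the term with \<open>U'\<close> keeps
      another factor \<open>r\<close> and drops out.\<close>
    let ?F = "at (-d) within {-d..0}"
    have bot: "?F \<noteq> bot" using d by (simp add: at_within_Icc_at_right)
    have ev: "\<forall>\<^sub>F z in ?F. z \<in> {-d<..<0}"
    proof -
      have "\<forall>\<^sub>F z in ?F. z \<in> {-d..0} \<and> z \<noteq> -d" by (simp add: eventually_at_filter)
      moreover have "\<forall>\<^sub>F z in ?F. z < 0" using d by (intro order_tendstoD(2)[OF tendsto_ident_at]) auto
      ultimately show ?thesis by eventually_elim auto
    qed
    have dm: "-d \<in> {-d..0}" using d by auto
    have rl: "((\<lambda>z. r i z / (z + d)) \<longlongrightarrow> ((k i)\<^sup>2 + l\<^sup>2) * f i (-d) / (U (-d))\<^sup>2) ?F" if i: "i \<in> S" for i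
      using modeD(2)[OF m[OF i] dm] modeD(3)[OF m[OF i]]
      by (simp add: has_field_derivative_iff)
    have cont: "(h \<longlongrightarrow> h (-d)) ?F" if "continuous_on {-d..0} h" for h :: "real \<Rightarrow> real"
      using that dm unfolding continuous_on_def by blast
    have lim: "((\<lambda>z. \<Sum>i\<in>S. f i z * (r i z / (z + d)) + U z * U' z * (r i z / (z + d)) * r i z / (k i)\<^sup>2) \<longlongrightarrow>
       (\<Sum>i\<in>S. f i (-d) * (((k i)\<^sup>2 + l\<^sup>2) * f i (-d) / (U (-d))\<^sup>2)
         + U (-d) * U' (-d) * (((k i)\<^sup>2 + l\<^sup>2) * f i (-d) / (U (-d))\<^sup>2) * r i (-d) / (k i)\<^sup>2)) ?F"
      using k by (intro tendsto_intros rl cont cU cU' mode_continuous[OF m]) (auto simp: less_le)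
    have ev0: "\<forall>\<^sub>F z in ?F. (\<Sum>i\<in>S. f i z * (r i z / (z + d)) + U z * U' z * (r i z / (z + d)) * r i z / (k i)\<^sup>2) = 0"
      using ev
    proof eventually_elim
      case (elim z)
      have "(\<Sum>i\<in>S. f i z * (r i z / (z + d)) + U z * U' z * (r i z / (z + d)) * r i z / (k i)\<^sup>2) = X z / (z + d)"
        unfolding X_def sum_divide_distrib by (intro sum.cong) (auto simp: power2_eq_square add_divide_distrib mult_ac)
      then show ?case using X0[OF elim] by simp
    qed
    have "(\<Sum>i\<in>S. f i (-d) * (((k i)\<^sup>2 + l\<^sup>2) * f i (-d) / (U (-d))\<^sup>2)
         + U (-d) * U' (-d) * (((k i)\<^sup>2 + l\<^sup>2) * f i (-d) / (U (-d))\<^sup>2) * r i (-d) / (k i)\<^sup>2) = 0"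
      by (rule tendsto_unique[OF bot lim tendsto_eventually[OF ev0]])
    moreover have "(\<Sum>i\<in>S. f i (-d) * (((k i)\<^sup>2 + l\<^sup>2) * f i (-d) / (U (-d))\<^sup>2)
         + U (-d) * U' (-d) * (((k i)\<^sup>2 + l\<^sup>2) * f i (-d) / (U (-d))\<^sup>2) * r i (-d) / (k i)\<^sup>2) > 0"
    proof (intro sum_pos fin)
      fix i assume i: "i \<in> S"
      have "f i (-d) \<noteq> 0"
        using mode_unique[OF m[OF i] _ dm _ modeD(3)[OF m[OF i]]] nz[OF i] \<kappa>[OF i] by force
      then have "((k i)\<^sup>2 + l\<^sup>2) * (f i (-d))\<^sup>2 / (U (-d))\<^sup>2 > 0" using \<kappa>[OF i] U0[OF dm] by simp
      then show "0 < f i (-d) * (((k i)\<^sup>2 + l\<^sup>2) * f i (-d) / (U (-d))\<^sup>2)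
         + U (-d) * U' (-d) * (((k i)\<^sup>2 + l\<^sup>2) * f i (-d) / (U (-d))\<^sup>2) * r i (-d) / (k i)\<^sup>2"
        using modeD(3)[OF m[OF i]] by (simp add: power2_eq_square mult_ac)
    qed
    ultimately show ?thesis by simp
  qed
qed

end

section \<open>Periodic functions on the slab\<close>

definition pt :: "real \<Rightarrow> real \<Rightarrow> real \<Rightarrow> real^3" where
  "pt s t z = s *\<^sub>R axis 1 1 + t *\<^sub>R axis 2 1 + z *\<^sub>R axis 3 1"

lemma pt_nth [simp]: "pt s t z $ 1 = s" "pt s t z $ 2 = t" "pt s t z $ 3 = z"
  by (simp_all add: pt_def axis_def)

lemma pt_eta: "pt (x $ 1) (x $ 2) (x $ 3) = x"
  by (simp add: vec_eq_iff forall_3)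

lemma continuous_on_pt [continuous_intros]:
  assumes "continuous_on A f" "continuous_on A g" "continuous_on A h"
  shows "continuous_on A (\<lambda>x. pt (f x) (g x) (h x))"
  unfolding pt_def by (intro continuous_intros assms)

lemma has_derivative_pt:
  "((\<lambda>s. pt s t z) has_derivative (\<lambda>h. h *\<^sub>R axis 1 1)) F"
  "((\<lambda>t. pt s t z) has_derivative (\<lambda>h. h *\<^sub>R axis 2 1)) F"
  "((\<lambda>z. pt s t z) has_derivative (\<lambda>h. h *\<^sub>R axis 3 1)) F"
  unfolding pt_def by (auto intro!: derivative_eq_intros)

lemma has_derivative_nth: "((\<lambda>x. x $ i) has_derivative (\<lambda>h. h $ i)) F"
  by (rule bounded_linear_imp_has_derivative[OF bounded_linear_vec_nth])

lemma integral_cell_reflect1: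
  fixes g :: "real \<times> real \<Rightarrow> real"
  assumes c: "continuous_on (cbox (-a,-b) (a,b)) g"
  shows "integral (cbox (-a,-b) (a,b)) (\<lambda>y. g (- fst y, snd y)) = integral (cbox (-a,-b) (a,b)) g"
proof -
  have c': "continuous_on (cbox (-a,-b) (a,b)) (\<lambda>y. g (- fst y, snd y))"
    by (rule continuous_on_compose2[OF c]) (auto intro!: continuous_intros simp: cbox_Pair_eq)
  show ?thesis
    unfolding integral_prod_continuous[OF c] integral_prod_continuous[OF c']
    using integral_reflect[of a "-a" "\<lambda>x. integral (cbox (-b) b) (\<lambda>y. g (x, y))"] by simp
qed

lemma integral_cell_reflect2:
  fixes g :: "real \<times> real \<Rightarrow> real"
  assumes c: "continuous_on (cbox (-a,-b) (a,b)) g"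
  shows "integral (cbox (-a,-b) (a,b)) (\<lambda>y. g (fst y, - snd y)) = integral (cbox (-a,-b) (a,b)) g"
proof -
  have c': "continuous_on (cbox (-a,-b) (a,b)) (\<lambda>y. g (fst y, - snd y))"
    by (rule continuous_on_compose2[OF c]) (auto intro!: continuous_intros simp: cbox_Pair_eq)
  show ?thesis
    unfolding integral_prod_continuous[OF c] integral_prod_continuous[OF c']
    using integral_reflect[of b "-b" "\<lambda>y. g (x, y)" for x] by simp
qed

locale slab =
  fixes d l1 l2 :: real
  assumes d_pos: "d > 0" and l_pos: "l1 > 0" "l2 > 0"
begin

abbreviation D :: "(real^3) set" where "D \<equiv> Omega_closed d"

lemma in_D: "x \<in> D \<longleftrightarrow> x $ 3 \<in> {-d..0}"
  by (simp add: Omega_closed_def)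

text \<open>The gradient is carried along as an explicit vector field: derivatives of composite
  expressions arise by chaining closure rules and reading off components. Its continuity up to the
  walls is what integration over horizontal sections uses.\<close>

definition C1 :: "(real^3 \<Rightarrow> real) \<Rightarrow> (real^3 \<Rightarrow> real^3) \<Rightarrow> bool" where
  "C1 f f' \<longleftrightarrow> (\<forall>x\<in>D. (f has_derivative (\<lambda>h. f' x \<bullet> h)) (at x within D)) \<and> continuous_on D f' \<and>
     periodic_on l1 l2 D f \<and> periodic_on l1 l2 D f'"

lemma C1_cont: "C1 f f' \<Longrightarrow> continuous_on D f"
  unfolding C1_def continuous_on_eq_continuous_within using has_derivative_continuous by blast

lemma C1_cont': "C1 f f' \<Longrightarrow> continuous_on D (\<lambda>x. f' x $ i)"
  unfolding C1_def by (auto intro: continuous_intros)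

lemma C1_periodic: "C1 f f' \<Longrightarrow> periodic_on l1 l2 D f" "C1 f f' \<Longrightarrow> periodic_on l1 l2 D (\<lambda>x. f' x $ i)"
  unfolding C1_def periodic_on_def by auto

lemma C1_const: "C1 (\<lambda>x. k) (\<lambda>x. 0)"
  unfolding C1_def periodic_on_def by (auto intro!: derivative_eq_intros)

lemma C1_add: "C1 f f' \<Longrightarrow> C1 g g' \<Longrightarrow> C1 (\<lambda>x. f x + g x) (\<lambda>x. f' x + g' x)"
  unfolding C1_def periodic_on_def
  by (auto intro!: derivative_eq_intros continuous_intros simp: inner_left_distrib)

lemma C1_diff: "C1 f f' \<Longrightarrow> C1 g g' \<Longrightarrow> C1 (\<lambda>x. f x - g x) (\<lambda>x. f' x - g' x)"
  unfolding C1_def periodic_on_def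
  by (auto intro!: derivative_eq_intros continuous_intros simp: inner_left_distrib inner_diff_left)

lemma C1_mult: "C1 f f' \<Longrightarrow> C1 g g' \<Longrightarrow> C1 (\<lambda>x. f x * g x) (\<lambda>x. f x *\<^sub>R g' x + g x *\<^sub>R f' x)"
proof -
  assume a: "C1 f f'" "C1 g g'"
  note c = C1_cont[OF a(1)] C1_cont[OF a(2)]
  show ?thesis using a unfolding C1_def periodic_on_def
    by (auto intro!: derivative_eq_intros continuous_intros c simp: inner_left_distrib algebra_simps)
qed

lemma C1_vertical:
  assumes "\<And>z. z \<in> {-d..0} \<Longrightarrow> (g has_real_derivative g' z) (at z within {-d..0})" "continuous_on {-d..0} g'"
  shows "C1 (\<lambda>x. g (x $ 3)) (\<lambda>x. axis 3 (g' (x $ 3)))"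
  unfolding C1_def
proof (intro conjI ballI)
  fix x assume x: "x \<in> D"
  have im: "(\<lambda>x. x $ 3) ` D \<subseteq> {-d..0}" by (auto simp: in_D)
  have "(g has_derivative (\<lambda>h. g' (x $ 3) * h)) (at (x $ 3) within (\<lambda>x. x $ 3) ` D)"
    using assms(1)[of "x $ 3"] x im unfolding has_field_derivative_def in_D
    by (auto intro: has_derivative_subset)
  from has_derivative_in_compose[OF has_derivative_nth this]
  show "((\<lambda>x. g (x $ 3)) has_derivative (\<lambda>h. axis 3 (g' (x $ 3)) \<bullet> h)) (at x within D)"
    by (simp add: inner_axis')
next
  show "continuous_on D (\<lambda>x. axis 3 (g' (x $ 3)) :: real^3)"
  proof -
    have "continuous_on D (\<lambda>x. g' (x $ 3) *\<^sub>R (axis 3 1 :: real^3))"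
      by (intro continuous_intros continuous_on_compose2[OF assms(2)]) (auto simp: in_D)
    moreover have "g' w *\<^sub>R (axis 3 1 :: real^3) = axis 3 (g' w)" for w
      by (simp add: axis_def vec_eq_iff)
    ultimately show ?thesis by simp
  qed
  have "(axis 1 w :: real^3) $ 3 = 0" "(axis 2 w :: real^3) $ 3 = 0" for w by (simp_all add: axis_def)
  then show "periodic_on l1 l2 D (\<lambda>x. g (x $ 3))" "periodic_on l1 l2 D (\<lambda>x. axis 3 (g' (x $ 3)) :: real^3)"
    by (simp_all add: periodic_on_def)
qed

definition km :: "nat \<Rightarrow> real" where "km m = real m * (pi / (l1/2))"
definition lm :: "nat \<Rightarrow> real" where "lm n = real n * (pi / (l2/2))"

lemma km_pos: "m \<ge> 1 \<Longrightarrow> km m > 0" and lm_pos: "n \<ge> 1 \<Longrightarrow> lm n > 0"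
  using l_pos by (auto simp: km_def lm_def)

definition tp :: "bool \<Rightarrow> nat \<Rightarrow> real^3 \<Rightarrow> real" where "tp c m x = tr c (km m * x $ 1)"
definition tq :: "bool \<Rightarrow> nat \<Rightarrow> real^3 \<Rightarrow> real" where "tq c n x = tr c (lm n * x $ 2)"

text \<open>The sign that \<open>tr c\<close> picks up under reflection; it also governs
  differentiation, as cos' = - sin and sin' = cos.\<close>

definition sg :: "bool \<Rightarrow> real" where "sg c = (if c then 1 else -1)"

lemma tr_derivative: "(tr c has_real_derivative - sg c * tr (\<not> c) x) (at x within A)"
  unfolding tr_def sg_def by (cases c) (auto intro!: derivative_eq_intros)

lemma tr_shift: "tr c (x + 2 * pi * of_int k) = tr c x"
  using cos_integer_2pi sin_integer_2pi by (simp add: tr_def cos_add sin_add)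

lemma C1_trig:
  assumes per: "\<And>c. periodic_on l1 l2 D (\<lambda>x. tr c (w * x $ i))"
  shows "C1 (\<lambda>x. tr c (w * x $ i)) (\<lambda>x. axis i (- sg c * w * tr (\<not> c) (w * x $ i)))"
  unfolding C1_def
proof (intro conjI ballI per)
  fix x
  have "((\<lambda>x. tr c (w * x $ i)) has_derivative (\<lambda>h. - sg c * tr (\<not> c) (w * x $ i) * (w * h $ i))) (at x within D)"
    by (rule has_derivative_compose[OF _ tr_derivative[unfolded has_field_derivative_def], of _ "\<lambda>h. w * h $ i" for x])
      (intro has_derivative_mult_right has_derivative_nth)
  then show "((\<lambda>x. tr c (w * x $ i)) has_derivative (\<lambda>h. axis i (- sg c * w * tr (\<not> c) (w * x $ i)) \<bullet> h)) (at x within D)"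
    by (simp add: inner_axis' mult_ac)
  have "continuous_on D (\<lambda>x. (- sg c * w * tr (\<not> c) (w * x $ i)) *\<^sub>R (axis i 1 :: real^3))"
    by (intro continuous_intros)
  then show "continuous_on D (\<lambda>x. axis i (- sg c * w * tr (\<not> c) (w * x $ i)) :: real^3)"
    by (simp add: axis_def vec_eq_iff[abs_def] scaleR_vec_def if_distrib cong: if_cong)
  show "periodic_on l1 l2 D (\<lambda>x. axis i (- sg c * w * tr (\<not> c) (w * x $ i)) :: real^3)"
    using per[of "\<not> c"] unfolding periodic_on_def by simp
qed

lemma C1_tp: "C1 (tp c m) (\<lambda>x. axis 1 (- sg c * km m * tp (\<not> c) m x))"
  unfolding tp_def[abs_def]
proof (rule C1_trig)
  have "km m * (y + l1 * of_int k) = km m * y + 2 * pi * of_int (int m * k)" for y and k :: int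
    using l_pos by (simp add: km_def field_simps)
  then show "periodic_on l1 l2 D (\<lambda>x. tr c (km m * x $ 1))" for c
    unfolding periodic_on_def by (auto simp: axis_def tr_shift simp del: of_int_mult)
qed

lemma C1_tq: "C1 (tq c n) (\<lambda>x. axis 2 (- sg c * lm n * tq (\<not> c) n x))"
  unfolding tq_def[abs_def]
proof (rule C1_trig)
  have "lm n * (y + l2 * of_int k) = lm n * y + 2 * pi * of_int (int n * k)" for y and k :: int
    using l_pos by (simp add: lm_def field_simps)
  then show "periodic_on l1 l2 D (\<lambda>x. tr c (lm n * x $ 2))" for c
    unfolding periodic_on_def by (auto simp: axis_def tr_shift simp del: of_int_mult)
qed

abbreviation cell :: "(real \<times> real) set" where "cell \<equiv> cbox (-(l1/2), -(l2/2)) (l1/2, l2/2)"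

definition sec :: "(real^3 \<Rightarrow> real) \<Rightarrow> real \<Rightarrow> real \<times> real \<Rightarrow> real" where
  "sec f z y = f (pt (fst y) (snd y) z)"

text \<open>The mean over a horizontal period cell, up to the factor \<open>l1 * l2\<close>. It
  annihilates horizontal derivatives of periodic functions.\<close>

definition J :: "real \<Rightarrow> (real^3 \<Rightarrow> real) \<Rightarrow> real" where
  "J z f = integral cell (sec f z)"

lemma continuous_on_sec: "continuous_on D f \<Longrightarrow> z \<in> {-d..0} \<Longrightarrow> continuous_on A (sec f z)"
  unfolding sec_def[abs_def]
  by (erule continuous_on_compose2) (auto intro!: continuous_intros simp: in_D)

lemma J_integral: "continuous_on D f \<Longrightarrow> z \<in> {-d..0} \<Longrightarrow> (sec f z has_integral J z f) cell"
  unfolding J_def by (intro integrable_integral integrable_continuous continuous_on_sec)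

lemma J_cong: "z \<in> {-d..0} \<Longrightarrow> (\<And>x. x \<in> D \<Longrightarrow> x $ 3 = z \<Longrightarrow> f x = g x) \<Longrightarrow> J z f = J z g"
  unfolding J_def sec_def by (intro integral_cong) (auto simp: in_D)

lemma J_add: "continuous_on D f \<Longrightarrow> continuous_on D g \<Longrightarrow> z \<in> {-d..0} \<Longrightarrow> J z (\<lambda>x. f x + g x) = J z f + J z g"
  using has_integral_add[OF J_integral J_integral, of f z g z] unfolding J_def sec_def[abs_def] by (simp add: integral_unique)

lemma J_diff: "continuous_on D f \<Longrightarrow> continuous_on D g \<Longrightarrow> z \<in> {-d..0} \<Longrightarrow> J z (\<lambda>x. f x - g x) = J z f - J z g"
  using has_integral_diff[OF J_integral J_integral, of f z g z] unfolding J_def sec_def[abs_def] by (simp add: integral_unique)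

lemma J_cmult: "J z (\<lambda>x. k * f x) = k * J z f"
  unfolding J_def sec_def[abs_def] by simp

lemma line_derivative:
  assumes f: "C1 f f'" and p: "(p has_derivative (\<lambda>h. h *\<^sub>R v)) (at s within T)" and T: "p ` T \<subseteq> D" "s \<in> T"
  shows "((\<lambda>s. f (p s)) has_real_derivative f' (p s) \<bullet> v) (at s within T)"
proof -
  have "(f has_derivative (\<lambda>h. f' (p s) \<bullet> h)) (at (p s) within p ` T)"
    using f T unfolding C1_def by (blast intro: has_derivative_subset)
  from has_derivative_in_compose[OF p this] show ?thesis
    by (simp add: has_field_derivative_def mult.commute[of _ "f' (p s) \<bullet> v"])
qed

lemma section_derivative_integral:
  assumes f: "C1 f f'" and p: "\<And>s. (p has_derivative (\<lambda>h. h *\<^sub>R axis i 1)) (at s within {-a..a})"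
    and pD: "\<And>s. p s \<in> D" and a: "a \<ge> 0" and per: "f (p a) = f (p (-a))"
  shows "integral {-a..a} (\<lambda>s. f' (p s) $ i) = 0"
proof -
  have "((\<lambda>s. f' (p s) $ i) has_integral f (p a) - f (p (-a))) {-a..a}"
  proof (rule fundamental_theorem_of_calculus)
    show "((\<lambda>s. f (p s)) has_vector_derivative f' (p s) $ i) (at s within {-a..a})" if "s \<in> {-a..a}" for s
      using line_derivative[OF f p, of s] pD that
      by (auto simp: has_real_derivative_iff_has_vector_derivative inner_axis)
  qed (use a in auto)
  then show ?thesis using per by (simp add: integral_unique)
qed

text \<open>Over one period in x_1 the derivative integrates to a difference of equal boundary
  values. The iterated integral has x_1 outside, hence the swap of the variables.\<close>

lemma J_d1:
  assumes f: "C1 f f'" and z: "z \<in> {-d..0}" shows "J z (\<lambda>x. f' x $ 1) = 0"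
proof -
  let ?g = "\<lambda>s t. f' (pt s t z) $ 1"
  have c: "continuous_on A (\<lambda>(s,t). ?g s t)" "continuous_on B (\<lambda>(t,s). ?g s t)" for A B
    unfolding split_beta by (rule continuous_on_compose2[OF C1_cont'[OF f, of 1]];
      use z in \<open>auto intro!: continuous_intros simp: in_D\<close>)+
  have inner: "integral {-(l1/2)..l1/2} (\<lambda>s. ?g s t) = 0" for t
  proof (rule section_derivative_integral[OF f has_derivative_pt(1)])
    have "pt (-(l1/2)) t z + axis 1 (l1 * of_int 1) + axis 2 (l2 * of_int 0) = pt (l1/2) t z"
      by (simp add: vec_eq_iff forall_3 axis_def)
    moreover have "pt (-(l1/2)) t z \<in> D" using z by (simp add: in_D)
    ultimately show "f (pt (l1/2) t z) = f (pt (-(l1/2)) t z)" using f unfolding C1_def periodic_on_def by metis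
  qed (use z l_pos in \<open>auto simp: in_D\<close>)
  have "J z (\<lambda>x. f' x $ 1) = integral cell (\<lambda>(s,t). ?g s t)"
    by (simp add: J_def sec_def[abs_def] case_prod_beta')
  also have "\<dots> = integral (cbox (-(l2/2), -(l1/2)) (l2/2, l1/2)) (\<lambda>(t,s). ?g s t)"
    by (rule integral_swap_2dim[OF c(1)])
  also have "\<dots> = 0" using integral_prod_continuous[OF c(2)] inner by simp
  finally show ?thesis .
qed

lemma J_d2:
  assumes f: "C1 f f'" and z: "z \<in> {-d..0}" shows "J z (\<lambda>x. f' x $ 2) = 0"
proof -
  let ?g = "\<lambda>s t. f' (pt s t z) $ 2"
  have c: "continuous_on A (\<lambda>(s,t). ?g s t)" for A
    unfolding split_beta by (rule continuous_on_compose2[OF C1_cont'[OF f, of 2]])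
      (use z in \<open>auto intro!: continuous_intros simp: in_D\<close>)
  have inner: "integral {-(l2/2)..l2/2} (\<lambda>t. ?g s t) = 0" for s
  proof (rule section_derivative_integral[OF f has_derivative_pt(2)])
    have "pt s (-(l2/2)) z + axis 1 (l1 * of_int 0) + axis 2 (l2 * of_int 1) = pt s (l2/2) z"
      by (simp add: vec_eq_iff forall_3 axis_def)
    moreover have "pt s (-(l2/2)) z \<in> D" using z by (simp add: in_D)
    ultimately show "f (pt s (l2/2) z) = f (pt s (-(l2/2)) z)" using f unfolding C1_def periodic_on_def by metis
  qed (use z l_pos in \<open>auto simp: in_D\<close>)
  have "J z (\<lambda>x. f' x $ 2) = integral cell (\<lambda>(s,t). ?g s t)"
    by (simp add: J_def sec_def[abs_def] case_prod_beta')
  also have "\<dots> = 0" using integral_prod_continuous[OF c] inner by simp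
  finally show ?thesis .
qed

lemma J_d3:
  assumes f: "C1 f f'" and z: "z \<in> {-d..0}"
  shows "((\<lambda>z. J z f) has_real_derivative J z (\<lambda>x. f' x $ 3)) (at z within {-d..0})"
  unfolding J_def sec_def[abs_def]
proof (rule leibniz_rule_field_derivative)
  fix w y assume w: "w \<in> {-d..0}"
  have "((\<lambda>w. f (pt (fst y) (snd y) w)) has_real_derivative f' (pt (fst y) (snd y) w) \<bullet> axis 3 1) (at w within {-d..0})"
    by (intro line_derivative[OF f]) (use w in \<open>auto intro!: has_derivative_pt simp: in_D\<close>)
  then show "((\<lambda>w. f (pt (fst y) (snd y) w)) has_real_derivative f' (pt (fst y) (snd y) w) $ 3) (at w within {-d..0})"
    by (simp add: inner_axis)
next
  fix w assume w: "w \<in> {-d..0}"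
  show "(\<lambda>y. f (pt (fst y) (snd y) w)) integrable_on cell"
    using continuous_on_sec[OF C1_cont[OF f] w] unfolding sec_def[abs_def] by (rule integrable_continuous)
next
  show "continuous_on ({-d..0} \<times> cell) (\<lambda>(w, y). f' (pt (fst y) (snd y) w) $ 3)"
    unfolding split_beta by (rule continuous_on_compose2[OF C1_cont'[OF f, of 3]])
      (auto intro!: continuous_intros simp: in_D)
qed (use z in auto)

section \<open>Fourier coefficients as functions of the height\<close>

definition cf :: "(real^3 \<Rightarrow> real) \<Rightarrow> bool \<Rightarrow> bool \<Rightarrow> nat \<Rightarrow> nat \<Rightarrow> real \<Rightarrow> real" where
  "cf f c e m n z = J z (\<lambda>x. f x * (tp c m x * tq e n x))"

lemma cf_co: "cf f c e m n z = co (l1/2) (l2/2) (sec f z) c e m n"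
  unfolding cf_def J_def sec_def[abs_def] co_def tp_def tq_def km_def lm_def by (simp add: mult.assoc)

lemma cont_tp: "continuous_on A (tp c m)" and cont_tq: "continuous_on A (tq c m)"
  unfolding tp_def[abs_def] tq_def[abs_def] by (intro continuous_intros)+

lemma cf_add: "continuous_on D f \<Longrightarrow> continuous_on D g \<Longrightarrow> z \<in> {-d..0} \<Longrightarrow>
    cf (\<lambda>x. f x + g x) c e m n z = cf f c e m n z + cf g c e m n z"
  unfolding cf_def distrib_right by (intro J_add continuous_intros cont_tp cont_tq)

lemma cf_diff: "continuous_on D f \<Longrightarrow> continuous_on D g \<Longrightarrow> z \<in> {-d..0} \<Longrightarrow>
    cf (\<lambda>x. f x - g x) c e m n z = cf f c e m n z - cf g c e m n z"
  unfolding cf_def left_diff_distrib by (intro J_diff continuous_intros cont_tp cont_tq)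

lemma cf_cmult: "cf (\<lambda>x. k * f x) c e m n z = k * cf f c e m n z"
  unfolding cf_def mult.assoc by (rule J_cmult)

lemma cf_vertical: "z \<in> {-d..0} \<Longrightarrow> cf (\<lambda>x. G (x $ 3) * f x) c e m n z = G z * cf f c e m n z"
  unfolding cf_cmult[symmetric] unfolding cf_def by (rule J_cong) auto

lemma cf_cong: "z \<in> {-d..0} \<Longrightarrow> (\<And>x. x \<in> D \<Longrightarrow> x $ 3 = z \<Longrightarrow> f x = g x) \<Longrightarrow> cf f c e m n z = cf g c e m n z"
  unfolding cf_def by (rule J_cong) auto

text \<open>Integration by parts: \<open>J_d1\<close> is applied to the product of \<open>f\<close>
  with the mode. Periodicity removes the boundary terms, and differentiating the mode exchanges sine
  and cosine.\<close>

lemma cf_d1: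
  assumes f: "C1 f f'" and z: "z \<in> {-d..0}"
  shows "cf (\<lambda>x. f' x $ 1) c e m n z = sg c * km m * cf f (\<not> c) e m n z"
proof -
  note C = C1_mult[OF f C1_mult[OF C1_tp C1_tq], of c m e n]
  have "J z (\<lambda>x. f' x $ 1 * (tp c m x * tq e n x) - sg c * km m * (f x * (tp (\<not> c) m x * tq e n x))) = 0"
    using J_d1[OF C z] by (elim trans[rotated], intro J_cong[OF z]) (simp add: axis_def algebra_simps)
  then show ?thesis
    unfolding cf_def using C1_cont'[OF f, of 1] C1_cont[OF f] z
    by (subst (asm) J_diff) (auto intro!: continuous_intros cont_tp cont_tq simp: J_cmult)
qed

lemma cf_d2:
  assumes f: "C1 f f'" and z: "z \<in> {-d..0}"
  shows "cf (\<lambda>x. f' x $ 2) c e m n z = sg e * lm n * cf f c (\<not> e) m n z"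
proof -
  note C = C1_mult[OF f C1_mult[OF C1_tp C1_tq], of c m e n]
  have "J z (\<lambda>x. f' x $ 2 * (tp c m x * tq e n x) - sg e * lm n * (f x * (tp c m x * tq (\<not> e) n x))) = 0"
    using J_d2[OF C z] by (elim trans[rotated], intro J_cong[OF z]) (simp add: axis_def algebra_simps)
  then show ?thesis
    unfolding cf_def using C1_cont'[OF f, of 2] C1_cont[OF f] z
    by (subst (asm) J_diff) (auto intro!: continuous_intros cont_tp cont_tq simp: J_cmult)
qed

lemma cf_d3:
  assumes f: "C1 f f'" and z: "z \<in> {-d..0}"
  shows "(cf f c e m n has_real_derivative cf (\<lambda>x. f' x $ 3) c e m n z) (at z within {-d..0})"
proof -
  note C = C1_mult[OF f C1_mult[OF C1_tp C1_tq], of c m e n]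
  have "J z (\<lambda>x. (f x *\<^sub>R (tp c m x *\<^sub>R axis 2 (- sg e * lm n * tq (\<not> e) n x) + tq e n x *\<^sub>R axis 1 (- sg c * km m * tp (\<not> c) m x)) +
       (tp c m x * tq e n x) *\<^sub>R f' x) $ 3) = cf (\<lambda>x. f' x $ 3) c e m n z"
    unfolding cf_def by (intro J_cong[OF z]) (simp add: axis_def)
  with J_d3[OF C z] show ?thesis unfolding cf_def[abs_def] by simp
qed

text \<open>The integrand changes sign under the reflection, since \<open>f\<close> has the parity
  opposite to that of \<open>tr c\<close>.\<close>

lemma cf_parity1:
  assumes c: "continuous_on D f" and z: "z \<in> {-d..0}" and p: "\<And>x. x \<in> D \<Longrightarrow> f (reflect 1 x) = - sg c * f x"
  shows "cf f c e m n z = 0"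
proof -
  let ?g = "sec (\<lambda>x. f x * (tp c m x * tq e n x)) z"
  have cont: "continuous_on cell ?g"
    by (intro continuous_on_sec[OF _ z] continuous_intros c cont_tp cont_tq)
  have "?g (- fst y, snd y) = - ?g y" for y
  proof -
    have "pt (- fst y) (snd y) z = reflect 1 (pt (fst y) (snd y) z)" by (simp add: vec_eq_iff forall_3 reflect_def)
    then have "f (pt (- fst y) (snd y) z) = - sg c * f (pt (fst y) (snd y) z)" using p z by (simp add: in_D)
    then show ?thesis by (simp add: sec_def tp_def tq_def tr_def sg_def)
  qed
  then have "- integral cell ?g = integral cell ?g" using integral_cell_reflect1[OF cont] by simp
  then show ?thesis unfolding cf_def J_def by simp
qed

lemma cf_parity2:
  assumes c: "continuous_on D f" and z: "z \<in> {-d..0}" and p: "\<And>x. x \<in> D \<Longrightarrow> f (reflect 2 x) = - sg e * f x"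
  shows "cf f c e m n z = 0"
proof -
  let ?g = "sec (\<lambda>x. f x * (tp c m x * tq e n x)) z"
  have cont: "continuous_on cell ?g"
    by (intro continuous_on_sec[OF _ z] continuous_intros c cont_tp cont_tq)
  have "?g (fst y, - snd y) = - ?g y" for y
  proof -
    have "pt (fst y) (- snd y) z = reflect 2 (pt (fst y) (snd y) z)" by (simp add: vec_eq_iff forall_3 reflect_def)
    then have "f (pt (fst y) (- snd y) z) = - sg e * f (pt (fst y) (snd y) z)" using p z by (simp add: in_D)
    then show ?thesis by (simp add: sec_def tp_def tq_def tr_def sg_def)
  qed
  then have "- integral cell ?g = integral cell ?g" using integral_cell_reflect2[OF cont] by simp
  then show ?thesis unfolding cf_def J_def by simp
qed

text \<open>The sine of frequency zero is the zero function. For fields odd in x_1, such as the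
  cross-flow components below, this excludes every mode independent of x_1.\<close>

lemma cf_degenerate: "cf f False e 0 n z = 0" "cf f c False m 0 z = 0"
  unfolding cf_def J_def sec_def[abs_def] tp_def tq_def tr_def km_def lm_def by simp_all

lemma cf_vanish: "z \<in> {-d..0} \<Longrightarrow> (\<And>x. x \<in> D \<Longrightarrow> x $ 3 = z \<Longrightarrow> f x = 0) \<Longrightarrow> cf f c e m n z = 0"
  using cf_cong[of z f "\<lambda>x. 0"] cf_cmult[of 0 "\<lambda>x. 0"] by simp

lemma deriv_unique_within:
  assumes f: "(f has_real_derivative D1) (at z within {-d..0})" and g: "(g has_real_derivative D2) (at z within {-d..0})"
    and eq: "\<And>w. w \<in> {-d..0} \<Longrightarrow> f w = g w" and z: "z \<in> {-d..0}"
  shows "D1 = D2"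
proof (rule tendsto_unique)
  show "at z within {-d..0} \<noteq> bot"
    using d_pos z by (metis atLeastAtMost_iff at_within_Icc_at_left at_within_Icc_at_right at_within_interior
      interior_atLeastAtMost_real greaterThanLessThan_iff less_eq_real_def neg_less_0_iff_less trivial_limit_at_left_real trivial_limit_at_right_real trivial_limit_at)
  have "(f has_real_derivative D2) (at z within {-d..0})"
    by (rule has_field_derivative_transform_within[OF g zero_less_one z]) (simp add: eq)
  then show "((\<lambda>y. (f y - f z) / (y - z)) \<longlongrightarrow> D2) (at z within {-d..0})"
    by (simp add: has_field_derivative_iff)
qed (use f in \<open>auto simp: has_field_derivative_iff\<close>)

text \<open>Completeness at the single height \<open>x $ 3\<close>; rounding to the nearest lattice
  point moves \<open>x\<close> into the centred cell. It permits identities between derivatives to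
  be proved by comparing coefficients, without further differentiability.\<close>

lemma cf_zero:
  assumes c: "continuous_on D f" and per: "periodic_on l1 l2 D f"
    and H: "\<And>c e m n. cf f c e m n (x $ 3) = 0" and x: "x \<in> D"
  shows "f x = 0"
proof -
  have z: "x $ 3 \<in> {-d..0}" using x by (simp add: in_D)
  have round: "\<exists>k::int. \<bar>s - l * of_int k\<bar> \<le> l/2" if "l > 0" for s l :: real
  proof -
    have "\<bar>s - l * of_int (round (s/l))\<bar> = l * \<bar>of_int (round (s/l)) - s/l\<bar>"
      using that by (simp add: abs_mult_pos'[symmetric] abs_minus_commute field_simps)
    also have "\<dots> \<le> l * (1/2)" using that of_int_round_abs_le by (intro mult_left_mono) auto
    finally show ?thesis by (intro exI[of _ "round (s/l)"]) simp
  qed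
  obtain k1 where k1: "\<bar>x $ 1 - l1 * of_int k1\<bar> \<le> l1/2" using round l_pos by blast
  obtain k2 where k2: "\<bar>x $ 2 - l2 * of_int k2\<bar> \<le> l2/2" using round l_pos by blast
  let ?y = "(x $ 1 - l1 * of_int k1, x $ 2 - l2 * of_int k2)"
  have y: "?y \<in> cell" using k1 k2 unfolding abs_le_iff by (auto simp: cbox_Pair_eq)
  have "sec f (x $ 3) ?y = 0"
    by (rule fourier_coefficients_zero[OF continuous_on_sec[OF c z] _ _ _ y]) (use l_pos H in \<open>auto simp: cf_co\<close>)
  moreover have "sec f (x $ 3) ?y = f x"
  proof -
    let ?p = "pt (x $ 1 - l1 * of_int k1) (x $ 2 - l2 * of_int k2) (x $ 3)"
    have "?p + axis 1 (l1 * of_int k1) + axis 2 (l2 * of_int k2) = x"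
      by (simp add: vec_eq_iff forall_3 axis_def)
    moreover have "?p \<in> D" using z by (simp add: in_D)
    ultimately have "f ?p = f x" using per unfolding periodic_on_def by metis
    then show ?thesis by (simp add: sec_def)
  qed
  ultimately show ?thesis by simp
qed

text \<open>Equality of mixed derivatives is read off the Fourier coefficients.\<close>

lemma mixed_derivatives:
  assumes f: "C1 f f'" "C1 (\<lambda>x. f' x $ 1) f1'" "C1 (\<lambda>x. f' x $ 2) f2'" and x: "x \<in> D"
  shows "f1' x $ 2 = f2' x $ 1"
proof -
  have z: "x $ 3 \<in> {-d..0}" using x by (simp add: in_D)
  note c = C1_cont'[OF f(2), of 2] C1_cont'[OF f(3), of 1]
  have "f1' x $ 2 - f2' x $ 1 = 0"
  proof (rule cf_zero[OF _ _ _ x])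
    show "continuous_on D (\<lambda>x. f1' x $ 2 - f2' x $ 1)" by (intro continuous_intros c)
    show "periodic_on l1 l2 D (\<lambda>x. f1' x $ 2 - f2' x $ 1)"
      using C1_periodic(2)[OF f(2), of 2] C1_periodic(2)[OF f(3), of 1] unfolding periodic_on_def by simp
    show "cf (\<lambda>x. f1' x $ 2 - f2' x $ 1) c e m n (x $ 3) = 0" for c e m n
      by (simp add: cf_diff[OF c z] cf_d2[OF f(2) z] cf_d1[OF f(3) z] cf_d1[OF f(1) z] cf_d2[OF f(1) z])
  qed
  then show ?thesis by simp
qed

end

section \<open>The linearized problem\<close>

text \<open>\<open>b\<close> is \<open>u\<^sub>2\<close> and \<open>v\<close> is the unflattened vertical velocity \<open>u\<^sub>3 + U \<partial>\<^sub>1 \<phi>\<close>; the divergence condition has been used to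
  eliminate \<open>\<partial>\<^sub>1 u\<^sub>1\<close> from the first momentum equation. \<open>h\<close> is the elevation as a function on the slab.\<close>

locale linear_wave = slab d l1 l2 + shear_flow d U U' for d l1 l2 U U' +
  fixes g \<sigma> :: real and p b v h :: "real^3 \<Rightarrow> real" and p' b' v' h' h1' h2' :: "real^3 \<Rightarrow> real^3"
  assumes gs: "g > 0" "\<sigma> > 0"
    and p: "C1 p p'" and b: "C1 b b'" and v: "C1 v v'"
    and h: "C1 h h'" and h1: "C1 (\<lambda>x. h' x $ 1) h1'" and h2: "C1 (\<lambda>x. h' x $ 2) h2'"
    and p_sym: "\<And>x. x \<in> Omega_closed d \<Longrightarrow> p (reflect 1 x) = p x" "\<And>x. x \<in> Omega_closed d \<Longrightarrow> p (reflect 2 x) = p x"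
    and b_sym: "\<And>x. x \<in> Omega_closed d \<Longrightarrow> b (reflect 1 x) = - b x" "\<And>x. x \<in> Omega_closed d \<Longrightarrow> b (reflect 2 x) = - b x"
    and v_sym: "\<And>x. x \<in> Omega_closed d \<Longrightarrow> v (reflect 1 x) = - v x" "\<And>x. x \<in> Omega_closed d \<Longrightarrow> v (reflect 2 x) = v x"
    and h_sym: "\<And>x. x \<in> Omega_closed d \<Longrightarrow> h (reflect 1 x) = h x" "\<And>x. x \<in> Omega_closed d \<Longrightarrow> h (reflect 2 x) = h x"
    and momentum1: "\<And>x. x \<in> Omega_closed d \<Longrightarrow> - U (x $ 3) * (b' x $ 2 + v' x $ 3) + U' (x $ 3) * v x + p' x $ 1 = 0"
    and momentum2: "\<And>x. x \<in> Omega_closed d \<Longrightarrow> U (x $ 3) * b' x $ 1 + p' x $ 2 = 0"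
    and momentum3: "\<And>x. x \<in> Omega_closed d \<Longrightarrow> U (x $ 3) * v' x $ 1 + p' x $ 3 = 0"
    and bottom: "\<And>x. x $ 3 = - d \<Longrightarrow> v x = 0"
    and top_kinematic: "\<And>x. x $ 3 = 0 \<Longrightarrow> v x = U 0 * h' x $ 1"
    and top_dynamic: "\<And>x. x $ 3 = 0 \<Longrightarrow> p x = g * h x - \<sigma> * (h1' x $ 1 + h2' x $ 2)"
begin

section \<open>Mode equations of the linearized problem\<close>

lemma C1_U: "C1 (\<lambda>x. U (x $ 3)) (\<lambda>x. axis 3 (U' (x $ 3)))"
  by (rule C1_vertical[OF dU cU'])

lemma cont_vert: "continuous_on D (\<lambda>x. U (x $ 3))" "continuous_on D (\<lambda>x. U' (x $ 3))"
  by (rule C1_cont[OF C1_U]) (rule continuous_on_compose2[OF cU'], auto intro!: continuous_intros simp: in_D)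

lemmas contD [continuous_intros] = cont_vert C1_cont[OF p] C1_cont[OF b] C1_cont[OF v] C1_cont[OF h]
  C1_cont'[OF p] C1_cont'[OF b] C1_cont'[OF v] C1_cont'[OF h] C1_cont'[OF h1] C1_cont'[OF h2]

abbreviation pm :: "nat \<Rightarrow> nat \<Rightarrow> real \<Rightarrow> real" where "pm m n \<equiv> cf p True True m n"
abbreviation bm :: "nat \<Rightarrow> nat \<Rightarrow> real \<Rightarrow> real" where "bm m n \<equiv> cf b False False m n"
abbreviation vm :: "nat \<Rightarrow> nat \<Rightarrow> real \<Rightarrow> real" where "vm m n \<equiv> cf v False True m n"
abbreviation hm :: "nat \<Rightarrow> nat \<Rightarrow> real" where "hm m n \<equiv> cf h True True m n 0"
abbreviation rm :: "nat \<Rightarrow> nat \<Rightarrow> real \<Rightarrow> real" where "rm m n \<equiv> \<lambda>z. - (km m * vm m n z / U z)"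
abbreviation \<kappa> :: "nat \<Rightarrow> nat \<Rightarrow> real" where "\<kappa> m n \<equiv> (km m)\<^sup>2 + (lm n)\<^sup>2"

lemma sg_simps [simp]: "sg True = 1" "sg False = -1"
  by (simp_all add: sg_def)

lemma p_parity: "z \<in> {-d..0} \<Longrightarrow> \<not> (c \<and> e) \<Longrightarrow> cf p c e m n z = 0"
  using cf_parity1[OF C1_cont[OF p], of z c] cf_parity2[OF C1_cont[OF p], of z e] p_sym by (cases c; cases e) auto

lemma b_parity: "z \<in> {-d..0} \<Longrightarrow> c \<or> e \<Longrightarrow> cf b c e m n z = 0"
  using cf_parity1[OF C1_cont[OF b], of z c] cf_parity2[OF C1_cont[OF b], of z e] b_sym by (cases c; cases e) auto

lemma v_parity: "z \<in> {-d..0} \<Longrightarrow> \<not> (\<not> c \<and> e) \<Longrightarrow> cf v c e m n z = 0"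
  using cf_parity1[OF C1_cont[OF v], of z c] cf_parity2[OF C1_cont[OF v], of z e] v_sym by (cases c; cases e) auto

lemma h_parity: "z \<in> {-d..0} \<Longrightarrow> \<not> (c \<and> e) \<Longrightarrow> cf h c e m n z = 0"
  using cf_parity1[OF C1_cont[OF h], of z c] cf_parity2[OF C1_cont[OF h], of z e] h_sym by (cases c; cases e) auto

lemma mode_b: assumes z: "z \<in> {-d..0}" shows "U z * km m * bm m n z = lm n * pm m n z"
proof -
  have "cf (\<lambda>x. U (x $ 3) * b' x $ 1 + p' x $ 2) True False m n z = 0"
    by (rule cf_vanish[OF z]) (use momentum2 in auto)
  moreover have "cf (\<lambda>x. U (x $ 3) * b' x $ 1 + p' x $ 2) True False m n z
      = cf (\<lambda>x. U (x $ 3) * b' x $ 1) True False m n z + cf (\<lambda>x. p' x $ 2) True False m n z"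
    by (intro cf_add z continuous_intros)
  ultimately show ?thesis using cf_vertical[OF z, of U "\<lambda>x. b' x $ 1"] cf_d1[OF b z] cf_d2[OF p z] by simp
qed

lemma mode_p: assumes z: "z \<in> {-d..0}" shows "cf (\<lambda>x. p' x $ 3) True True m n z = - (U z * km m * vm m n z)"
proof -
  have "cf (\<lambda>x. U (x $ 3) * v' x $ 1 + p' x $ 3) True True m n z = 0"
    by (rule cf_vanish[OF z]) (use momentum3 in auto)
  moreover have "cf (\<lambda>x. U (x $ 3) * v' x $ 1 + p' x $ 3) True True m n z
      = cf (\<lambda>x. U (x $ 3) * v' x $ 1) True True m n z + cf (\<lambda>x. p' x $ 3) True True m n z"
    by (intro cf_add z continuous_intros)
  ultimately show ?thesis using cf_vertical[OF z, of U "\<lambda>x. v' x $ 1"] cf_d1[OF v z] by simp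
qed

lemma mode_v: assumes z: "z \<in> {-d..0}"
  shows "U z * cf (\<lambda>x. v' x $ 3) False True m n z = U' z * vm m n z - U z * lm n * bm m n z - km m * pm m n z"
proof -
  let ?F = "\<lambda>x. U (x $ 3) * (b' x $ 2 + v' x $ 3)" and ?G = "\<lambda>x. U' (x $ 3) * v x + p' x $ 1"
  have "cf ?F False True m n z = cf ?G False True m n z"
    by (rule cf_cong[OF z]) (use momentum1 in \<open>auto simp: algebra_simps add_eq_0_iff\<close>)
  moreover have "cf ?F False True m n z = U z * (cf (\<lambda>x. b' x $ 2) False True m n z + cf (\<lambda>x. v' x $ 3) False True m n z)"
    by (subst cf_vertical[OF z], subst cf_add[OF _ _ z]) (auto intro!: continuous_intros)
  moreover have "cf ?G False True m n z = U' z * vm m n z + cf (\<lambda>x. p' x $ 1) False True m n z"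
    by (subst cf_add[OF _ _ z], (intro continuous_intros)+, subst cf_vertical[OF z], simp)
  ultimately show ?thesis using cf_d2[OF b z] cf_d1[OF p z] by (simp add: algebra_simps)
qed

text \<open>After division of \<open>vm\<close> by \<open>U\<close> the quotient rule absorbs the
  term with \<open>U'\<close> in \<open>mode_v\<close>. Multiplied by \<open>km m\<close>, the term
  with \<open>bm\<close> there is traded for a multiple of the pressure by \<open>mode_b\<close>, so
  that \<open>k\<close> and \<open>l\<close> enter only through \<open>\<kappa>\<close>.\<close>

lemma wave_mode: "mode (\<kappa> m n) (pm m n) (rm m n)"
  unfolding mode_def
proof (intro conjI ballI)
  fix z assume z: "z \<in> {-d..0}"
  have Uz: "U z \<noteq> 0" using U0[OF z] .
  have "cf (\<lambda>x. p' x $ 3) True True m n z = (U z)\<^sup>2 * rm m n z"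
    unfolding mode_p[OF z] using Uz by (simp add: power2_eq_square)
  with cf_d3[OF p z] show "(pm m n has_real_derivative (U z)\<^sup>2 * rm m n z) (at z within {-d..0})" by metis
  have "((\<lambda>z. vm m n z / U z) has_real_derivative
     (cf (\<lambda>x. v' x $ 3) False True m n z * U z - vm m n z * U' z) / (U z * U z)) (at z within {-d..0})"
    using cf_d3[OF v z] dU[OF z] Uz by (intro DERIV_divide)
  then have "((\<lambda>z. - (km m * (vm m n z / U z))) has_real_derivative
      - (km m * ((cf (\<lambda>x. v' x $ 3) False True m n z * U z - vm m n z * U' z) / (U z * U z)))) (at z within {-d..0})"
    by (intro DERIV_minus DERIV_cmult)
  moreover have "- (km m * ((cf (\<lambda>x. v' x $ 3) False True m n z * U z - vm m n z * U' z) / (U z * U z)))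
      = \<kappa> m n * pm m n z / (U z)\<^sup>2"
  proof -
    have "- (km m * (cf (\<lambda>x. v' x $ 3) False True m n z * U z - vm m n z * U' z))
       = - km m * (U z * cf (\<lambda>x. v' x $ 3) False True m n z - vm m n z * U' z)" by simp
    also have "\<dots> = lm n * (U z * km m * bm m n z) + (km m)\<^sup>2 * pm m n z"
      unfolding mode_v[OF z] by (simp add: algebra_simps power2_eq_square)
    also have "\<dots> = \<kappa> m n * pm m n z" unfolding mode_b[OF z] by (simp add: algebra_simps power2_eq_square)
    finally have "- (km m * (cf (\<lambda>x. v' x $ 3) False True m n z * U z - vm m n z * U' z)) / (U z)\<^sup>2 = \<kappa> m n * pm m n z / (U z)\<^sup>2"
      by simp
    then show ?thesis by (simp add: power2_eq_square)
  qed
  ultimately show "(rm m n has_real_derivative \<kappa> m n * pm m n z / (U z)\<^sup>2) (at z within {-d..0})" by simp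
next
  have "vm m n (-d) = 0" by (rule cf_vanish) (use bottom d_pos in auto)
  then show "- (km m * vm m n (-d) / U (-d)) = 0" by simp
qed

lemma mode_top:
  shows "pm m n 0 = (g + \<sigma> * \<kappa> m n) * hm m n" "rm m n 0 = (km m)\<^sup>2 * hm m n"
proof -
  have z: "0 \<in> {-d..0}" using d_pos by simp
  have "pm m n 0 = cf (\<lambda>x. g * h x - \<sigma> * (h1' x $ 1 + h2' x $ 2)) True True m n 0"
    by (rule cf_cong[OF z]) (use top_dynamic in auto)
  also have "\<dots> = g * hm m n - \<sigma> * (cf (\<lambda>x. h1' x $ 1) True True m n 0 + cf (\<lambda>x. h2' x $ 2) True True m n 0)"
    by (subst cf_diff[OF _ _ z]; (intro continuous_intros)?)
       (simp add: cf_cmult, subst cf_add[OF _ _ z], auto intro!: continuous_intros)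
  finally show "pm m n 0 = (g + \<sigma> * \<kappa> m n) * hm m n"
    using cf_d1[OF h1 z] cf_d2[OF h2 z] cf_d1[OF h z] cf_d2[OF h z] by (simp add: algebra_simps power2_eq_square)
  have "vm m n 0 = cf (\<lambda>x. U 0 * h' x $ 1) False True m n 0"
    by (rule cf_cong[OF z]) (use top_kinematic in auto)
  then have "vm m n 0 = U 0 * (- km m * hm m n)" using cf_d1[OF h z] by (simp add: cf_cmult)
  then show "rm m n 0 = (km m)\<^sup>2 * hm m n" using U0[OF z] by (simp add: power2_eq_square)
qed

text \<open>The elevation is eliminated between the dynamic and the kinematic condition.\<close>

lemma mode_bc: "(km m)\<^sup>2 * pm m n 0 = (g + \<sigma> * \<kappa> m n) * rm m n 0"
  unfolding mode_top by simp

text \<open>For \<open>k = 0\<close> the transverse momentum balance reads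
  \<open>l * p = 0\<close>.\<close>

lemma pm_0: "n \<ge> 1 \<Longrightarrow> z \<in> {-d..0} \<Longrightarrow> pm 0 n z = 0"
  using mode_b[of z 0 n] lm_pos[of n] by (simp add: km_def)

lemma rm_zero:
  assumes "\<And>z. z \<in> {-d..0} \<Longrightarrow> pm m n z = 0" and z: "z \<in> {-d..0}"
  shows "rm m n z = 0"
proof -
  have "(U z)\<^sup>2 * rm m n z = 0"
    by (rule deriv_unique_within[OF modeD(1)[OF wave_mode z] DERIV_const _ z]) (rule assms)
  then show ?thesis using U0[OF z] by simp
qed

lemma bm_eq: "m \<ge> 1 \<Longrightarrow> z \<in> {-d..0} \<Longrightarrow> bm m n z = lm n * pm m n z / (km m * U z)"
  using mode_b[of z m n] U0[of z] km_pos[of m] by (simp add: field_simps)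

lemma vm_eq: "m \<ge> 1 \<Longrightarrow> z \<in> {-d..0} \<Longrightarrow> vm m n z = - (U z * rm m n z / km m)"
  using U0[of z] km_pos[of m] by simp

lemma b_derivative_parity:
  assumes z: "z \<in> {-d..0}" and "c \<or> e" shows "cf (\<lambda>x. b' x $ 3) c e m n z = 0"
  by (rule deriv_unique_within[OF cf_d3[OF b z] DERIV_const _ z]) (rule b_parity, use assms in auto)

text \<open>The vertical vorticity of the perturbation is transported along the shear flow, hence independent
  of \<open>x\<^sub>1\<close>; it vanishes because it is odd in \<open>x\<^sub>1\<close>.\<close>

lemma rotation: assumes x: "x \<in> D" shows "U (x $ 3) * v' x $ 2 = U' (x $ 3) * b x + U (x $ 3) * b' x $ 3"
proof -
  let ?W = "\<lambda>x. U (x $ 3) * v' x $ 2 - (U' (x $ 3) * b x + U (x $ 3) * b' x $ 3)"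
  have "?W x = 0"
  proof (rule cf_zero[OF _ _ _ x])
    show "continuous_on D ?W" by (intro continuous_intros)
    have "(axis 1 w :: real^3) $ 3 = 0" "(axis 2 w :: real^3) $ 3 = 0" for w by (simp_all add: axis_def)
    then show "periodic_on l1 l2 D ?W"
      using C1_periodic(2)[OF v, of 2] C1_periodic(1)[OF b] C1_periodic(2)[OF b, of 3] unfolding periodic_on_def by simp
    fix c e m n
    define z where "z = x $ 3"
    have z: "z \<in> {-d..0}" using x by (simp add: in_D z_def)
    have "cf ?W c e m n z = cf (\<lambda>x. U (x $ 3) * v' x $ 2) c e m n z - cf (\<lambda>x. U' (x $ 3) * b x + U (x $ 3) * b' x $ 3) c e m n z"
      by (intro cf_diff z continuous_intros)
    also have "cf (\<lambda>x. U' (x $ 3) * b x + U (x $ 3) * b' x $ 3) c e m n z = cf (\<lambda>x. U' (x $ 3) * b x) c e m n z + cf (\<lambda>x. U (x $ 3) * b' x $ 3) c e m n z"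
      by (intro cf_add z continuous_intros)
    finally have W: "cf ?W c e m n z = U z * (sg e * lm n * cf v c (\<not> e) m n z) - (U' z * cf b c e m n z + U z * cf (\<lambda>x. b' x $ 3) c e m n z)"
      using cf_vertical[OF z, of U "\<lambda>x. v' x $ 2"] cf_vertical[OF z, of U' b] cf_vertical[OF z, of U "\<lambda>x. b' x $ 3"] cf_d2[OF v z] by simp
    have "cf ?W c e m n z = 0"
    proof (cases "c \<or> e")
      case True
      then show ?thesis unfolding W using v_parity[OF z, of c "\<not> e"] b_parity[OF z True] b_derivative_parity[OF z True] by simp
    next
      case False
      have "cf (\<lambda>x. b' x $ 3) False False m n z * U z + U' z * bm m n z = - lm n * U z * vm m n z"
      proof (cases "m = 0")
        case True
        then show ?thesis by (simp add: cf_degenerate)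
      next
        case False
        then have k: "km m > 0" using km_pos by simp
        \<comment> \<open>In place of a mixed second derivative of the pressure, the relation
          \<open>mode_b\<close> is differentiated in \<open>z\<close> and \<open>mode_p\<close>
          inserted; then \<open>km m\<close> cancels. In the case \<open>m = 0\<close> both sides
          consist of coefficients against the zero sine.\<close>
        have "((\<lambda>z. U z * km m * bm m n z) has_real_derivative (U z * km m * cf (\<lambda>x. b' x $ 3) False False m n z + U' z * km m * bm m n z)) (at z within {-d..0})"
          using cf_d3[OF b z] dU[OF z] by (auto intro!: derivative_eq_intros)
        then have "U z * km m * cf (\<lambda>x. b' x $ 3) False False m n z + U' z * km m * bm m n z = lm n * cf (\<lambda>x. p' x $ 3) True True m n z"
          by (rule deriv_unique_within[OF _ DERIV_cmult[OF cf_d3[OF p z]] _ z]) (rule mode_b)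
        then have "km m * (cf (\<lambda>x. b' x $ 3) False False m n z * U z + U' z * bm m n z) = km m * (- lm n * U z * vm m n z)"
          unfolding mode_p[OF z] by (simp add: algebra_simps)
        then show ?thesis using k by (subst (asm) mult_left_cancel) auto
      qed
      then show ?thesis unfolding W using False by (simp add: algebra_simps)
    qed
    then show "cf ?W c e m n (x $ 3) = 0" by (simp add: z_def)
  qed
  then show ?thesis by simp
qed

text \<open>At a fixed height the integrand is \<open>U^2\<close> times
  \<open>p^2 / U^2 + b^2 + v^2\<close>, tested with a cosine. Only even harmonics are recorded,
  because the top harmonic of a square is even.\<close>

definition no_transverse_energy :: bool where
  "no_transverse_energy \<longleftrightarrow> (\<forall>L\<ge>1. \<forall>z. -d < z \<and> z < 0 \<and> U' z \<noteq> 0 \<longrightarrow>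
     J z (\<lambda>x. ((p x)\<^sup>2 + (U (x $ 3))\<^sup>2 * ((b x)\<^sup>2 + (v x)\<^sup>2)) * tq True (2 * L) x) = 0)"

lemma active_modes_bounded: "\<exists>N. \<forall>m n. m \<ge> 1 \<longrightarrow> (\<exists>z\<in>{-d..0}. pm m n z \<noteq> 0) \<longrightarrow> m \<le> N \<and> n \<le> N"
proof -
  obtain K0 where K0: "\<And>\<kappa> k f r z. mode \<kappa> f r \<Longrightarrow> \<kappa> \<ge> K0 \<Longrightarrow> \<kappa> \<ge> 0 \<Longrightarrow> k\<^sup>2 \<le> \<kappa> \<Longrightarrow>
      k\<^sup>2 * f 0 = (g + \<sigma> * \<kappa>) * r 0 \<Longrightarrow> z \<in> {-d..0} \<Longrightarrow> f z = 0 \<and> r z = 0"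
    using high_modes_vanish[OF gs] by blast
  \<comment> \<open>The bound |K0| + 1 stands in for the square root of \<open>K0\<close>, since a
    number above 1 is at most its own square.\<close>
  obtain N1 where N1: "\<bar>K0\<bar> + 1 < real N1 * (pi / (l1/2))"
    using reals_Archimedean3[of "pi / (l1/2)"] l_pos by auto
  obtain N2 where N2: "\<bar>K0\<bar> + 1 < real N2 * (pi / (l2/2))"
    using reals_Archimedean3[of "pi / (l2/2)"] l_pos by auto
  have big: "K0 \<le> x\<^sup>2" if "\<bar>K0\<bar> + 1 < x" for x :: real
  proof -
    have "x * 1 \<le> x * x" using that by (intro mult_left_mono) auto
    then show ?thesis using that by (simp add: power2_eq_square)
  qed
  have "m \<le> N1 + N2 \<and> n \<le> N1 + N2" if m: "m \<ge> 1" and nz: "\<exists>z\<in>{-d..0}. pm m n z \<noteq> 0" for m n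
  proof -
    have K: "\<kappa> m n < K0"
    proof (rule ccontr)
      assume "\<not> \<kappa> m n < K0"
      then have "pm m n z = 0 \<and> rm m n z = 0" if "z \<in> {-d..0}" for z
        by (intro K0[OF wave_mode _ _ _ mode_bc that]) auto
      then show False using nz by blast
    qed
    have "m \<le> N1"
    proof (rule ccontr)
      assume "\<not> m \<le> N1"
      then have "real N1 * (pi / (l1/2)) \<le> km m" unfolding km_def using l_pos by (intro mult_right_mono) auto
      then have "K0 \<le> (km m)\<^sup>2" using N1 by (intro big) linarith
      then show False using K by (smt (verit) zero_le_power2)
    qed
    moreover have "n \<le> N2"
    proof (rule ccontr)
      assume "\<not> n \<le> N2"
      then have "real N2 * (pi / (l2/2)) \<le> lm n" unfolding lm_def using l_pos by (intro mult_right_mono) auto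
      then have "K0 \<le> (lm n)\<^sup>2" using N2 by (intro big) linarith
      then show False using K by (smt (verit) zero_le_power2)
    qed
    ultimately show ?thesis by simp
  qed
  then show ?thesis by blast
qed

lemma transverse_modes_vanish:
  assumes E: no_transverse_energy and nc: "\<not> U constant_on {-d..0}"
    and n: "n \<ge> 1" and z: "z \<in> {-d..0}"
  shows "pm m n z = 0"
proof (rule ccontr)
  assume nz: "pm m n z \<noteq> 0"
  define act where "act m n \<longleftrightarrow> m \<ge> 1 \<and> (\<exists>z\<in>{-d..0}. pm m n z \<noteq> 0)" for m n
  obtain N where N: "\<And>m n. act m n \<Longrightarrow> m \<le> N \<and> n \<le> N" using active_modes_bounded unfolding act_def by blast
  have m1: "m \<ge> 1" using nz pm_0[OF n z] by (cases m) auto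
  let ?A = "{n. n \<ge> 1 \<and> (\<exists>m. act m n)}"
  have fin: "finite ?A" by (rule finite_subset[of _ "{..N}"]) (use N in auto)
  have ne: "n \<in> ?A" using n nz m1 z unfolding act_def by blast
  define L where "L = Max ?A"
  have L: "L \<in> ?A" and Lmax: "\<And>n m. n \<ge> 1 \<Longrightarrow> act m n \<Longrightarrow> n \<le> L"
    using Max_in[OF fin] ne Max_ge[OF fin] unfolding L_def by auto
  have L1: "L \<ge> 1" using L by simp
  define S where "S = {m. act m L}"
  have finS: "finite S" by (rule finite_subset[of _ "{..N}"]) (use N S_def in auto)
  have neS: "S \<noteq> {}" using L S_def by auto
  have kS: "km i > 0" if "i \<in> S" for i using that km_pos unfolding S_def act_def by auto
  \<comment> \<open>The case \<open>m = 0\<close> lies outside the band only if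
    \<open>n > L\<close>; then \<open>n\<close> is at least 1 and \<open>pm_0\<close>
    applies.\<close>
  have inact: "pm m n z = 0" if "\<not> (m \<le> N \<and> n \<le> L)" "z \<in> {-d..0}" for m n z
  proof (cases "m = 0")
    case True
    then show ?thesis using pm_0[of n z] that L1 by auto
  next
    case False
    have "\<not> act m n" using that N[of m n] Lmax[of n m] by (cases "n = 0") auto
    then show ?thesis using that False unfolding act_def by auto
  qed
  have inact_r: "rm m n z = 0" if "\<not> (m \<le> N \<and> n \<le> L)" "z \<in> {-d..0}" for m n z
    by (rule rm_zero[OF inact[OF that(1)] that(2)])
  have "U constant_on {-d..0}"
  proof (rule no_balanced_modes[OF finS neS, of km "lm L" "\<lambda>m. pm m L" "\<lambda>m. rm m L"])
    show "0 < km i" if "i \<in> S" for i by (rule kS[OF that])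
    show "mode (\<kappa> i L) (pm i L) (rm i L)" for i by (rule wave_mode)
    show "\<exists>z\<in>{-d..0}. pm i L z \<noteq> 0" if "i \<in> S" for i using that unfolding S_def act_def by simp
    fix z assume zz: "-d < z" "z < 0" "U' z \<noteq> 0"
    have z: "z \<in> {-d..0}" using zz by simp
    have lp: "l1/2 > 0" "l2/2 > 0" using l_pos by auto
    let ?C = "\<lambda>y. cos (real (2 * L) * (pi / (l2/2) * snd y))"
    have csec: "continuous_on cell (sec p z)" "continuous_on cell (sec b z)" "continuous_on cell (sec v z)"
      by (intro continuous_on_sec z contD)+
    let ?k = "1 / (2 * (l1/2) * (l2/2))"
    \<comment> \<open>To be used for \<open>p\<close> and \<open>v\<close>, even in x_2, and for
      \<open>b\<close>, odd in x_2; this is where the opposite signs arise.\<close>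
    have sq: "integral cell (\<lambda>y. (sec f z y)\<^sup>2 * ?C y) = (if e then 1 else -1) * ?k * (\<Sum>m=1..N. (cf f c e m L z)\<^sup>2)"
      if f: "continuous_on cell (sec f z)" and other: "\<And>c' e' m n. \<not> (c' = c \<and> e' = e) \<Longrightarrow> cf f c' e' m n z = 0"
        and high: "\<And>m n. \<not> (m \<le> N \<and> n \<le> L) \<Longrightarrow> cf f c e m n z = 0" and zero: "cf f c e 0 L z = 0" for f c e
    proof -
      have "co (l1/2) (l2/2) (sec f z) c' e' m n = 0" if "\<not> (c' = c \<and> e' = e \<and> m \<le> N \<and> n \<le> L)" for c' e' m n
        unfolding cf_co[symmetric] by (cases "c' = c \<and> e' = e") (use that other high in auto)
      from top_harmonic_of_square[OF f lp this zero[unfolded cf_co] L1] show ?thesis by (simp add: cf_co)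
    qed
    have "bm m n z = 0" if "\<not> (m \<le> N \<and> n \<le> L)" for m n
      using bm_eq[OF _ z, of m n] inact[OF that z] cf_degenerate(1)[of b False n z] by (cases "m = 0") auto
    then have ib: "integral cell (\<lambda>y. (sec b z y)\<^sup>2 * ?C y) = - ?k * (\<Sum>m=1..N. (bm m L z)\<^sup>2)"
      using sq[OF csec(2), of False False] b_parity[OF z] cf_degenerate(1)[of b False L z] by simp
    have "vm m n z = 0" if "\<not> (m \<le> N \<and> n \<le> L)" for m n
      using vm_eq[OF _ z, of m n] inact_r[OF that z] cf_degenerate(1)[of v True n z] by (cases "m = 0") auto
    then have iv: "integral cell (\<lambda>y. (sec v z y)\<^sup>2 * ?C y) = ?k * (\<Sum>m=1..N. (vm m L z)\<^sup>2)"
      using sq[OF csec(3), of False True] v_parity[OF z] cf_degenerate(1)[of v True L z] by simp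
    have ip: "integral cell (\<lambda>y. (sec p z y)\<^sup>2 * ?C y) = ?k * (\<Sum>m=1..N. (pm m L z)\<^sup>2)"
      using sq[OF csec(1), of True True] p_parity[OF z] inact[OF _ z] pm_0[OF L1 z] by simp
    have i: "((\<lambda>y. (sec f z y)\<^sup>2 * ?C y) has_integral integral cell (\<lambda>y. (sec f z y)\<^sup>2 * ?C y)) cell"
      if "continuous_on cell (sec f z)" for f
      by (intro integrable_integral integrable_continuous continuous_intros that)
    have "integral cell (\<lambda>y. (sec p z y)\<^sup>2 * ?C y + (U z)\<^sup>2 * ((sec b z y)\<^sup>2 * ?C y + (sec v z y)\<^sup>2 * ?C y))
      = ?k * (\<Sum>m=1..N. (pm m L z)\<^sup>2) + (U z)\<^sup>2 * (- ?k * (\<Sum>m=1..N. (bm m L z)\<^sup>2) + ?k * (\<Sum>m=1..N. (vm m L z)\<^sup>2))"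
      unfolding ip[symmetric] ib[symmetric] iv[symmetric]
      by (intro integral_unique has_integral_add has_integral_mult_right i csec)
    moreover have "integral cell (\<lambda>y. (sec p z y)\<^sup>2 * ?C y + (U z)\<^sup>2 * ((sec b z y)\<^sup>2 * ?C y + (sec v z y)\<^sup>2 * ?C y))
       = J z (\<lambda>x. ((p x)\<^sup>2 + (U (x $ 3))\<^sup>2 * ((b x)\<^sup>2 + (v x)\<^sup>2)) * tq True (2 * L) x)"
      unfolding J_def by (intro arg_cong2[of _ _ _ _ integral] refl ext)
        (simp add: sec_def tq_def tr_def lm_def algebra_simps)
    moreover have "J z (\<lambda>x. ((p x)\<^sup>2 + (U (x $ 3))\<^sup>2 * ((b x)\<^sup>2 + (v x)\<^sup>2)) * tq True (2 * L) x) = 0"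
      using E L1 zz unfolding no_transverse_energy_def by blast
    ultimately have "?k * (\<Sum>m=1..N. (pm m L z)\<^sup>2 - (U z)\<^sup>2 * (bm m L z)\<^sup>2 + (U z)\<^sup>2 * (vm m L z)\<^sup>2) = 0"
      by (simp add: sum.distrib sum_subtractf sum_distrib_left[symmetric] algebra_simps)
    then have "(\<Sum>m=1..N. (pm m L z)\<^sup>2 - (U z)\<^sup>2 * (bm m L z)\<^sup>2 + (U z)\<^sup>2 * (vm m L z)\<^sup>2) = 0"
      using l_pos by simp
    \<comment> \<open>With \<open>bm = lm pm / (km U)\<close> and \<open>vm = - U rm / km\<close>
      the three squares become the balance in \<open>no_balanced_modes\<close>. The sum starts at 1,
      so \<open>km m\<close> is positive.\<close>
    also have "(\<Sum>m=1..N. (pm m L z)\<^sup>2 - (U z)\<^sup>2 * (bm m L z)\<^sup>2 + (U z)\<^sup>2 * (vm m L z)\<^sup>2)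
       = (\<Sum>m=1..N. (((km m)\<^sup>2 - (lm L)\<^sup>2) * (pm m L z)\<^sup>2 + (U z)^4 * (rm m L z)\<^sup>2) / (km m)\<^sup>2)"
    proof (intro sum.cong refl)
      fix m assume m: "m \<in> {1..N}"
      then have k: "km m \<noteq> 0" "m \<ge> 1" using km_pos[of m] by auto
      show "(pm m L z)\<^sup>2 - (U z)\<^sup>2 * (bm m L z)\<^sup>2 + (U z)\<^sup>2 * (vm m L z)\<^sup>2
        = (((km m)\<^sup>2 - (lm L)\<^sup>2) * (pm m L z)\<^sup>2 + (U z)^4 * (rm m L z)\<^sup>2) / (km m)\<^sup>2"
        unfolding bm_eq[OF k(2) z] using k U0[OF z] by (simp add: field_simps power2_eq_square power4_eq_xxxx)
    qed
    also have "\<dots> = (\<Sum>m\<in>S. (((km m)\<^sup>2 - (lm L)\<^sup>2) * (pm m L z)\<^sup>2 + (U z)^4 * (rm m L z)\<^sup>2) / (km m)\<^sup>2)"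
    proof (rule sum.mono_neutral_right)
      show "S \<subseteq> {1..N}"
        proof
        fix i assume "i \<in> S"
        then have "act i L" by (simp add: S_def)
        then show "i \<in> {1..N}" using N[of i L] by (simp add: act_def)
      qed
      show "\<forall>m\<in>{1..N} - S. (((km m)\<^sup>2 - (lm L)\<^sup>2) * (pm m L z)\<^sup>2 + (U z)^4 * (rm m L z)\<^sup>2) / (km m)\<^sup>2 = 0"
      proof
        fix m assume "m \<in> {1..N} - S"
        then have "\<And>z. z \<in> {-d..0} \<Longrightarrow> pm m L z = 0" unfolding S_def act_def by auto
        then show "(((km m)\<^sup>2 - (lm L)\<^sup>2) * (pm m L z)\<^sup>2 + (U z)^4 * (rm m L z)\<^sup>2) / (km m)\<^sup>2 = 0"
          using rm_zero[of m L z] z by simp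
      qed
    qed simp
    finally show "(\<Sum>m\<in>S. (((km m)\<^sup>2 - (lm L)\<^sup>2) * (pm m L z)\<^sup>2 + (U z)^4 * (rm m L z)\<^sup>2) / (km m)\<^sup>2) = 0" .
  qed
  then show False using nc by simp
qed

text \<open>Modes with \<open>n\<close> at least 1 vanish, those with \<open>n = 0\<close> carry the
  factor \<open>lm 0 = 0\<close> in every x_2-derivative, and the sine series \<open>b\<close> has
  none of the latter. The elevation follows the pressure through the dynamic condition, where
  \<open>g + \<sigma> * \<kappa>\<close> is positive.\<close>

theorem two_dimensional:
  assumes E: no_transverse_energy and nc: "\<not> U constant_on {-d..0}" and x: "x \<in> D"
  shows "b x = 0" "p' x $ 2 = 0" "v' x $ 2 = 0" "x $ 3 = 0 \<Longrightarrow> h' x $ 2 = 0"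
proof -
  define z where "z = x $ 3"
  have z: "z \<in> {-d..0}" using x by (simp add: in_D z_def)
  have P: "pm m n z = 0" if "n \<ge> 1" "z \<in> {-d..0}" for m n z by (rule transverse_modes_vanish[OF E nc that])
  have lm0: "lm 0 = 0" by (simp add: lm_def)
  have B: "bm m n z = 0" for m n
    using bm_eq[OF _ z, of m n] P[of n z] z lm0 cf_degenerate(1)[of b False n z] by (cases "m = 0"; cases "n = 0") auto
  have "cf b c e m n z = 0" for c e m n using B b_parity[OF z, of c e] by (cases c; cases e) auto
  then show "b x = 0" using cf_zero[OF contD(4) C1_periodic(1)[OF b] _ x] by (simp add: z_def)
  have "lm n * pm m n z = 0" for m n using P[of n z] z lm0 by (cases "n = 0") auto
  then have "cf (\<lambda>x. p' x $ 2) c e m n z = 0" for c e m n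
    unfolding cf_d2[OF p z] using p_parity[OF z, of c "\<not> e" m n] by (cases c; cases e) auto
  then show "p' x $ 2 = 0" using cf_zero[OF C1_cont'[OF p] C1_periodic(2)[OF p] _ x] by (simp add: z_def)
  have "lm n * vm m n z = 0" for m n
  proof (cases "n = 0 \<or> m = 0")
    case True
    then show ?thesis using lm0 cf_degenerate(1)[of v True n z] by auto
  next
    case False
    then show ?thesis using U0[OF z] km_pos[of m] rm_zero[OF P z, of n m] by simp
  qed
  then have "cf (\<lambda>x. v' x $ 2) c e m n z = 0" for c e m n
    unfolding cf_d2[OF v z] using v_parity[OF z, of c "\<not> e" m n] by (cases c; cases e) auto
  then show "v' x $ 2 = 0" using cf_zero[OF C1_cont'[OF v] C1_periodic(2)[OF v] _ x] by (simp add: z_def)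
  assume x3: "x $ 3 = 0"
  have z0: "0 \<in> {-d..0}" using d_pos by simp
  have "lm n * hm m n = 0" for m n
  proof (cases "n = 0")
    case False
    have "g + \<sigma> * \<kappa> m n > 0" using gs by (simp add: add_pos_nonneg)
    then show ?thesis using mode_top(1)[of m n] P[OF _ z0, of n m] False by simp
  qed (simp add: lm0)
  then have "cf (\<lambda>x. h' x $ 2) c e m n 0 = 0" for c e m n
    unfolding cf_d2[OF h z0] using h_parity[OF z0, of c "\<not> e" m n] by (cases c; cases e) auto
  then show "h' x $ 2 = 0" using cf_zero[OF C1_cont'[OF h] C1_periodic(2)[OF h] _ x] x3 by simp
qed

end

section \<open>Solvability at second order\<close>

text \<open>The numbers are values at a point: digits mark partial derivatives, \<delta> is
  \<open>1 / d\<close>, \<open>\<phi>1\<close> and \<open>\<phi>2\<close> are horizontal derivatives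
  of the first-order \<phi>, while \<open>e\<close> and \<open>q\<close> are the second-order
  transverse velocity and pressure. Twice the transverse momentum balance becomes an x_1-derivative
  plus the x_2-derivative of \<open>p^2 / U^2 + b^2 + v^2 + 2 (q - U \<phi>1 v)\<close>. The term
  \<open>b p / U\<close> is inserted because its x_1-derivative contains
  \<open>- p p2 / U^2\<close>.\<close>

lemma second_order_identity2:
  fixes U U' a a1 b b1 b2 b3 v v1 v2 v3 p p1 p2 p3 \<phi>1 \<phi>2 \<phi>12 h h1 \<delta> e1 q2 :: real
  assumes U: "U \<noteq> 0" and m1: "- U * (b2 + v3) + U' * v + p1 = 0" and m2: "U * b1 + p2 = 0" and m3: "U * v1 + p3 = 0"
    and rot: "U * v2 = U' * b + U * b3" and div: "a1 + b2 + (v3 - U' * \<phi>1 - U * h1 * \<delta>) = 0"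
  shows "2 * (U * e1 + h * \<delta> * (U * b1) + (a * b1 + b * b2 + (v - U * \<phi>1) * b3) - b * U * h1 * \<delta> - \<phi>2 * p3 + q2 + 3 * (h * \<delta>) * p2)
    = 2 * (U * e1 + (a1 * b + a * b1) + (b1 * p + b * p1) / U - 2 * U * (h1 * b + h * b1) * \<delta> + U * (\<phi>12 * v + \<phi>2 * v1))
      + (2 * p * p2 / U\<^sup>2 + 2 * b * b2 + 2 * v * v2) + 2 * (q2 - U * (\<phi>12 * v + \<phi>1 * v2))"
proof -
  have e: "p1 = U * (b2 + v3) - U' * v" "p2 = - (U * b1)" "p3 = - (U * v1)" "b3 = v2 - U' * b / U"
    "a1 = - b2 - (v3 - U' * \<phi>1 - U * h1 * \<delta>)"
    using m1 m2 m3 div rot U by (auto simp: field_simps)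
  show ?thesis unfolding e using U by (simp add: field_simps power2_eq_square)
qed

text \<open>The undifferentiated last term offsets the factors \<open>U'\<close> that come from
  differentiating \<open>1 / U^2\<close>, from the vorticity relation and from the first momentum
  equation. Since it is not a derivative, it survives averaging and makes the two balances
  restrictive together.\<close>

lemma second_order_identity3:
  fixes U U' a a1 b b1 b2 b3 v v1 v2 v3 p p1 p2 p3 \<phi>1 h1 \<delta> X1 q3 :: real
  assumes U: "U \<noteq> 0" and m1: "- U * (b2 + v3) + U' * v + p1 = 0" and m2: "U * b1 + p2 = 0" and m3: "U * v1 + p3 = 0"
    and rot: "U * v2 = U' * b + U * b3" and div: "a1 + b2 + (v3 - U' * \<phi>1 - U * h1 * \<delta>) = 0"
  shows "2 * (a * v1 + b * v2 + (v - U * \<phi>1) * v3 + q3 + U * X1)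
    = 2 * ((a1 * v + a * v1) + (v1 * p + v * p1) / U + U * X1)
      + (2 * p * p3 / U\<^sup>2 - 2 * U' * p\<^sup>2 / U^3 + 2 * b * b3 + 2 * v * v3)
      + 2 * (q3 - (U' * \<phi>1 * v + U * (h1 * \<delta> * v + \<phi>1 * v3))) + 2 * (U' / U) * (p\<^sup>2 / U\<^sup>2 + b\<^sup>2 + v\<^sup>2)"
proof -
  have e: "p1 = U * (b2 + v3) - U' * v" "p2 = - (U * b1)" "p3 = - (U * v1)" "b3 = v2 - U' * b / U"
    "a1 = - b2 - (v3 - U' * \<phi>1 - U * h1 * \<delta>)"
    using m1 m2 m3 div rot U by (auto simp: field_simps)
  show ?thesis unfolding e using U by (simp add: field_simps power2_eq_square power3_eq_cube)
qed

context slab begin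

lemma C1_height: "C1 (\<lambda>x. 1 + x $ 3 / d) (\<lambda>x. axis 3 (1 / d))"
proof (rule C1_vertical[of "\<lambda>z. 1 + z / d" "\<lambda>z. 1 / d"])
  show "((\<lambda>z. 1 + z / d) has_real_derivative 1 / d) (at z within {-d..0})" for z
    using d_pos by (auto intro!: derivative_eq_intros)
qed (intro continuous_intros)

lemma C1_cmult: "C1 f f' \<Longrightarrow> C1 (\<lambda>x. k * f x) (\<lambda>x. k *\<^sub>R f' x)"
  using C1_mult[OF C1_const[of k]] by simp

lemma J_d1_weighted:
  assumes f: "C1 f f'" and z: "z \<in> {-d..0}"
  shows "J z (\<lambda>x. tq e n x * f' x $ 1) = 0"
  using J_d1[OF C1_mult[OF C1_tq f] z, of e n] by (simp add: axis_def)

lemma J_d2_weighted: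
  assumes f: "C1 f f'" and z: "z \<in> {-d..0}"
  shows "J z (\<lambda>x. tq False n x * f' x $ 2) = - lm n * J z (\<lambda>x. tq True n x * f x)"
proof -
  have "J z (\<lambda>x. tq False n x * f' x $ 2 + lm n * (tq True n x * f x)) = 0"
    using J_d2[OF C1_mult[OF C1_tq f] z, of False n] by (simp add: axis_def mult_ac sg_def)
  then show ?thesis
    by (subst (asm) J_add) (intro continuous_intros cont_tq C1_cont[OF f] C1_cont'[OF f] z | simp add: J_cmult)+
qed

lemma J_d3_weighted:
  assumes f: "C1 f f'" and z: "z \<in> {-d<..<0}" and vanish: "\<And>z. z \<in> {-d<..<0} \<Longrightarrow> J z (\<lambda>x. tq e n x * f x) = 0"
  shows "J z (\<lambda>x. tq e n x * f' x $ 3) = 0"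
proof -
  have zz: "z \<in> {-d..0}" "at z within {-d..0} = at z" using z by (auto simp: at_within_interior[of z "{-d..0}"])
  have "((\<lambda>z. J z (\<lambda>x. tq e n x * f x)) has_real_derivative J z (\<lambda>x. tq e n x * f' x $ 3)) (at z)"
    using J_d3[OF C1_mult[OF C1_tq f] zz(1), of e n] unfolding zz(2) by (simp add: axis_def)
  moreover have "((\<lambda>z. J z (\<lambda>x. tq e n x * f x)) has_real_derivative 0) (at z)"
  proof -
    have "\<forall>\<^sub>F w in nhds z. J w (\<lambda>x. tq e n x * f x) = 0"
      by (rule eventually_mono[OF eventually_nhds_in_open[of "{-d<..<0}" z]]) (use z vanish in auto)
    then show ?thesis using DERIV_cong_ev[OF refl, of "\<lambda>z. J z (\<lambda>x. tq e n x * f x)" "\<lambda>_. 0" z 0 0] by simp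
  qed
  ultimately show ?thesis using DERIV_unique by blast
qed

end

context linear_wave begin

definition slope1 :: "real^3 \<Rightarrow> real" where "slope1 x = (1 + x $ 3 / d) * h' x $ 1"
definition slope2 :: "real^3 \<Rightarrow> real" where "slope2 x = (1 + x $ 3 / d) * h' x $ 2"

lemma C1_slope: "C1 slope1 (\<lambda>x. (1 + x $ 3 / d) *\<^sub>R h1' x + (h' x $ 1) *\<^sub>R axis 3 (1 / d))"
    "C1 slope2 (\<lambda>x. (1 + x $ 3 / d) *\<^sub>R h2' x + (h' x $ 2) *\<^sub>R axis 3 (1 / d))"
  using C1_mult[OF C1_height h1] C1_mult[OF C1_height h2] unfolding slope1_def[abs_def] slope2_def[abs_def] by simp_all

lemma C1_inverse_U: "C1 (\<lambda>x. 1 / U (x $ 3)) (\<lambda>x. axis 3 (- U' (x $ 3) / (U (x $ 3))\<^sup>2))"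
proof (rule C1_vertical[of "\<lambda>z. 1 / U z" "\<lambda>z. - U' z / (U z)\<^sup>2"])
  show "((\<lambda>z. 1 / U z) has_real_derivative - U' z / (U z)\<^sup>2) (at z within {-d..0})" if "z \<in> {-d..0}" for z
    using dU[OF that] U0[OF that] by (auto intro!: derivative_eq_intros simp: power2_eq_square)
  show "continuous_on {-d..0} (\<lambda>z. - U' z / (U z)\<^sup>2)" by (intro continuous_intros cU cU') (use U0 in auto)
qed

text \<open>Modulo \<open>x\<^sub>1\<close>-derivatives, the second-order equations read \<open>\<partial>\<^sub>2 (E + Q) = 0\<close> and
  \<open>\<partial>\<^sub>3 (E + Q) + 2 (U'/U) E = 0\<close> with \<open>2 E = p\<^sup>2/U\<^sup>2 + b\<^sup>2 + v\<^sup>2\<close>; eliminating \<open>E + Q\<close> leaves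
  \<open>U' \<partial>\<^sub>2 E = 0\<close> in the mean over \<open>x\<^sub>1\<close>.\<close>

lemma second_order_solvability:
  assumes a: "C1 a a'" and e: "C1 e e'" and q: "C1 q q'" and X: "C1 X X'"
    and h13: "\<And>x. x \<in> D \<Longrightarrow> h1' x $ 3 = 0"
    and div: "\<And>x. x \<in> Omega d \<Longrightarrow> a' x $ 1 + b' x $ 2 + (v' x $ 3 - U' (x $ 3) * slope1 x - U (x $ 3) * h' x $ 1 * (1 / d)) = 0"
    and s2: "\<And>x. x \<in> Omega d \<Longrightarrow> U (x $ 3) * e' x $ 1 + h x * (1 / d) * (U (x $ 3) * b' x $ 1)
       + (a x * b' x $ 1 + b x * b' x $ 2 + (v x - U (x $ 3) * slope1 x) * b' x $ 3)
       - b x * U (x $ 3) * h' x $ 1 * (1 / d) - slope2 x * p' x $ 3 + q' x $ 2 + 3 * (h x * (1 / d)) * p' x $ 2 = 0"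
    and s3: "\<And>x. x \<in> Omega d \<Longrightarrow> a x * v' x $ 1 + b x * v' x $ 2 + (v x - U (x $ 3) * slope1 x) * v' x $ 3 + q' x $ 3 + U (x $ 3) * X' x $ 1 = 0"
  shows no_transverse_energy
proof -
  note V = C1_inverse_U and U = C1_U
  note G = C1_add[OF C1_add[OF C1_mult[OF C1_mult[OF V p] C1_mult[OF V p]] C1_mult[OF b b]] C1_mult[OF v v]]
  note Q = C1_diff[OF q C1_mult[OF C1_mult[OF U C1_slope(1)] v]]
  note GQ = C1_add[OF G C1_cmult[OF Q, of 2]]
  \<comment> \<open>\<open>T2\<close> and \<open>T3\<close> gather the quantities whose
    x_1-derivatives occur; these derivatives drop out of means over x_1, even with a weight
    depending on x_2.\<close>
  note T2 = C1_cmult[OF C1_add[OF C1_diff[OF C1_add[OF C1_add[OF C1_mult[OF U e] C1_mult[OF a b]] C1_mult[OF V C1_mult[OF b p]]]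
      C1_mult[OF C1_cmult[OF U, of "2 / d"] C1_mult[OF h b]]] C1_mult[OF U C1_mult[OF C1_slope(2) v]]], of 2]
  note T3 = C1_cmult[OF C1_add[OF C1_add[OF C1_mult[OF a v] C1_mult[OF V C1_mult[OF v p]]] C1_mult[OF U X]], of 2]
  let ?G = "\<lambda>x. 1 / U (x $ 3) * p x * (1 / U (x $ 3) * p x) + b x * b x + v x * v x"
  let ?F = "\<lambda>x. ?G x + 2 * (q x - U (x $ 3) * slope1 x * v x)"
  obtain F' where F: "C1 ?F F'"
    and F2: "\<And>x. F' x $ 2 = 2 * p x * p' x $ 2 / (U (x $ 3))\<^sup>2 + 2 * b x * b' x $ 2 + 2 * v x * v' x $ 2
       + 2 * (q' x $ 2 - U (x $ 3) * ((1 + x $ 3 / d) * h1' x $ 2 * v x + slope1 x * v' x $ 2))"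
    and F3: "\<And>x. x \<in> D \<Longrightarrow> F' x $ 3 = 2 * p x * p' x $ 3 / (U (x $ 3))\<^sup>2 - 2 * U' (x $ 3) * (p x)\<^sup>2 / (U (x $ 3))^3 + 2 * b x * b' x $ 3 + 2 * v x * v' x $ 3
       + 2 * (q' x $ 3 - (U' (x $ 3) * slope1 x * v x + U (x $ 3) * (h' x $ 1 * (1 / d) * v x + slope1 x * v' x $ 3)))"
  proof (rule that[OF GQ])
  qed (use h13 U0 in \<open>auto simp: axis_def algebra_simps power2_eq_square power3_eq_cube in_D\<close>)
  obtain T2f T2' where T2: "C1 T2f T2'" and T2d: "\<And>x. x \<in> D \<Longrightarrow> T2' x $ 1 = 2 * (U (x $ 3) * e' x $ 1 + (a' x $ 1 * b x + a x * b' x $ 1) + (b' x $ 1 * p x + b x * p' x $ 1) / U (x $ 3)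
       - 2 * U (x $ 3) * (h' x $ 1 * b x + h x * b' x $ 1) * (1 / d) + U (x $ 3) * ((1 + x $ 3 / d) * h1' x $ 2 * v x + slope2 x * v' x $ 1))"
    by (rule that[OF T2]) (use mixed_derivatives[OF h h1 h2] in \<open>simp add: axis_def algebra_simps add_divide_distrib\<close>)
  obtain T3f T3' where T3: "C1 T3f T3'" and T3d: "\<And>x. T3' x $ 1 = 2 * ((a' x $ 1 * v x + a x * v' x $ 1) + (v' x $ 1 * p x + v x * p' x $ 1) / U (x $ 3) + U (x $ 3) * X' x $ 1)"
    by (rule that[OF T3]) (simp add: axis_def algebra_simps add_divide_distrib)
  have OD: "x \<in> Omega d \<longleftrightarrow> x \<in> D \<and> x $ 3 \<in> {-d<..<0}" for x by (auto simp: Omega_def in_D)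
  have id2: "T2' x $ 1 + F' x $ 2 = 0" if x: "x \<in> D" "x $ 3 \<in> {-d<..<0}" for x
    using second_order_identity2[OF U0 momentum1[OF x(1)] momentum2[OF x(1)] momentum3[OF x(1)] rotation[OF x(1)] div,
        where ?e1.0 = "e' x $ 1" and h = "h x" and a = "a x" and p = "p x" and ?\<phi>2.0 = "slope2 x" and ?q2.0 = "q' x $ 2"
          and ?\<phi>12.0 = "(1 + x $ 3 / d) * h1' x $ 2"] s2[of x] x
    unfolding T2d[OF x(1)] F2 OD by (simp add: in_D)
  have id3: "T3' x $ 1 + F' x $ 3 + 2 * (U' (x $ 3) / U (x $ 3)) * ?G x = 0" if x: "x \<in> D" "x $ 3 \<in> {-d<..<0}" for x
    using second_order_identity3[OF U0 momentum1[OF x(1)] momentum2[OF x(1)] momentum3[OF x(1)] rotation[OF x(1)] div,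
        where a = "a x" and p = "p x" and ?q3.0 = "q' x $ 3" and ?X1.0 = "X' x $ 1"] s3[of x] x
    unfolding T3d F3[OF x(1)] OD by (simp add: in_D power2_eq_square)
  have cG: "continuous_on D ?G" by (rule C1_cont[OF G])
  note cc = continuous_intros cont_tq C1_cont'[OF T2] C1_cont'[OF T3] C1_cont'[OF F] cG
  \<comment> \<open>Tested with a sine in x_2, the transverse balance loses \<open>T2'\<close>, and
    integration by parts leaves a nonzero multiple of the cosine coefficient of \<open>?F\<close>.
    As this holds at every interior height, the vertical derivative of that coefficient vanishes
    too.\<close>
  have F0: "J z (\<lambda>x. tq True n x * ?F x) = 0" if z: "z \<in> {-d<..<0}" and n: "n \<ge> 1" for z n
  proof -
    have zz: "z \<in> {-d..0}" using z by auto
    have "J z (\<lambda>x. tq False n x * T2' x $ 1 + tq False n x * F' x $ 2) = J z (\<lambda>x. 0 * ?F x)"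
      by (rule J_cong[OF zz]) (use id2 z in \<open>simp add: distrib_left[symmetric]\<close>)
    also have "\<dots> = 0" unfolding J_cmult by simp
    also have "J z (\<lambda>x. tq False n x * T2' x $ 1 + tq False n x * F' x $ 2)
       = J z (\<lambda>x. tq False n x * T2' x $ 1) + J z (\<lambda>x. tq False n x * F' x $ 2)"
      by (intro J_add zz cc)
    finally show ?thesis using J_d1_weighted[OF T2 zz] J_d2_weighted[OF F zz, of n] lm_pos[OF n] by simp
  qed
  show ?thesis unfolding no_transverse_energy_def
  proof (intro allI impI)
    fix L z assume L: "L \<ge> (1::nat)" and z: "-d < z \<and> z < 0 \<and> U' z \<noteq> 0"
    then have zz: "z \<in> {-d..0}" "z \<in> {-d<..<0}" and n: "2 * L \<ge> 1" by auto
    let ?t = "tq True (2 * L)"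
    \<comment> \<open>Tested with the cosine of frequency \<open>2 * L\<close>, the vertical balance
      retains only the term with \<open>U' / U\<close>.\<close>
    have "J z (\<lambda>x. ?t x * T3' x $ 1 + ?t x * F' x $ 3 + 2 * (U' z / U z) * (?t x * ?G x)) = J z (\<lambda>x. 0 * ?F x)"
    proof (rule J_cong[OF zz(1)])
      fix x assume x: "x \<in> D" "x $ 3 = z"
      have "?t x * T3' x $ 1 + ?t x * F' x $ 3 + 2 * (U' z / U z) * (?t x * ?G x)
         = ?t x * (T3' x $ 1 + F' x $ 3 + 2 * (U' (x $ 3) / U (x $ 3)) * ?G x)" using x by (simp add: algebra_simps)
      also have "\<dots> = 0" using id3[OF x(1)] x zz by simp
      finally show "?t x * T3' x $ 1 + ?t x * F' x $ 3 + 2 * (U' z / U z) * (?t x * ?G x) = 0 * ?F x" by simp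
    qed
    also have "\<dots> = 0" unfolding J_cmult by simp
    also have "J z (\<lambda>x. ?t x * T3' x $ 1 + ?t x * F' x $ 3 + 2 * (U' z / U z) * (?t x * ?G x))
       = J z (\<lambda>x. ?t x * T3' x $ 1 + ?t x * F' x $ 3) + J z (\<lambda>x. 2 * (U' z / U z) * (?t x * ?G x))"
      by (intro J_add zz(1) cc)
    also have "J z (\<lambda>x. ?t x * T3' x $ 1 + ?t x * F' x $ 3) = J z (\<lambda>x. ?t x * T3' x $ 1) + J z (\<lambda>x. ?t x * F' x $ 3)"
      by (intro J_add zz(1) cc)
    also have "J z (\<lambda>x. 2 * (U' z / U z) * (?t x * ?G x)) = 2 * (U' z / U z) * J z (\<lambda>x. ?t x * ?G x)"
      by (rule J_cmult)
    finally have "2 * (U' z / U z) * J z (\<lambda>x. ?t x * ?G x) = 0"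
      using J_d1_weighted[OF T3 zz(1)] J_d3_weighted[OF F zz(2) F0[OF _ n]] by simp
    then have "J z (\<lambda>x. ?t x * ?G x) = 0" using z U0[OF zz(1)] by simp
    moreover have "J z (\<lambda>x. ((p x)\<^sup>2 + (U (x $ 3))\<^sup>2 * ((b x)\<^sup>2 + (v x)\<^sup>2)) * ?t x) = J z (\<lambda>x. (U z)\<^sup>2 * (?t x * ?G x))"
      by (rule J_cong[OF zz(1)]) (use U0[OF zz(1)] in \<open>simp add: field_simps power2_eq_square\<close>)
    ultimately show "J z (\<lambda>x. ((p x)\<^sup>2 + (U (x $ 3))\<^sup>2 * ((b x)\<^sup>2 + (v x)\<^sup>2)) * ?t x) = 0"
      by (simp add: J_cmult)
  qed
qed

end

section \<open>Pointwise expansions of curves\<close>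

text \<open>This condition makes derivatives within \<open>D\<close> unique.\<close>

definition thick :: "'a::euclidean_space set \<Rightarrow> bool" where
  "thick D \<longleftrightarrow> (\<forall>x\<in>D. \<forall>i\<in>Basis. \<forall>e>0. \<exists>t. 0 < \<bar>t\<bar> \<and> \<bar>t\<bar> < e \<and> x + t *\<^sub>R i \<in> D)"

lemma dirderiv_eq:
  assumes "thick D" "x \<in> D" "(f has_derivative F) (at x within D)"
  shows "dirderiv D b f x = F b"
proof -
  have "frechet_derivative f (at x within D) = F"
  proof (rule frechet_derivative_unique_within[OF _ assms(3)])
    show "(f has_derivative frechet_derivative f (at x within D)) (at x within D)"
      using assms(3) differentiableI frechet_derivative_works by blast
  qed (use assms(1,2) in \<open>auto simp: thick_def\<close>)
  then show ?thesis by (simp add: dirderiv_def)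
qed

lemma has_dirderiv:
  assumes "f differentiable_on D" "x \<in> D"
  shows "(f has_derivative (\<lambda>b. dirderiv D b f x)) (at x within D)"
  using assms unfolding differentiable_on_def dirderiv_def by (simp add: frechet_derivative_works[symmetric])

lemma dirderiv_cong:
  assumes "thick D" "f differentiable_on D" "\<And>x. x \<in> D \<Longrightarrow> g x = f x" "x \<in> D"
  shows "dirderiv D b g x = dirderiv D b f x"
  using has_derivative_transform[OF assms(4,3) has_dirderiv[OF assms(2,4)]] by (intro dirderiv_eq assms)

lemma dirderiv_linear:
  assumes D: "thick D" and f: "f differentiable_on D" and g: "g differentiable_on D" and x: "x \<in> D"
  shows "dirderiv D b (\<lambda>x. f x + c *\<^sub>R g x) x = dirderiv D b f x + c *\<^sub>R dirderiv D b g x"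
  by (rule dirderiv_eq[OF D x]) (intro derivative_intros has_dirderiv f g x)

text \<open>\<open>frechet_derivative\<close> is a choice operator, so linearity in the function
  rests on uniqueness, which \<open>thick\<close> supplies. One scaled summand at a time suffices to
  assemble the remainder of an expansion.\<close>

lemma C2_on_linear:
  assumes D: "thick D" and f: "C2_on D f" and g: "C2_on D g"
  shows "C2_on D (\<lambda>x. f x + c *\<^sub>R g x)"
    and "\<And>b. x \<in> D \<Longrightarrow> dirderiv D b (\<lambda>x. f x + c *\<^sub>R g x) x = dirderiv D b f x + c *\<^sub>R dirderiv D b g x"
    and "\<And>a b. x \<in> D \<Longrightarrow> b \<in> Basis \<Longrightarrow> dirderiv D a (dirderiv D b (\<lambda>x. f x + c *\<^sub>R g x)) x
        = dirderiv D a (dirderiv D b f) x + c *\<^sub>R dirderiv D a (dirderiv D b g) x"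
proof -
  let ?h = "\<lambda>x. f x + c *\<^sub>R g x"
  have df: "f differentiable_on D" "g differentiable_on D" using f g by (auto simp: C2_on_def)
  have df2: "dirderiv D b f differentiable_on D" "dirderiv D b g differentiable_on D" if "b \<in> Basis" for b
    using f g that by (auto simp: C2_on_def)
  have dh: "?h differentiable_on D" using df by (auto simp: differentiable_on_def intro!: derivative_intros)
  have 1: "dirderiv D b ?h x = dirderiv D b f x + c *\<^sub>R dirderiv D b g x" if "x \<in> D" for b x
    by (rule dirderiv_linear[OF D df that])
  have dl: "(\<lambda>x. dirderiv D b f x + c *\<^sub>R dirderiv D b g x) differentiable_on D" if "b \<in> Basis" for b
    using df2[OF that] by (auto simp: differentiable_on_def intro!: derivative_intros)
  have dh2: "dirderiv D b ?h differentiable_on D" if "b \<in> Basis" for b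
    using dl[OF that] 1 unfolding differentiable_on_def differentiable_def by (metis (mono_tags, lifting) has_derivative_transform)
  have 2: "dirderiv D a (dirderiv D b ?h) x = dirderiv D a (dirderiv D b f) x + c *\<^sub>R dirderiv D a (dirderiv D b g) x"
    if "x \<in> D" "b \<in> Basis" for a b x
  proof -
    have "dirderiv D a (dirderiv D b ?h) x = dirderiv D a (\<lambda>x. dirderiv D b f x + c *\<^sub>R dirderiv D b g x) x"
      by (rule dirderiv_cong[OF D dl[OF that(2)] _ that(1)]) (rule 1)
    then show ?thesis using dirderiv_linear[OF D df2[OF that(2)] that(1)] by simp
  qed
  show "C2_on D ?h" unfolding C2_on_def
  proof (intro conjI ballI dh dh2)
    fix a b :: 'a assume ab: "b \<in> Basis" "a \<in> Basis"
    have "continuous_on D (\<lambda>x. dirderiv D a (dirderiv D b f) x + c *\<^sub>R dirderiv D a (dirderiv D b g) x)"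
      using f g ab unfolding C2_on_def by (intro continuous_intros) auto
    then show "continuous_on D (dirderiv D a (dirderiv D b ?h))"
      by (subst continuous_on_cong[OF refl 2[OF _ ab(1)]])
  qed
  show "\<And>b. x \<in> D \<Longrightarrow> dirderiv D b ?h x = dirderiv D b f x + c *\<^sub>R dirderiv D b g x" by (rule 1)
  show "\<And>a b. x \<in> D \<Longrightarrow> b \<in> Basis \<Longrightarrow> dirderiv D a (dirderiv D b ?h) x
        = dirderiv D a (dirderiv D b f) x + c *\<^sub>R dirderiv D a (dirderiv D b g) x" by (rule 2)
qed

text \<open>A common frame for the slab and the plane. The compact set meets every lattice orbit,
  which makes continuous periodic functions bounded.\<close>

definition periodic_domain :: "real \<Rightarrow> real \<Rightarrow> (real^('n::{finite,numeral})) set \<Rightarrow> bool" where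
  "periodic_domain l1 l2 D \<longleftrightarrow> thick D \<and>
    (\<forall>x\<in>D. \<forall>(k::int) (m::int). x + axis 1 (l1 * of_int k) + axis 2 (l2 * of_int m) \<in> D) \<and>
    (\<exists>K\<subseteq>D. compact K \<and> (\<forall>x\<in>D. \<exists>(k::int) (m::int). x + axis 1 (l1 * of_int k) + axis 2 (l2 * of_int m) \<in> K))"

lemma periodic_dirderiv:
  fixes D :: "(real^('n::{finite,numeral})) set"
  assumes D: "periodic_domain l1 l2 D" and p: "periodic_on l1 l2 D f" and f: "f differentiable_on D"
  shows "periodic_on l1 l2 D (dirderiv D b f)"
  unfolding periodic_on_def
proof (intro ballI allI)
  fix x k m assume x: "x \<in> D"
  define \<tau> :: "(real, 'n) vec" where "\<tau> = axis 1 (l1 * of_int k) + axis 2 (l2 * of_int m)"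
  have shift: "y + \<tau> \<in> D" "f (y + \<tau>) = f y" if "y \<in> D" for y
    using D p that unfolding \<tau>_def periodic_domain_def periodic_on_def by (auto simp: add.assoc)
  have unshift: "y - \<tau> \<in> D" if "y \<in> D" for y
  proof -
    have "y + axis 1 (l1 * of_int (-k)) + axis 2 (l2 * of_int (-m)) \<in> D"
      using D that unfolding periodic_domain_def by blast
    moreover have "y + axis 1 (l1 * of_int (-k)) + axis 2 (l2 * of_int (-m)) = y - \<tau>"
      unfolding \<tau>_def by (simp add: vec_eq_iff axis_def)
    ultimately show ?thesis by metis
  qed
  have im: "(\<lambda>y. y - \<tau>) ` D = D"
  proof
    show "D \<subseteq> (\<lambda>y. y - \<tau>) ` D" using shift(1) by (auto intro!: image_eqI[where x = "y + \<tau>" for y])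
  qed (use unshift in auto)
  have "((\<lambda>y. y - \<tau>) has_derivative (\<lambda>h. h)) (at (x + \<tau>) within D)" by (auto intro!: derivative_eq_intros)
  moreover have "(f has_derivative (\<lambda>b. dirderiv D b f x)) (at ((x + \<tau>) - \<tau>) within (\<lambda>y. y - \<tau>) ` D)"
    using has_dirderiv[OF f x] im by simp
  ultimately have "((\<lambda>y. f (y - \<tau>)) has_derivative (\<lambda>b. dirderiv D b f x)) (at (x + \<tau>) within D)"
    by (rule has_derivative_in_compose)
  then have "(f has_derivative (\<lambda>b. dirderiv D b f x)) (at (x + \<tau>) within D)"
    by (rule has_derivative_transform[OF shift(1)[OF x], rotated]) (use shift(2)[OF unshift] in auto)
  then have "dirderiv D b f (x + \<tau>) = dirderiv D b f x"
    using D shift(1)[OF x] unfolding periodic_domain_def by (intro dirderiv_eq) auto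
  then show "dirderiv D b f (x + axis 1 (l1 * of_int k) + axis 2 (l2 * of_int m)) = dirderiv D b f x"
    by (simp add: \<tau>_def add.assoc)
qed

lemma periodic_bounded:
  fixes D :: "(real^('n::{finite,numeral})) set"
  assumes D: "periodic_domain l1 l2 D" and p: "periodic_on l1 l2 D f" and c: "continuous_on D f"
  shows "\<exists>M. \<forall>x\<in>D. norm (f x) \<le> M"
proof -
  obtain K where K: "K \<subseteq> D" "compact K"
    "\<And>x. x \<in> D \<Longrightarrow> \<exists>(k::int) (m::int). x + axis 1 (l1 * of_int k) + axis 2 (l2 * of_int m) \<in> K"
    using D unfolding periodic_domain_def by blast
  have "compact (f ` K)" using K c by (meson compact_continuous_image continuous_on_subset)
  then obtain M where M: "\<forall>y\<in>f ` K. norm y \<le> M" using compact_imp_bounded bounded_iff by blast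
  have "norm (f x) \<le> M" if x: "x \<in> D" for x
  proof -
    obtain k m :: int where "x + axis 1 (l1 * of_int k) + axis 2 (l2 * of_int m) \<in> K" using K(3)[OF x] by blast
    then have "norm (f (x + axis 1 (l1 * of_int k) + axis 2 (l2 * of_int m))) \<le> M" using M by blast
    then show ?thesis using p x unfolding periodic_on_def by simp
  qed
  then show ?thesis by blast
qed

text \<open>A supremum of reals dominates its members only if they are bounded above; periodicity
  and continuity provide this for the function together with its derivatives up to second
  order.\<close>

lemma C2_norm_bounds:
  fixes D :: "(real^('n::{finite,numeral})) set"
  assumes D: "periodic_domain l1 l2 D" and p: "periodic_on l1 l2 D f" and f: "C2_on D f" and x: "x \<in> D"
  shows "norm (f x) \<le> C2_norm D f" "b \<in> Basis \<Longrightarrow> norm (dirderiv D b f x) \<le> C2_norm D f"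
    "a \<in> Basis \<Longrightarrow> b \<in> Basis \<Longrightarrow> norm (dirderiv D a (dirderiv D b f) x) \<le> C2_norm D f"
proof -
  let ?s = "\<lambda>x. norm (f x) + (\<Sum>b\<in>Basis. norm (dirderiv D b f x))
     + (\<Sum>b\<in>Basis. \<Sum>c\<in>Basis. norm (dirderiv D c (dirderiv D b f) x))"
  have df: "f differentiable_on D" "\<And>b. b \<in> Basis \<Longrightarrow> dirderiv D b f differentiable_on D"
    using f by (auto simp: C2_on_def)
  have cont: "continuous_on D ?s"
    using f unfolding C2_on_def
    by (intro continuous_intros differentiable_imp_continuous_on[OF df(1)] differentiable_imp_continuous_on[OF df(2)]) auto
  have p1: "periodic_on l1 l2 D (dirderiv D b f)" for b by (rule periodic_dirderiv[OF D p df(1)])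
  have p2: "periodic_on l1 l2 D (dirderiv D a (dirderiv D b f))" if "b \<in> Basis" for a b
    by (rule periodic_dirderiv[OF D p1 df(2)[OF that]])
  have "periodic_on l1 l2 D ?s"
    using p p1 p2 unfolding periodic_on_def by auto
  then obtain M where "\<forall>x\<in>D. norm (?s x) \<le> M" using periodic_bounded[OF D _ cont] by blast
  then have "bdd_above (?s ` D)" by (intro bdd_aboveI[of _ M]) auto
  then have le: "?s x \<le> C2_norm D f" unfolding C2_norm_def using x by (intro cSUP_upper)
  have s1: "(\<Sum>b\<in>Basis. norm (dirderiv D b f x)) \<ge> 0" by (intro sum_nonneg) auto
  have s2: "(\<Sum>b\<in>Basis. \<Sum>c\<in>Basis. norm (dirderiv D c (dirderiv D b f) x)) \<ge> 0" by (intro sum_nonneg) auto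
  show "norm (f x) \<le> C2_norm D f" using le s1 s2 by linarith
  show "norm (dirderiv D b f x) \<le> C2_norm D f" if "b \<in> Basis"
  proof -
    have "norm (dirderiv D b f x) \<le> (\<Sum>b\<in>Basis. norm (dirderiv D b f x))"
      using that by (intro member_le_sum) auto
    then show ?thesis using le s2 norm_ge_zero[of "f x"] by linarith
  qed
  show "norm (dirderiv D a (dirderiv D b f) x) \<le> C2_norm D f" if "a \<in> Basis" "b \<in> Basis"
  proof -
    have "norm (dirderiv D a (dirderiv D b f) x) \<le> (\<Sum>c\<in>Basis. norm (dirderiv D c (dirderiv D b f) x))"
      using that by (intro member_le_sum) auto
    also have "\<dots> \<le> (\<Sum>b\<in>Basis. \<Sum>c\<in>Basis. norm (dirderiv D c (dirderiv D b f) x))"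
      using that by (intro member_le_sum[of b _ "\<lambda>b. \<Sum>c\<in>Basis. norm (dirderiv D c (dirderiv D b f) x)"]) (auto intro: sum_nonneg)
    finally show ?thesis using le s1 norm_ge_zero[of "f x"] by linarith
  qed
qed

text \<open>Second-order expansion at a fixed point of space. The limit ignores
  \<open>t = 0\<close>, so the value of \<open>f\<close> there is unconstrained.\<close>

definition ex2 :: "(real \<Rightarrow> 'a::real_normed_vector) \<Rightarrow> 'a \<Rightarrow> 'a \<Rightarrow> 'a \<Rightarrow> bool" where
  "ex2 f a0 a1 a2 \<longleftrightarrow> ((\<lambda>t. (1 / t\<^sup>2) *\<^sub>R (f t - (a0 + t *\<^sub>R a1 + t\<^sup>2 *\<^sub>R a2))) \<longlongrightarrow> 0) (at 0)"

text \<open>The norm of the remainder bounds its values and derivatives up to second order at each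
  point. From here on the function spaces are left behind and everything is calculus in
  \<open>t\<close> at fixed \<open>x\<close>.\<close>

lemma ex2_expansion:
  fixes D :: "(real^('n::{finite,numeral})) set" and \<gamma> :: "real \<Rightarrow> (real, 'n) vec \<Rightarrow> 'b::real_normed_vector"
  assumes D: "periodic_domain l1 l2 D" and x: "x \<in> D"
    and ev: "\<forall>\<^sub>F t in at 0. C2_on D (\<gamma> t) \<and> periodic_on l1 l2 D (\<gamma> t)"
    and f: "C2_on D f0" "periodic_on l1 l2 D f0" "C2_on D f1" "periodic_on l1 l2 D f1" "C2_on D f2" "periodic_on l1 l2 D f2"
    and ex: "expands2 (C2_norm D) \<gamma> f0 f1 f2"
  shows "ex2 (\<lambda>t. \<gamma> t x) (f0 x) (f1 x) (f2 x)"
    "b \<in> Basis \<Longrightarrow> ex2 (\<lambda>t. dirderiv D b (\<gamma> t) x) (dirderiv D b f0 x) (dirderiv D b f1 x) (dirderiv D b f2 x)"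
    "a \<in> Basis \<Longrightarrow> b \<in> Basis \<Longrightarrow> ex2 (\<lambda>t. dirderiv D a (dirderiv D b (\<gamma> t)) x)
      (dirderiv D a (dirderiv D b f0) x) (dirderiv D a (dirderiv D b f1) x) (dirderiv D a (dirderiv D b f2) x)"
proof -
  have th: "thick D" using D by (simp add: periodic_domain_def)
  define R where "R t x = \<gamma> t x - (f0 x + t *\<^sub>R f1 x + t\<^sup>2 *\<^sub>R f2 x)" for t x
  have lim: "((\<lambda>t. C2_norm D (R t) / t\<^sup>2) \<longlongrightarrow> 0) (at 0)"
    using smalloD_tendsto[OF ex[unfolded expands2_def]] unfolding R_def[abs_def] .
  let ?A = "\<lambda>t x. \<gamma> t x + (-1) *\<^sub>R f0 x" let ?B = "\<lambda>t x. ?A t x + (-t) *\<^sub>R f1 x" let ?C = "\<lambda>t x. ?B t x + (-(t\<^sup>2)) *\<^sub>R f2 x"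
  have RC: "R t = ?C t" for t unfolding R_def by (intro ext) simp
  have key: "C2_on D (R t) \<and> periodic_on l1 l2 D (R t) \<and>
      (\<forall>b. dirderiv D b (R t) x = dirderiv D b (\<gamma> t) x - (dirderiv D b f0 x + t *\<^sub>R dirderiv D b f1 x + t\<^sup>2 *\<^sub>R dirderiv D b f2 x)) \<and>
      (\<forall>a. \<forall>b\<in>Basis. dirderiv D a (dirderiv D b (R t)) x = dirderiv D a (dirderiv D b (\<gamma> t)) x - (dirderiv D a (dirderiv D b f0) x
         + t *\<^sub>R dirderiv D a (dirderiv D b f1) x + t\<^sup>2 *\<^sub>R dirderiv D a (dirderiv D b f2) x))"
    if g: "C2_on D (\<gamma> t) \<and> periodic_on l1 l2 D (\<gamma> t)" for t
  proof -
    have A: "C2_on D (?A t)" by (rule C2_on_linear(1)[OF th conjunct1[OF g] f(1)])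
    have B: "C2_on D (?B t)" by (rule C2_on_linear(1)[OF th A f(3)])
    have C: "C2_on D (?C t)" by (rule C2_on_linear(1)[OF th B f(5)])
    have P: "periodic_on l1 l2 D (R t)" using g f unfolding R_def periodic_on_def by simp
    show ?thesis
    proof (intro conjI allI ballI)
      show "C2_on D (R t)" "periodic_on l1 l2 D (R t)" using C P unfolding RC by auto
      show "dirderiv D b (R t) x = dirderiv D b (\<gamma> t) x - (dirderiv D b f0 x + t *\<^sub>R dirderiv D b f1 x + t\<^sup>2 *\<^sub>R dirderiv D b f2 x)" for b
        unfolding RC C2_on_linear(2)[OF th B f(5) x] C2_on_linear(2)[OF th A f(3) x] C2_on_linear(2)[OF th conjunct1[OF g] f(1) x]
        by simp
      show "dirderiv D a (dirderiv D b (R t)) x = dirderiv D a (dirderiv D b (\<gamma> t)) x - (dirderiv D a (dirderiv D b f0) x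
         + t *\<^sub>R dirderiv D a (dirderiv D b f1) x + t\<^sup>2 *\<^sub>R dirderiv D a (dirderiv D b f2) x)" if "b \<in> Basis" for a b
        unfolding RC C2_on_linear(3)[OF th B f(5) x that] C2_on_linear(3)[OF th A f(3) x that] C2_on_linear(3)[OF th conjunct1[OF g] f(1) x that]
        by simp
    qed
  qed
  have main: "ex2 F A0 A1 A2" if "\<And>t. C2_on D (\<gamma> t) \<and> periodic_on l1 l2 D (\<gamma> t) \<Longrightarrow>
      norm (F t - (A0 + t *\<^sub>R A1 + t\<^sup>2 *\<^sub>R A2)) \<le> C2_norm D (R t)" for F :: "real \<Rightarrow> 'b" and A0 A1 A2
    unfolding ex2_def
  proof (rule Lim_null_comparison[OF _ lim])
    show "\<forall>\<^sub>F t in at 0. norm ((1 / t\<^sup>2) *\<^sub>R (F t - (A0 + t *\<^sub>R A1 + t\<^sup>2 *\<^sub>R A2))) \<le> C2_norm D (R t) / t\<^sup>2"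
      using ev
    proof eventually_elim
      case (elim t)
      show ?case using divide_right_mono[OF that[OF elim], of "t\<^sup>2"] by simp
    qed
  qed
  note bnd = C2_norm_bounds[OF D conjunct1[OF conjunct2[OF key]] conjunct1[OF key] x]
  show "ex2 (\<lambda>t. \<gamma> t x) (f0 x) (f1 x) (f2 x)"
    by (rule main) (use bnd(1) in \<open>simp add: R_def\<close>)
  show "ex2 (\<lambda>t. dirderiv D b (\<gamma> t) x) (dirderiv D b f0 x) (dirderiv D b f1 x) (dirderiv D b f2 x)" if "b \<in> Basis"
    by (rule main) (use bnd(2) that key in metis)
  show "ex2 (\<lambda>t. dirderiv D a (dirderiv D b (\<gamma> t)) x)
      (dirderiv D a (dirderiv D b f0) x) (dirderiv D a (dirderiv D b f1) x) (dirderiv D a (dirderiv D b f2) x)" if "a \<in> Basis" "b \<in> Basis"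
    by (rule main) (use bnd(3) that key in metis)
qed

lemma ex2_nth: "ex2 f a0 a1 a2 \<Longrightarrow> ex2 (\<lambda>t. f t $ i) (a0 $ i) (a1 $ i) (a2 $ i)"
  unfolding ex2_def using tendsto_vec_nth[of _ 0 "at 0" i] by fastforce

lemma ex2_const: "ex2 (\<lambda>_. k) k 0 0"
  unfolding ex2_def by simp

lemma ex2_add: "ex2 f a0 a1 a2 \<Longrightarrow> ex2 g b0 b1 b2 \<Longrightarrow> ex2 (\<lambda>t. f t + g t) (a0 + b0) (a1 + b1) (a2 + b2)"
  unfolding ex2_def by (drule (1) tendsto_add) (simp add: algebra_simps)

lemma ex2_diff: "ex2 f a0 a1 a2 \<Longrightarrow> ex2 g b0 b1 b2 \<Longrightarrow> ex2 (\<lambda>t. f t - g t) (a0 - b0) (a1 - b1) (a2 - b2)"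
  unfolding ex2_def by (drule (1) tendsto_diff) (simp add: algebra_simps)

lemma ex2_tendsto:
  assumes "ex2 f a0 a1 a2" shows "(f \<longlongrightarrow> a0) (at 0)"
proof -
  have lim: "((\<lambda>t. t\<^sup>2 *\<^sub>R ((1 / t\<^sup>2) *\<^sub>R (f t - (a0 + t *\<^sub>R a1 + t\<^sup>2 *\<^sub>R a2))) + (a0 + t *\<^sub>R a1 + t\<^sup>2 *\<^sub>R a2)) \<longlongrightarrow>
      0\<^sup>2 *\<^sub>R 0 + (a0 + 0 *\<^sub>R a1 + 0\<^sup>2 *\<^sub>R a2)) (at 0)"
    by (intro tendsto_intros assms[unfolded ex2_def])
  have "(f \<longlongrightarrow> 0\<^sup>2 *\<^sub>R 0 + (a0 + 0 *\<^sub>R a1 + 0\<^sup>2 *\<^sub>R a2)) (at 0)"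
    by (rule Lim_transform_eventually[OF lim]) (auto simp: eventually_at_filter)
  then show ?thesis by simp
qed

lemma ex2_mult:
  fixes f g :: "real \<Rightarrow> real"
  assumes f: "ex2 f a0 a1 a2" and g: "ex2 g b0 b1 b2"
  shows "ex2 (\<lambda>t. f t * g t) (a0 * b0) (a0 * b1 + a1 * b0) (a0 * b2 + a1 * b1 + a2 * b0)"
proof -
  let ?F = "\<lambda>t. (1 / t\<^sup>2) *\<^sub>R (f t - (a0 + t *\<^sub>R a1 + t\<^sup>2 *\<^sub>R a2))"
  let ?G = "\<lambda>t. (1 / t\<^sup>2) *\<^sub>R (g t - (b0 + t *\<^sub>R b1 + t\<^sup>2 *\<^sub>R b2))"
  have lim: "((\<lambda>t. ?F t * g t + (a0 + t * a1 + t\<^sup>2 * a2) * ?G t + t * (a1 * b2 + a2 * b1) + t\<^sup>2 * (a2 * b2)) \<longlongrightarrow>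
     0 * b0 + (a0 + 0 * a1 + 0\<^sup>2 * a2) * 0 + 0 * (a1 * b2 + a2 * b1) + 0\<^sup>2 * (a2 * b2)) (at 0)"
    by (intro tendsto_intros ex2_tendsto[OF g] f[unfolded ex2_def] g[unfolded ex2_def])
  have eq: "?F t * g t + (a0 + t * a1 + t\<^sup>2 * a2) * ?G t + t * (a1 * b2 + a2 * b1) + t\<^sup>2 * (a2 * b2)
     = (1 / t\<^sup>2) *\<^sub>R (f t * g t - (a0 * b0 + t *\<^sub>R (a0 * b1 + a1 * b0) + t\<^sup>2 *\<^sub>R (a0 * b2 + a1 * b1 + a2 * b0)))"
    if "t \<noteq> 0" for t
    using that by (simp add: field_simps power2_eq_square)
  have "((\<lambda>t. (1 / t\<^sup>2) *\<^sub>R (f t * g t - (a0 * b0 + t *\<^sub>R (a0 * b1 + a1 * b0) + t\<^sup>2 *\<^sub>R (a0 * b2 + a1 * b1 + a2 * b0)))) \<longlongrightarrow>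
     0 * b0 + (a0 + 0 * a1 + 0\<^sup>2 * a2) * 0 + 0 * (a1 * b2 + a2 * b1) + 0\<^sup>2 * (a2 * b2)) (at 0)"
    by (rule Lim_transform_eventually[OF lim]) (use eq in \<open>auto simp: eventually_at_filter\<close>)
  then show ?thesis unfolding ex2_def by simp
qed

text \<open>Uniqueness of the coefficients: each is a limit once the lower ones are removed and a
  power of \<open>t\<close> is divided out. An identity along the curve thus yields one equation per
  order.\<close>

lemma ex2_zero:
  fixes f :: "real \<Rightarrow> real"
  assumes f: "ex2 f a0 a1 a2" and z: "\<forall>\<^sub>F t in at 0. f t = 0"
  shows "a0 = 0" "a1 = 0" "a2 = 0"
proof -
  have lim: "((\<lambda>t. (1 / t\<^sup>2) * (a0 + t * a1 + t\<^sup>2 * a2)) \<longlongrightarrow> 0) (at 0)"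
  proof (rule Lim_transform_eventually)
    show "((\<lambda>t. - ((1 / t\<^sup>2) *\<^sub>R (f t - (a0 + t *\<^sub>R a1 + t\<^sup>2 *\<^sub>R a2)))) \<longlongrightarrow> 0) (at 0)"
      using tendsto_minus[OF f[unfolded ex2_def]] by simp
    show "\<forall>\<^sub>F t in at 0. - ((1 / t\<^sup>2) *\<^sub>R (f t - (a0 + t *\<^sub>R a1 + t\<^sup>2 *\<^sub>R a2))) = (1 / t\<^sup>2) * (a0 + t * a1 + t\<^sup>2 * a2)"
      using z by eventually_elim (simp only: diff_0 scaleR_minus_right minus_minus real_scaleR_def)
  qed
  have nz: "\<forall>\<^sub>F t in at 0. t \<noteq> (0::real)" by (simp add: eventually_at_filter)
  have "((\<lambda>t. a0 + t * a1 + t\<^sup>2 * a2) \<longlongrightarrow> 0\<^sup>2 * 0) (at 0)"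
    by (rule Lim_transform_eventually[OF tendsto_mult[OF tendsto_power[OF tendsto_ident_at] lim]])
       (use nz in eventually_elim, simp)
  moreover have "((\<lambda>t. a0 + t * a1 + t\<^sup>2 * a2) \<longlongrightarrow> a0 + 0 * a1 + 0\<^sup>2 * a2) (at 0)" by (intro tendsto_intros)
  ultimately show a0: "a0 = 0" using LIM_unique by fastforce
  have "((\<lambda>t. a1 + t * a2) \<longlongrightarrow> 0 * 0) (at 0)"
    by (rule Lim_transform_eventually[OF tendsto_mult[OF tendsto_ident_at lim]])
       (use nz in eventually_elim, simp add: a0 field_simps power2_eq_square)
  moreover have "((\<lambda>t. a1 + t * a2) \<longlongrightarrow> a1 + 0 * a2) (at 0)" by (intro tendsto_intros)
  ultimately show a1: "a1 = 0" using LIM_unique by fastforce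
  have "((\<lambda>t. a2) \<longlongrightarrow> 0) (at (0::real))"
    by (rule Lim_transform_eventually[OF lim]) (use nz in eventually_elim, simp add: a0 a1)
  then show "a2 = 0" by (simp add: tendsto_const_iff)
qed

text \<open>Meant for the dynamic condition, which enters at first order; there the derivative rules
  cope directly with the root and the quotient in the curvature.\<close>

lemma ex2_derivative:
  fixes f :: "real \<Rightarrow> real"
  assumes f: "ex2 f a0 a1 a2" and "f 0 = a0"
  shows "(f has_real_derivative a1) (at 0)"
proof -
  have lim: "((\<lambda>t. t * ((1 / t\<^sup>2) *\<^sub>R (f t - (a0 + t *\<^sub>R a1 + t\<^sup>2 *\<^sub>R a2))) + a1 + t * a2) \<longlongrightarrow> 0 * 0 + a1 + 0 * a2) (at 0)"
    by (intro tendsto_intros f[unfolded ex2_def])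
  have "((\<lambda>t. (f t - f 0) / t) \<longlongrightarrow> 0 * 0 + a1 + 0 * a2) (at 0)"
    by (rule Lim_transform_eventually[OF lim]) (auto simp: eventually_at_filter assms(2) field_simps power2_eq_square)
  then show ?thesis by (simp add: has_field_derivative_iff)
qed

lemma shift_into_period:
  fixes s l :: real
  assumes "l > 0" shows "\<exists>k::int. \<bar>s + l * of_int k\<bar> \<le> l"
proof -
  have "\<bar>s + l * of_int (- round (s/l))\<bar> = l * \<bar>of_int (round (s/l)) - s/l\<bar>"
    using assms by (simp add: abs_mult_pos'[symmetric] abs_minus_commute field_simps)
  also have "\<dots> \<le> l * (1/2)" using assms of_int_round_abs_le by (intro mult_left_mono) auto
  also have "\<dots> \<le> l" using assms by simp
  finally show ?thesis by blast
qed

section \<open>The plane and the slab as periodic domains\<close>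

lemma thick_UNIV: "thick UNIV"
  unfolding thick_def
proof (intro ballI allI impI)
  fix e :: real assume "e > 0"
  then show "\<exists>t. 0 < \<bar>t\<bar> \<and> \<bar>t\<bar> < e \<and> x + t *\<^sub>R i \<in> UNIV" for x i :: 'a by (intro exI[of _ "e/2"]) auto
qed

lemma thick_interval: "d > 0 \<Longrightarrow> thick {-d..0::real}"
  unfolding thick_def
proof (intro ballI allI impI)
  fix x i e :: real assume d: "d > 0" and x: "x \<in> {-d..0}" and i: "i \<in> Basis" and e: "e > 0"
  show "\<exists>t. 0 < \<bar>t\<bar> \<and> \<bar>t\<bar> < e \<and> x + t *\<^sub>R i \<in> {-d..0}"
  proof (cases "x < 0")
    case True
    then show ?thesis using x e i by (intro exI[of _ "min (e/2) (-x)"]) auto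
  next
    case False
    then show ?thesis using x e i d by (intro exI[of _ "- min (e/2) d"]) auto
  qed
qed

lemma thick_slab: assumes d: "d > 0" shows "thick (Omega_closed d)"
  unfolding thick_def
proof (intro ballI allI impI)
  fix x i :: "real^3" and e :: real assume x: "x \<in> Omega_closed d" and i: "i \<in> Basis" and e: "e > 0"
  obtain j where j: "i = axis j 1" using i by (auto simp: Basis_vec_def)
  have x3: "x $ 3 \<in> {-d..0}" using x by (simp add: Omega_closed_def)
  obtain t where t: "0 < \<bar>t\<bar>" "\<bar>t\<bar> < e" "x $ 3 + t \<in> {-d..0}"
    using thick_interval[OF d] x3 e unfolding thick_def by force
  have "x + t *\<^sub>R i \<in> Omega_closed d"
    using t(3) x3 unfolding j Omega_closed_def by (cases "j = 3") (auto simp: axis_def)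
  then show "\<exists>t. 0 < \<bar>t\<bar> \<and> \<bar>t\<bar> < e \<and> x + t *\<^sub>R i \<in> Omega_closed d" using t by blast
qed

lemma periodic_domain_plane:
  assumes l: "l1 > 0" "l2 > 0" shows "periodic_domain l1 l2 (UNIV :: (real^2) set)"
  unfolding periodic_domain_def
proof (intro conjI thick_UNIV exI[of _ "cbox (vector [-l1, -l2]) (vector [l1, l2])"] ballI)
  fix x :: "real^2"
  obtain k m :: int where "\<bar>x $ 1 + l1 * of_int k\<bar> \<le> l1" "\<bar>x $ 2 + l2 * of_int m\<bar> \<le> l2"
    using shift_into_period l by metis
  then show "\<exists>(k::int) (m::int). x + axis 1 (l1 * of_int k) + axis 2 (l2 * of_int m) \<in> cbox (vector [-l1, -l2]) (vector [l1, l2])"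
    by (intro exI[of _ k] exI[of _ m]) (auto simp: mem_box_cart forall_2 axis_def abs_le_iff)
qed auto

lemma periodic_domain_slab:
  assumes d: "d > 0" and l: "l1 > 0" "l2 > 0" shows "periodic_domain l1 l2 (Omega_closed d)"
  unfolding periodic_domain_def
proof (intro conjI thick_slab d exI[of _ "cbox (vector [-l1, -l2, -d]) (vector [l1, l2, 0])"] ballI)
  fix x :: "real^3" assume x: "x \<in> Omega_closed d"
  obtain k m :: int where "\<bar>x $ 1 + l1 * of_int k\<bar> \<le> l1" "\<bar>x $ 2 + l2 * of_int m\<bar> \<le> l2"
    using shift_into_period l by metis
  then show "\<exists>(k::int) (m::int). x + axis 1 (l1 * of_int k) + axis 2 (l2 * of_int m) \<in> cbox (vector [-l1, -l2, -d]) (vector [l1, l2, 0])"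
    using x by (intro exI[of _ k] exI[of _ m]) (auto simp: mem_box_cart forall_3 axis_def abs_le_iff Omega_closed_def)
  show "\<forall>(k::int) (m::int). x + axis 1 (l1 * of_int k) + axis 2 (l2 * of_int m) \<in> Omega_closed d"
    using x by (simp add: Omega_closed_def axis_def)
qed (auto simp: mem_box_cart forall_3 Omega_closed_def)

section \<open>Expansion of the flattened equations\<close>

lemma horiz_nth [simp]: "horiz x $ 1 = x $ 1" "horiz x $ 2 = x $ 2"
  by (simp_all add: horiz_def)

lemma horiz_eq: "horiz x = (x $ 1) *\<^sub>R axis 1 1 + (x $ 2) *\<^sub>R axis 2 1"
  by (simp add: vec_eq_iff forall_2 axis_def)

lemma has_derivative_horiz: "(horiz has_derivative (\<lambda>h. horiz h)) F"
  unfolding horiz_eq[abs_def] by (intro derivative_intros has_derivative_nth)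

lemma vec3_eq: "x = (x $ 1) *\<^sub>R axis 1 1 + (x $ 2) *\<^sub>R axis 2 1 + (x $ 3) *\<^sub>R axis 3 1" for x :: "real^3"
  by (simp add: vec_eq_iff forall_3 axis_def)

lemma Omega_interior: "x \<in> Omega d \<Longrightarrow> at x within Omega_closed d = at x" "x \<in> Omega d \<Longrightarrow> at x within Omega d = at x"
  "x \<in> Omega d \<Longrightarrow> x \<in> Omega_closed d"
proof -
  have "Omega d = {x. -d < x $ 3} \<inter> {x. x $ 3 < 0}" by (auto simp: Omega_def)
  then have o: "open (Omega d)"
    by (auto intro!: open_Collect_less continuous_intros)
  assume x: "x \<in> Omega d"
  have "x \<in> interior (Omega_closed d)" using o x by (auto intro!: interiorI[of "Omega d"] simp: Omega_def Omega_closed_def)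
  then show "at x within Omega_closed d = at x" by (rule at_within_interior)
  show "at x within Omega d = at x" using o x by (rule at_within_open[rotated])
  show "x \<in> Omega_closed d" using x by (simp add: Omega_def Omega_closed_def)
qed

text \<open>The equations are posed with derivatives within the open slab, the function spaces with
  derivatives within the closed one; at interior points both are ordinary derivatives.\<close>

lemma dirderiv_interior: "x \<in> Omega d \<Longrightarrow> dirderiv (Omega d) b f x = dirderiv (Omega_closed d) b f x"
  by (simp add: dirderiv_def Omega_interior)

lemma dirderiv_linear_combination3:
  fixes b :: "real^3"
  assumes "f differentiable_on D" "x \<in> D"
  shows "dirderiv D b f x = (b $ 1) *\<^sub>R pd D 1 f x + (b $ 2) *\<^sub>R pd D 2 f x + (b $ 3) *\<^sub>R pd D 3 f x"
proof -
  have l: "linear (\<lambda>b. dirderiv D b f x)" using has_dirderiv[OF assms] by (rule has_derivative_linear)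
  show ?thesis
    by (subst vec3_eq[of b]) (simp only: linear_add[OF l] linear_scale[OF l])
qed

lemma dirderiv_linear_combination2:
  fixes b :: "real^2"
  assumes "f differentiable_on D" "x \<in> D"
  shows "dirderiv D b f x = (b $ 1) *\<^sub>R pd D 1 f x + (b $ 2) *\<^sub>R pd D 2 f x"
proof -
  have l: "linear (\<lambda>b. dirderiv D b f x)" using has_dirderiv[OF assms] by (rule has_derivative_linear)
  have b: "b = (b $ 1) *\<^sub>R axis 1 1 + (b $ 2) *\<^sub>R axis 2 1" by (simp add: vec_eq_iff forall_2 axis_def)
  show ?thesis by (subst b) (simp only: linear_add[OF l] linear_scale[OF l])
qed

lemma has_derivative_lift:
  fixes f :: "real^2 \<Rightarrow> real"
  assumes "f differentiable_on UNIV"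
  shows "((\<lambda>x. f (horiz x)) has_derivative (\<lambda>h. h $ 1 * pd UNIV 1 f (horiz x) + h $ 2 * pd UNIV 2 f (horiz x))) (at x within A)"
proof -
  have "(f has_derivative (\<lambda>b. dirderiv UNIV b f (horiz x))) (at (horiz x))"
    using has_dirderiv[OF assms, of "horiz x"] by simp
  then have "((\<lambda>x. f (horiz x)) has_derivative (\<lambda>h. dirderiv UNIV (horiz h) f (horiz x))) (at x within A)"
    by (rule has_derivative_compose[OF has_derivative_horiz])
  moreover have "dirderiv UNIV (horiz h) f (horiz x) = h $ 1 * pd UNIV 1 f (horiz x) + h $ 2 * pd UNIV 2 f (horiz x)" for h
    using dirderiv_linear_combination2[OF assms, of "horiz x" "horiz h"] by simp
  ultimately show ?thesis by simp
qed

lemma axis_in_Basis [simp]: "axis i (1::real) \<in> Basis"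
  by (simp add: axis_in_Basis_iff)

lemma C2_on_pd:
  fixes D :: "(real^'n) set"
  assumes "C2_on D f"
  shows "f differentiable_on D" "pd D i f differentiable_on D" "continuous_on D (pd D j (pd D i f))"
  using assms by (auto simp: C2_on_def)

lemma has_derivative_height:
  "((\<lambda>y::real^3. 1 + y $ 3 / d) has_derivative (\<lambda>h. h $ 3 / d)) F"
  using has_derivative_add[OF has_derivative_const[of 1] has_derivative_mult_right[OF has_derivative_nth, of "1/d" 3]]
  by simp

lemma pd_phi:
  fixes \<eta> :: "real^2 \<Rightarrow> real" and j :: 3 and i :: 2
  assumes \<eta>: "\<eta> differentiable_on UNIV" and ji: "j = 1 \<and> i = 1 \<or> j = 2 \<and> i = 2"
  shows "pd UNIV j (phi d \<eta>) y = (1 + y $ 3 / d) * pd UNIV i \<eta> (horiz y)"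
proof -
  have "((\<lambda>y. (1 + y $ 3 / d) * \<eta> (horiz y)) has_derivative (\<lambda>h. (1 + y $ 3 / d) * (h $ 1 * pd UNIV 1 \<eta> (horiz y) + h $ 2 * pd UNIV 2 \<eta> (horiz y))
      + (h $ 3 / d) * \<eta> (horiz y))) (at y)"
    by (rule has_derivative_mult[OF has_derivative_height has_derivative_lift[OF \<eta>]])
  then have "pd UNIV j (phi d \<eta>) y = (\<lambda>h. (1 + y $ 3 / d) * (h $ 1 * pd UNIV 1 \<eta> (horiz y) + h $ 2 * pd UNIV 2 \<eta> (horiz y))
      + (h $ 3 / d) * \<eta> (horiz y)) (axis j 1)"
    by (intro dirderiv_eq[OF thick_UNIV]) (simp_all add: phi_def[abs_def])
  then show ?thesis using ji by (auto simp: axis_def)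
qed

lemma flattening_matrix_mult:
  fixes f1 f2 r :: real and A :: "real^3"
  defines "M \<equiv> (1 / r) *\<^sub>R (vector [vector [1, 0, 0], vector [0, 1, 0], vector [f1, f2, r]] :: real^3^3)"
  assumes r: "r \<noteq> 0"
  shows "M *v A = (A $ 1 / r) *\<^sub>R axis 1 1 + (A $ 2 / r) *\<^sub>R axis 2 1 + ((f1 * A $ 1 + f2 * A $ 2) / r + A $ 3) *\<^sub>R axis 3 1"
    "(transpose M *v A) $ 1 = (A $ 1 + f1 * A $ 3) / r" "(transpose M *v A) $ 2 = (A $ 2 + f2 * A $ 3) / r"
    "(transpose M *v A) $ 3 = A $ 3"
proof -
  have M: "M $ i $ j = (vector [vector [1, 0, 0], vector [0, 1, 0], vector [f1, f2, r]] :: real^3^3) $ i $ j / r" for i j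
    by (simp add: M_def)
  show "M *v A = (A $ 1 / r) *\<^sub>R axis 1 1 + (A $ 2 / r) *\<^sub>R axis 2 1 + ((f1 * A $ 1 + f2 * A $ 2) / r + A $ 3) *\<^sub>R axis 3 1"
    using r by (simp add: vec_eq_iff forall_3 matrix_vector_mult_def sum_3 M axis_def add_divide_distrib)
  show "(transpose M *v A) $ 1 = (A $ 1 + f1 * A $ 3) / r" "(transpose M *v A) $ 2 = (A $ 2 + f2 * A $ 3) / r"
    "(transpose M *v A) $ 3 = A $ 3"
    using r by (simp_all add: matrix_vector_mult_def transpose_def sum_3 M add_divide_distrib)
qed

text \<open>The momentum equations are multiplied by powers of \<open>R = \<rho>\<close> to make them polynomial in the derivatives of the unknowns.\<close>

lemma flattened_interior_equations:
  fixes u :: "real^3 \<Rightarrow> real^3" and p :: "real^3 \<Rightarrow> real" and \<eta> :: "real^2 \<Rightarrow> real"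
  assumes d: "d > 0" and sol: "flattened_solution d g \<sigma> u p \<eta>"
    and u: "C2_on (Omega_closed d) u" and \<eta>: "C2_on UNIV \<eta>" and x: "x \<in> Omega d"
  defines "V \<equiv> \<lambda>i. u x $ i" and "du \<equiv> \<lambda>j i. pd (Omega_closed d) j u x $ i" and "dp \<equiv> \<lambda>j. pd (Omega_closed d) j p x"
    and "e \<equiv> \<lambda>i. pd UNIV i \<eta> (horiz x)" and "ee \<equiv> \<lambda>j i. pd UNIV j (pd UNIV i \<eta>) (horiz x)"
    and "R \<equiv> 1 + (1/d) * \<eta> (horiz x)" and "W \<equiv> 1 + x $ 3 / d"
  defines "S \<equiv> \<lambda>i. V 1 * du 1 i + V 2 * du 2 i + V 3 * du 3 i"
    and "T \<equiv> (1/d) * (V 1 * e 1 + V 2 * e 2)"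
  shows "R * S 1 - T * V 1 - R * R * (W * e 1 * dp 3) + R * R * R * dp 1 = 0"
    "R * S 2 - T * V 2 - R * R * (W * e 2 * dp 3) + R * R * R * dp 2 = 0"
    "R * (((1/d) * V 3 * e 1 + W * (ee 1 1 * V 1 + ee 2 1 * V 2)) * V 1 + W * e 1 * S 1
        + ((1/d) * V 3 * e 2 + W * (ee 1 2 * V 1 + ee 2 2 * V 2)) * V 2 + W * e 2 * S 2)
      - T * (W * (e 1 * V 1 + e 2 * V 2)) + R * R * S 3 + R * R * dp 3 = 0"
    "du 1 1 + du 2 2 + du 3 3 = 0"
proof -
  let ?D = "Omega_closed d"
  note du_u = C2_on_pd(1)[OF u] and d\<eta> = C2_on_pd(1)[OF \<eta>] and d\<eta>2 = C2_on_pd(2)[OF \<eta>]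
  have xD: "x \<in> ?D" using Omega_interior(3)[OF x] .
  have at: "at x within ?D = at x" "at x within Omega d = at x" using Omega_interior x by auto
  have hu: "(u has_derivative (\<lambda>b. dirderiv ?D b u x)) (at x)"
    using has_dirderiv[OF du_u xD] unfolding at .
  have hui: "((\<lambda>y. u y $ i) has_derivative (\<lambda>b. dirderiv ?D b u x $ i)) (at x)" for i
    using has_derivative_compose[OF hu has_derivative_nth] .
  have Su: "dirderiv ?D (u x) u x $ i = S i" for i
    using dirderiv_linear_combination3[OF du_u xD, of "u x"] unfolding S_def V_def du_def by simp
  let ?r = "\<lambda>y. 1 + (1/d) * \<eta> (horiz y)"
  have R: "R > 0"
  proof -
    have "\<eta> (horiz x) > -d" using sol unfolding flattened_solution_def by blast
    then show ?thesis using d by (simp add: R_def field_simps)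
  qed
  have rho: "rho d \<eta> y = ?r y" for y by (simp add: rho_def)
  have rpos: "?r y \<noteq> 0" for y
  proof -
    have "\<eta> (horiz y) > -d" using sol unfolding flattened_solution_def by blast
    then show ?thesis using d by (simp add: field_simps)
  qed
  let ?f1 = "\<lambda>y. (1 + y $ 3 / d) * pd UNIV 1 \<eta> (horiz y)" and ?f2 = "\<lambda>y. (1 + y $ 3 / d) * pd UNIV 2 \<eta> (horiz y)"
  have p1: "pd UNIV 1 (phi d \<eta>) y = ?f1 y" and p2: "pd UNIV 2 (phi d \<eta>) y = ?f2 y" for y
    by (rule pd_phi[OF d\<eta>]; simp)+
  let ?F = "\<lambda>y. ?f1 y * u y $ 1 + ?f2 y * u y $ 2"
  let ?w = "\<lambda>y. (u y $ 1 / ?r y) *\<^sub>R (axis 1 1 :: real^3) + (u y $ 2 / ?r y) *\<^sub>R axis 2 1 + (?F y / ?r y + u y $ 3) *\<^sub>R axis 3 1"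
  have w: "Mmat d \<eta> y *v u y = ?w y" for y
    unfolding Mmat_def rho p1 p2 by (rule flattening_matrix_mult(1)[OF rpos])
  let ?r' = "\<lambda>h. (1/d) * (h $ 1 * e 1 + h $ 2 * e 2)"
  have hr: "(?r has_derivative ?r') (at x)"
    using has_derivative_add[OF has_derivative_const[of 1] has_derivative_mult_right[OF has_derivative_lift[OF d\<eta>], of "1/d"]]
    by (simp add: e_def)
  let ?g = "\<lambda>i h. (h $ 3 / d) * e i + W * (h $ 1 * ee 1 i + h $ 2 * ee 2 i)"
  have hf: "((\<lambda>y. (1 + y $ 3 / d) * pd UNIV i \<eta> (horiz y)) has_derivative ?g i) (at x)" for i
    by (rule has_derivative_eq_rhs[OF has_derivative_mult[OF has_derivative_height has_derivative_lift[OF d\<eta>2]]])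
      (simp add: e_def ee_def W_def fun_eq_iff)
  let ?F' = "\<lambda>h. (W * e 1) * dirderiv ?D h u x $ 1 + ?g 1 h * V 1 + ((W * e 2) * dirderiv ?D h u x $ 2 + ?g 2 h * V 2)"
  have hF: "(?F has_derivative ?F') (at x)"
    by (rule has_derivative_eq_rhs[OF has_derivative_add[OF has_derivative_mult[OF hf hui] has_derivative_mult[OF hf hui]]])
      (simp add: e_def W_def V_def fun_eq_iff)
  have quot: "((\<lambda>y. f y / ?r y) has_derivative (\<lambda>h. (f' h * R - f x * ?r' h) / (R * R))) (at x)"
    if "(f has_derivative f') (at x)" for f f'
    using has_derivative_divide'[OF that hr rpos] unfolding R_def .
  let ?w' = "\<lambda>h. ((dirderiv ?D h u x $ 1 * R - u x $ 1 * ?r' h) / (R * R)) *\<^sub>R (axis 1 1 :: real^3)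
     + ((dirderiv ?D h u x $ 2 * R - u x $ 2 * ?r' h) / (R * R)) *\<^sub>R axis 2 1
     + ((?F' h * R - ?F x * ?r' h) / (R * R) + dirderiv ?D h u x $ 3) *\<^sub>R axis 3 1"
  have hw: "((\<lambda>y. Mmat d \<eta> y *v u y) has_derivative ?w') (at x)"
    unfolding w by (intro has_derivative_add has_derivative_scaleR_left quot hui hF)
  have thick: "thick ?D" by (rule thick_slab[OF d])
  have dw: "pd (Omega d) j (\<lambda>y. Mmat d \<eta> y *v u y) x = ?w' (axis j 1)" for j
    unfolding dirderiv_interior[OF x] by (rule dirderiv_eq[OF thick xD]) (use hw at in simp)
  define A where "A = advect (Omega d) u (\<lambda>y. Mmat d \<eta> y *v u y) x"
  \<comment> \<open>The advection sum is the derivative in the direction \<open>u x\<close>, by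
    linearity.\<close>
  have Aeq: "A = ?w' (u x)"
  proof -
    have l: "linear ?w'" using hw by (rule has_derivative_linear)
    have "A = (u x $ 1) *\<^sub>R ?w' (axis 1 1) + (u x $ 2) *\<^sub>R ?w' (axis 2 1) + (u x $ 3) *\<^sub>R ?w' (axis 3 1)"
      unfolding A_def advect_def dw sum_3 ..
    also have "\<dots> = ?w' ((u x $ 1) *\<^sub>R axis 1 1 + (u x $ 2) *\<^sub>R axis 2 1 + (u x $ 3) *\<^sub>R axis 3 1)"
      unfolding linear_add[OF l] linear_scale[OF l] ..
    finally show ?thesis using vec3_eq[of "u x"] by simp
  qed
  have Teq: "?r' (u x) = T" by (simp add: T_def V_def)
  have comp: "(\<alpha> *\<^sub>R axis 1 1 + \<beta> *\<^sub>R axis 2 1 + \<gamma> *\<^sub>R axis 3 1 :: real^3) $ 1 = \<alpha>"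
    "(\<alpha> *\<^sub>R axis 1 1 + \<beta> *\<^sub>R axis 2 1 + \<gamma> *\<^sub>R axis 3 1 :: real^3) $ 2 = \<beta>"
    "(\<alpha> *\<^sub>R axis 1 1 + \<beta> *\<^sub>R axis 2 1 + \<gamma> *\<^sub>R axis 3 1 :: real^3) $ 3 = \<gamma>" for \<alpha> \<beta> \<gamma>
    by (simp_all add: axis_def)
  have A: "A $ 1 = (S 1 * R - V 1 * T) / (R * R)" "A $ 2 = (S 2 * R - V 2 * T) / (R * R)"
    "A $ 3 = (?F' (u x) * R - ?F x * T) / (R * R) + S 3"
    unfolding Aeq comp Teq Su V_def by (rule refl)+
  have mom: "transpose (Mmat d \<eta> x) *v A + grad (Omega d) p x = 0" and dv: "divergence (Omega d) u x = 0"
    using sol x unfolding flattened_solution_def A_def by auto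
  have g: "grad (Omega d) p x $ j = dp j" for j by (simp add: grad_def dp_def dirderiv_interior[OF x])
  have Rr: "rho d \<eta> x = R" by (simp add: rho R_def)
  have f1: "?f1 x = W * e 1" and f2: "?f2 x = W * e 2" by (simp_all add: W_def e_def)
  have mt: "(transpose (Mmat d \<eta> x) *v A) $ 1 = (A $ 1 + W * e 1 * A $ 3) / R"
    "(transpose (Mmat d \<eta> x) *v A) $ 2 = (A $ 2 + W * e 2 * A $ 3) / R"
    "(transpose (Mmat d \<eta> x) *v A) $ 3 = A $ 3"
    unfolding Mmat_def Rr p1 p2 f1 f2 by (rule flattening_matrix_mult, use R in simp)+
  have m1: "(A $ 1 + W * e 1 * A $ 3) / R + dp 1 = 0" and m2: "(A $ 2 + W * e 2 * A $ 3) / R + dp 2 = 0" and m3: "A $ 3 + dp 3 = 0"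
    using mom mt g by (simp_all add: vec_eq_iff forall_3)
  \<comment> \<open>The third row of the transposed matrix is a unit vector, so the vertical
    acceleration equals \<open>- dp 3\<close>. Inserted in the other two rows, it leaves expressions
    that powers of \<open>R\<close> turn into polynomials.\<close>
  have A3: "A $ 3 = - dp 3" using m3 by simp
  have k: "R * R * A $ 1 = R * S 1 - T * V 1" "R * R * A $ 2 = R * S 2 - T * V 2"
    unfolding A(1,2) using R by simp_all
  have "A $ 1 + W * e 1 * A $ 3 + R * dp 1 = ((A $ 1 + W * e 1 * A $ 3) / R + dp 1) * R" using R by (simp add: field_simps)
  then have "R * R * (A $ 1 + W * e 1 * A $ 3 + R * dp 1) = 0" unfolding m1 by simp
  then show "R * S 1 - T * V 1 - R * R * (W * e 1 * dp 3) + R * R * R * dp 1 = 0"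
    using k unfolding A3 by (simp add: algebra_simps)
  have "A $ 2 + W * e 2 * A $ 3 + R * dp 2 = ((A $ 2 + W * e 2 * A $ 3) / R + dp 2) * R" using R by (simp add: field_simps)
  then have "R * R * (A $ 2 + W * e 2 * A $ 3 + R * dp 2) = 0" unfolding m2 by simp
  then show "R * S 2 - T * V 2 - R * R * (W * e 2 * dp 3) + R * R * R * dp 2 = 0"
    using k unfolding A3 by (simp add: algebra_simps)
  have gen: "R * R * (a / (R * R) + s + t) = a + R * R * s + R * R * t" for a s t
    using R by (simp add: distrib_left)
  have "R * R * (A $ 3 + dp 3) = 0" unfolding m3 by simp
  then have eq3: "?F' (u x) * R - ?F x * T + R * R * S 3 + R * R * dp 3 = 0"
    unfolding A(3) gen .
  have Fx: "?F x = W * (e 1 * V 1 + e 2 * V 2)" unfolding f1 f2 V_def by (simp add: algebra_simps)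
  show "R * (((1/d) * V 3 * e 1 + W * (ee 1 1 * V 1 + ee 2 1 * V 2)) * V 1 + W * e 1 * S 1
        + ((1/d) * V 3 * e 2 + W * (ee 1 2 * V 1 + ee 2 2 * V 2)) * V 2 + W * e 2 * S 2)
      - T * (W * (e 1 * V 1 + e 2 * V 2)) + R * R * S 3 + R * R * dp 3 = 0"
    using eq3[unfolded Fx Su] by (simp add: V_def algebra_simps)
  have "pd (Omega d) i (\<lambda>y. u y $ i) x = du i i" for i
    unfolding dirderiv_interior[OF x] du_def
    by (rule dirderiv_eq[OF thick xD]) (use hui at in simp)
  then show "du 1 1 + du 2 2 + du 3 3 = 0" using dv by (simp add: divergence_def sum_3)
qed

text \<open>The first summand is the Laplacian over a root that equals 1 at zero slope, and the
  second is cubic in the derivatives of \<eta>; hence the linearization is the Laplacian.\<close>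

lemma curvature_expansion:
  fixes \<eta> :: "real^2 \<Rightarrow> real" and y :: "real^2"
  assumes \<eta>: "C2_on UNIV \<eta>"
  defines "e \<equiv> \<lambda>i. pd UNIV i \<eta> y" and "ee \<equiv> \<lambda>j i. pd UNIV j (pd UNIV i \<eta>) y"
  defines "q \<equiv> 1 + (e 1 * e 1 + e 2 * e 2)"
  shows "divergence UNIV (\<lambda>y. (1 / sqrt (1 + (norm (grad UNIV \<eta> y))\<^sup>2)) *\<^sub>R grad UNIV \<eta> y) y
    = (ee 1 1 + ee 2 2) / sqrt q - (e 1 * (e 1 * ee 1 1 + e 2 * ee 1 2) + e 2 * (e 1 * ee 2 1 + e 2 * ee 2 2)) / (q * sqrt q)"
proof -
  have he: "(pd UNIV i \<eta> has_derivative (\<lambda>h. h $ 1 * ee 1 i + h $ 2 * ee 2 i)) (at y)" for i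
  proof (rule has_derivative_eq_rhs)
    show "(pd UNIV i \<eta> has_derivative (\<lambda>h. dirderiv UNIV h (pd UNIV i \<eta>) y)) (at y)"
      using has_dirderiv[OF C2_on_pd(2)[OF \<eta>], of y i] by simp
    show "(\<lambda>h. dirderiv UNIV h (pd UNIV i \<eta>) y) = (\<lambda>h. h $ 1 * ee 1 i + h $ 2 * ee 2 i)"
    proof
      fix h show "dirderiv UNIV h (pd UNIV i \<eta>) y = h $ 1 * ee 1 i + h $ 2 * ee 2 i"
        using dirderiv_linear_combination2[OF C2_on_pd(2)[OF \<eta>] UNIV_I, of h i y] unfolding ee_def by simp
    qed
  qed
  let ?q = "\<lambda>y. 1 + (pd UNIV 1 \<eta> y * pd UNIV 1 \<eta> y + pd UNIV 2 \<eta> y * pd UNIV 2 \<eta> y)"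
  have nq: "1 + (norm (grad UNIV \<eta> y))\<^sup>2 = ?q y" for y
    by (simp add: norm_vec_def L2_set_def sum_2 grad_def power2_eq_square)
  have q: "q > 0" unfolding q_def by (intro add_pos_nonneg) auto
  have qy: "?q y = q" by (simp add: q_def e_def)
  let ?q' = "\<lambda>h. e 1 * (h $ 1 * ee 1 1 + h $ 2 * ee 2 1) + (h $ 1 * ee 1 1 + h $ 2 * ee 2 1) * e 1
      + (e 2 * (h $ 1 * ee 1 2 + h $ 2 * ee 2 2) + (h $ 1 * ee 1 2 + h $ 2 * ee 2 2) * e 2)"
  have hq: "(?q has_derivative ?q') (at y)"
    using has_derivative_add[OF has_derivative_const[of 1] has_derivative_add[OF has_derivative_mult[OF he[of 1] he[of 1]] has_derivative_mult[OF he[of 2] he[of 2]]]]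
    by (simp only: e_def add_0)
  have hs: "((\<lambda>y. sqrt (?q y)) has_derivative (\<lambda>h. ?q' h * (inverse (sqrt q) / 2))) (at y)"
    using has_derivative_real_sqrt[OF _ hq] q qy by (simp add: e_def)
  have comp: "pd UNIV i (\<lambda>y. ((1 / sqrt (1 + (norm (grad UNIV \<eta> y))\<^sup>2)) *\<^sub>R grad UNIV \<eta> y) $ i) y
     = (ee i i * sqrt q - e i * (?q' (axis i 1) * (inverse (sqrt q) / 2))) / (sqrt q * sqrt q)" for i
  proof -
    have f: "(\<lambda>y. ((1 / sqrt (1 + (norm (grad UNIV \<eta> y))\<^sup>2)) *\<^sub>R grad UNIV \<eta> y) $ i) = (\<lambda>y. pd UNIV i \<eta> y / sqrt (?q y))"
      unfolding nq by (simp add: grad_def)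
    have "((\<lambda>y. pd UNIV i \<eta> y / sqrt (?q y)) has_derivative
       (\<lambda>h. ((h $ 1 * ee 1 i + h $ 2 * ee 2 i) * sqrt q - e i * (?q' h * (inverse (sqrt q) / 2))) / (sqrt q * sqrt q))) (at y)"
      using has_derivative_divide'[OF he hs, of i] q qy by (simp add: e_def)
    then have "pd UNIV i (\<lambda>y. pd UNIV i \<eta> y / sqrt (?q y)) y = ((axis i 1 $ 1 * ee 1 i + axis i 1 $ 2 * ee 2 i) * sqrt q - e i * (?q' (axis i 1) * (inverse (sqrt q) / 2))) / (sqrt q * sqrt q)"
      by (intro dirderiv_eq[OF thick_UNIV]) simp_all
    moreover have "axis i 1 $ 1 * ee 1 i + axis i 1 $ 2 * ee 2 i = ee i i"
      using exhaust_2[of i] by (auto simp: axis_def)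
    ultimately show ?thesis unfolding f by simp
  qed
  define s where "s = sqrt q"
  have s: "s > 0" "q = s * s" using q by (auto simp: s_def)
  show ?thesis
    unfolding divergence_def sum_2 comp unfolding s_def[symmetric] s(2)
    using s(1) by (simp add: axis_def field_simps)
qed

text \<open>Multiplying by \<open>R\<close> adds to the second-order equations only multiples of the first-order ones.\<close>

lemma expanded_equations:
  fixes U U' \<delta> W :: real
  assumes V: "ex2 V1 U a A" "ex2 V2 0 b B" "ex2 V3 0 c C"
    and d1: "ex2 d11 0 a1 A1" "ex2 d21 0 a2 A2" "ex2 d31 U' a3 A3"
    and d2: "ex2 d12 0 b1 B1" "ex2 d22 0 b2 B2" "ex2 d32 0 b3 B3"
    and d3: "ex2 d13 0 c1 C1" "ex2 d23 0 c2 C2" "ex2 d33 0 c3 C3"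
    and e: "ex2 e1 0 h1 k1" "ex2 e2 0 h2 k2"
    and ee: "ex2 e11 0 h11 k11" "ex2 e21 0 h12 k12" "ex2 e12 0 h21 k21" "ex2 e22 0 h22 k22"
    and h: "ex2 \<eta> 0 h k" and dp: "ex2 dp1 0 p1 q1" "ex2 dp2 0 p2 q2" "ex2 dp3 0 p3 q3"
  defines "R \<equiv> \<lambda>t. 1 + \<delta> * \<eta> t" and "T \<equiv> \<lambda>t. \<delta> * (V1 t * e1 t + V2 t * e2 t)"
    and "S1 \<equiv> \<lambda>t. V1 t * d11 t + V2 t * d21 t + V3 t * d31 t"
    and "S2 \<equiv> \<lambda>t. V1 t * d12 t + V2 t * d22 t + V3 t * d32 t"
    and "S3 \<equiv> \<lambda>t. V1 t * d13 t + V2 t * d23 t + V3 t * d33 t"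
  defines "L1 \<equiv> \<lambda>t. R t * S1 t - T t * V1 t - R t * R t * (W * e1 t * dp3 t) + R t * R t * R t * dp1 t"
    and "L2 \<equiv> \<lambda>t. R t * S2 t - T t * V2 t - R t * R t * (W * e2 t * dp3 t) + R t * R t * R t * dp2 t"
    and "L3 \<equiv> \<lambda>t. R t * ((\<delta> * V3 t * e1 t + W * (e11 t * V1 t + e21 t * V2 t)) * V1 t + W * e1 t * S1 t
        + (\<delta> * V3 t * e2 t + W * (e12 t * V1 t + e22 t * V2 t)) * V2 t + W * e2 t * S2 t)
      - T t * (W * (e1 t * V1 t + e2 t * V2 t)) + R t * R t * S3 t + R t * R t * dp3 t"
  assumes E1: "\<forall>\<^sub>F t in at 0. L1 t = 0"
    and E2: "\<forall>\<^sub>F t in at 0. L2 t = 0"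
    and E3: "\<forall>\<^sub>F t in at 0. L3 t = 0"
    and Dv: "\<forall>\<^sub>F t in at 0. d11 t + d22 t + d33 t = 0"
  shows "U * a1 + c * U' - \<delta> * U * U * h1 + p1 = 0" (is "?E1") "U * b1 + p2 = 0" (is "?E2") "U * (U * W * h11 + c1) + p3 = 0" (is "?E3") "a1 + b2 + c3 = 0" (is "?E4")
    "U * B1 + h * \<delta> * (U * b1) + (a * b1 + b * b2 + c * b3) - b * U * h1 * \<delta> - W * h2 * p3 + q2 + 3 * (h * \<delta>) * p2 = 0" (is "?E5")
    "a * (c1 + U * W * h11) + b * (c2 + U * W * h12) + c * (c3 + U' * W * h1 + U * \<delta> * h1) + q3
       + U * (U * W * k11 + W * (a1 * h1 + a * h11 + b1 * h2 + b * h21) + C1 - \<delta> * (h1 * (U * W * h1) + h * (U * W * h11))) = 0" (is "?E6")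
proof -
  note rules = ex2_add ex2_diff ex2_mult ex2_const V d1 d2 d3 e ee h dp
  \<comment> \<open>The expansion coefficients start as unknowns: the sum and product rules
    instantiate them, and only then are they compared with the stated form.\<close>
  have "\<exists>z0 z1 z2. ex2 L1 z0 z1 z2
      \<and> z1 = U * a1 + c * U' - \<delta> * U * U * h1 + p1"
    unfolding L1_def R_def T_def S1_def by (intro exI conjI, (rule rules)+, simp)
  then show ?E1 using ex2_zero(2)[OF _ E1] by blast
  have "\<exists>z0 z1 z2. ex2 L2 z0 z1 z2
      \<and> z1 = U * b1 + p2 \<and> z2 = U * B1 + h * \<delta> * (U * b1) + (a * b1 + b * b2 + c * b3) - b * U * h1 * \<delta> - W * h2 * p3 + q2 + 3 * (h * \<delta>) * p2"
    unfolding L2_def R_def T_def S2_def by (intro exI conjI, (rule rules)+, simp, simp add: algebra_simps)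
  then show ?E2 ?E5
    using ex2_zero(2,3)[OF _ E2] by blast+
  have "\<exists>z0 z1 z2. ex2 L3 z0 z1 z2
      \<and> z1 = U * (U * W * h11 + c1) + p3 \<and> z2 = a * (c1 + U * W * h11) + b * (c2 + U * W * h12) + c * (c3 + U' * W * h1 + U * \<delta> * h1) + q3
       + U * (U * W * k11 + W * (a1 * h1 + a * h11 + b1 * h2 + b * h21) + C1 - \<delta> * (h1 * (U * W * h1) + h * (U * W * h11)))
       + 2 * \<delta> * h * (U * (U * W * h11 + c1) + p3)"
    unfolding L3_def R_def T_def S1_def S2_def S3_def by (intro exI conjI, (rule rules)+, simp add: algebra_simps, simp add: algebra_simps)
  then have m3: "U * (U * W * h11 + c1) + p3 = 0" "a * (c1 + U * W * h11) + b * (c2 + U * W * h12) + c * (c3 + U' * W * h1 + U * \<delta> * h1) + q3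
       + U * (U * W * k11 + W * (a1 * h1 + a * h11 + b1 * h2 + b * h21) + C1 - \<delta> * (h1 * (U * W * h1) + h * (U * W * h11)))
       + 2 * \<delta> * h * (U * (U * W * h11 + c1) + p3) = 0"
    using ex2_zero(2,3)[OF _ E3] by blast+
  \<comment> \<open>Clearing denominators left \<open>2 * \<delta> * h\<close> times the first-order
    equation inside the second-order one; the first fact removes it.\<close>
  then show ?E3 ?E6
    by simp_all
  have "ex2 (\<lambda>t. d11 t + d22 t + d33 t) (0 + 0 + 0) (a1 + b2 + c3) (A1 + B2 + C3)" by (rule rules)+
  then show ?E4 using ex2_zero(2)[OF _ Dv] by blast
qed

section \<open>Smooth periodic data as functions on the slab\<close>

context slab begin

lemma C1_partial:
  fixes f :: "real^3 \<Rightarrow> real"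
  assumes df: "\<And>x. x \<in> D \<Longrightarrow> (f has_derivative F x) (at x within D)"
    and c: "\<And>j. continuous_on D (\<lambda>x. F x (axis j 1))"
    and per: "periodic_on l1 l2 D f" "\<And>j. periodic_on l1 l2 D (\<lambda>x. F x (axis j 1))"
  shows "C1 f (\<lambda>x. \<chi> j. F x (axis j 1))"
  unfolding C1_def
proof (intro conjI ballI per)
  fix x assume x: "x \<in> D"
  have l: "linear (F x)" by (rule has_derivative_linear[OF df[OF x]])
  have F: "F x h = (\<chi> j. F x (axis j 1)) \<bullet> h" for h
    by (subst vec3_eq[of h]) (simp only: linear_add[OF l] linear_scale[OF l], simp add: inner_vec_def sum_3 axis_def)
  show "(f has_derivative (\<lambda>h. (\<chi> j. F x (axis j 1)) \<bullet> h)) (at x within D)"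
    by (intro has_derivative_eq_rhs[OF df[OF x]] ext F)
next
  show "continuous_on D (\<lambda>x. \<chi> j. F x (axis j 1))" by (intro continuous_on_vec_lambda c)
  show "periodic_on l1 l2 D (\<lambda>x. \<chi> j. F x (axis j 1))" using per(2) by (simp add: periodic_on_def)
qed

lemma periodic_pd:
  "C2_on D f \<Longrightarrow> periodic_on l1 l2 D f \<Longrightarrow> periodic_on l1 l2 D (pd D j f)"
  by (rule periodic_dirderiv[OF periodic_domain_slab[OF d_pos l_pos] _ C2_on_pd(1)])

lemma C1_component:
  fixes u :: "real^3 \<Rightarrow> real^3"
  assumes u: "C2_on D u" and per: "periodic_on l1 l2 D u"
  shows "C1 (\<lambda>x. u x $ i) (\<lambda>x. \<chi> j. pd D j u x $ i)"
proof (rule C1_partial)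
  show "((\<lambda>x. u x $ i) has_derivative (\<lambda>b. dirderiv D b u x $ i)) (at x within D)" if "x \<in> D" for x
    by (rule has_derivative_compose[OF has_dirderiv[OF C2_on_pd(1)[OF u] that] has_derivative_nth])
  show "continuous_on D (\<lambda>x. pd D j u x $ i)" for j
    by (intro continuous_intros differentiable_imp_continuous_on C2_on_pd(2)[OF u])
qed (use per periodic_pd[OF u per] in \<open>auto simp: periodic_on_def\<close>)

lemma C1_scalar:
  fixes f :: "real^3 \<Rightarrow> real"
  assumes "C2_on D f" "periodic_on l1 l2 D f"
  shows "C1 f (\<lambda>x. \<chi> j. pd D j f x)"
  by (rule C1_partial)
     (intro has_dirderiv C2_on_pd[OF assms(1)] assms differentiable_imp_continuous_on periodic_pd | assumption)+

lemma C1_pd: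
  assumes "C1 f f'" "x \<in> D" shows "pd D j f x = f' x $ j"
  using dirderiv_eq[OF thick_slab[OF d_pos] assms(2), of f "\<lambda>h. f' x \<bullet> h" "axis j 1"] assms
  by (simp add: C1_def inner_axis)

lemma horiz_shift: "horiz (x + axis 1 s + axis 2 t) = horiz x + axis 1 s + axis 2 t"
  by (simp add: vec_eq_iff forall_2 axis_def)

lemma C1_lift:
  fixes f :: "real^2 \<Rightarrow> real"
  assumes f: "f differentiable_on UNIV" and c: "\<And>i. continuous_on UNIV (pd UNIV i f)" and per: "periodic_on l1 l2 UNIV f"
  shows "C1 (\<lambda>x. f (horiz x)) (\<lambda>x. vector [pd UNIV 1 f (horiz x), pd UNIV 2 f (horiz x), 0])"
  unfolding C1_def
proof (intro conjI ballI)
  have pd: "periodic_domain l1 l2 (UNIV :: (real^2) set)" by (rule periodic_domain_plane[OF l_pos])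
  show "((\<lambda>x. f (horiz x)) has_derivative (\<lambda>h. vector [pd UNIV 1 f (horiz x), pd UNIV 2 f (horiz x), 0] \<bullet> h)) (at x within D)" for x
    using has_derivative_lift[OF f, of x D] by (simp add: inner_vec_def sum_3 mult.commute)
  have hc: "continuous_on D horiz"
    using has_derivative_horiz by (meson continuous_on_eq_continuous_within has_derivative_continuous)
  have ci: "continuous_on D (\<lambda>x. pd UNIV i f (horiz x))" for i
    by (rule continuous_on_compose2[OF c hc]) auto
  have "continuous_on D (\<lambda>x. pd UNIV 1 f (horiz x) *\<^sub>R (axis 1 1 :: real^3) + pd UNIV 2 f (horiz x) *\<^sub>R axis 2 1)"
    by (intro continuous_intros ci)
  moreover have "\<alpha> *\<^sub>R (axis 1 1 :: real^3) + \<beta> *\<^sub>R axis 2 1 = vector [\<alpha>, \<beta>, 0]" for \<alpha> \<beta> :: real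
    by (simp add: vec_eq_iff forall_3 axis_def)
  ultimately show "continuous_on D (\<lambda>x. vector [pd UNIV 1 f (horiz x), pd UNIV 2 f (horiz x), 0] :: real^3)" by simp
  show "periodic_on l1 l2 D (\<lambda>x. f (horiz x))" using per by (simp add: periodic_on_def horiz_shift)
  have "periodic_on l1 l2 UNIV (pd UNIV j f)" for j by (rule periodic_dirderiv[OF pd per f])
  then show "periodic_on l1 l2 D (\<lambda>x. vector [pd UNIV 1 f (horiz x), pd UNIV 2 f (horiz x), 0] :: real^3)"
    by (simp add: periodic_on_def horiz_shift)
qed

text \<open>The interior equations hold in the open slab, but the mode equations must reach both
  walls, where the boundary conditions act. Continuity along vertical segments closes the
  gap.\<close>

lemma zero_up_to_boundary:
  fixes f :: "real^3 \<Rightarrow> real"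
  assumes c: "continuous_on D f" and z: "\<And>x. x \<in> Omega d \<Longrightarrow> f x = 0" and x: "x \<in> D"
  shows "f x = 0"
proof -
  have cl: "closure {-d<..<0} = {-d..0}" using d_pos by simp
  have "f (pt (x $ 1) (x $ 2) (x $ 3)) = 0"
  proof (rule continuous_constant_on_closure[of "{-d<..<0}" "\<lambda>w. f (pt (x $ 1) (x $ 2) w)" 0])
    show "continuous_on (closure {-d<..<0}) (\<lambda>w. f (pt (x $ 1) (x $ 2) w))"
      unfolding cl by (rule continuous_on_compose2[OF c]) (auto intro!: continuous_intros simp: in_D)
    show "f (pt (x $ 1) (x $ 2) w) = 0" if "w \<in> {-d<..<0}" for w
      using that by (intro z) (simp add: Omega_def)
    show "x $ 3 \<in> closure {-d<..<0}" using x unfolding cl by (simp add: in_D)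
  qed
  then show ?thesis by (simp add: pt_eta)
qed

end

lemma pd_reflect:
  fixes f :: "real^2 \<Rightarrow> real"
  assumes f: "f differentiable_on UNIV" and s: "\<And>y. f (reflect j y) = f y"
  shows "pd UNIV i f (reflect j y) = (if i = j then - pd UNIV i f y else pd UNIV i f y)"
proof -
  have inv: "reflect j (reflect j y) = y" for y :: "real^2" by (simp add: reflect_def vec_eq_iff)
  have l: "linear (reflect j :: real^2 \<Rightarrow> real^2)" by (rule linearI) (auto simp: reflect_def vec_eq_iff)
  have hr: "((reflect j :: real^2 \<Rightarrow> real^2) has_derivative reflect j) (at y)" for y
    by (rule linear_imp_has_derivative[OF l])
  have "(f has_derivative (\<lambda>b. dirderiv UNIV b f y)) (at (reflect j (reflect j y)))"
    using has_dirderiv[OF f, of y] by (simp add: inv)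
  from has_derivative_compose[OF hr this]
  have "(f has_derivative (\<lambda>b. dirderiv UNIV (reflect j b) f y)) (at (reflect j y))" by (simp add: s)
  then have "pd UNIV i f (reflect j y) = dirderiv UNIV (reflect j (axis i 1)) f y"
    by (intro dirderiv_eq[OF thick_UNIV]) simp_all
  also have "reflect j (axis i 1 :: real^2) = (if i = j then - axis i 1 else axis i 1)"
    by (auto simp: reflect_def vec_eq_iff axis_def)
  also have "dirderiv UNIV (if i = j then - axis i 1 else axis i 1) f y = (if i = j then - pd UNIV i f y else pd UNIV i f y)"
  proof -
    have "linear (\<lambda>b. dirderiv UNIV b f y)" by (rule has_derivative_linear[OF has_dirderiv[OF f UNIV_I]])
    from linear_neg[OF this] show ?thesis by auto
  qed
  finally show ?thesis .
qed

lemma linearized_curvature: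
  fixes e1 e2 e11 e12 e21 e22 :: "real \<Rightarrow> real"
  assumes d: "(e1 has_real_derivative h1) (at 0)" "(e2 has_real_derivative h2) (at 0)"
     "(e11 has_real_derivative h11) (at 0)" "(e12 has_real_derivative h12) (at 0)"
     "(e21 has_real_derivative h21) (at 0)" "(e22 has_real_derivative h22) (at 0)"
    and z: "e1 0 = 0" "e2 0 = 0" "e11 0 = 0" "e12 0 = 0" "e21 0 = 0" "e22 0 = 0"
  shows "((\<lambda>t. (e11 t + e22 t) / sqrt (1 + (e1 t * e1 t + e2 t * e2 t))
     - (e1 t * (e1 t * e11 t + e2 t * e12 t) + e2 t * (e1 t * e21 t + e2 t * e22 t))
        / ((1 + (e1 t * e1 t + e2 t * e2 t)) * sqrt (1 + (e1 t * e1 t + e2 t * e2 t)))) has_real_derivative h11 + h22) (at 0)"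
  by (rule derivative_eq_intros d refl | simp add: z)+

lemma dirderiv_zero: "thick D \<Longrightarrow> x \<in> D \<Longrightarrow> dirderiv D b (\<lambda>_. 0) x = 0"
  by (rule dirderiv_eq[where F = "\<lambda>_. 0"]) (auto intro: has_derivative_const)

lemma dirderiv_zero2:
  assumes D: "thick D" and x: "x \<in> D" shows "dirderiv D c (dirderiv D b (\<lambda>_. 0)) x = 0"
proof (rule dirderiv_eq[OF D x, where F = "\<lambda>_. 0"])
  show "((\<lambda>x. dirderiv D b (\<lambda>_. 0) x) has_derivative (\<lambda>_. 0)) (at x within D)"
    by (rule has_derivative_transform[OF x dirderiv_zero[OF D] has_derivative_const])
qed

lemma C2_on_zero: "thick D \<Longrightarrow> C2_on D (\<lambda>_. 0)"
proof -
  assume D: "thick D"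
  have 1: "(\<lambda>x. dirderiv D b (\<lambda>_. 0) x) differentiable_on D" for b
    unfolding differentiable_on_def differentiable_def
  proof
    fix x assume x: "x \<in> D"
    have "((\<lambda>x. dirderiv D b (\<lambda>_. 0) x) has_derivative (\<lambda>_. 0)) (at x within D)"
      by (rule has_derivative_transform[OF x dirderiv_zero[OF D] has_derivative_const])
    then show "\<exists>F. ((\<lambda>x. dirderiv D b (\<lambda>_. 0) x) has_derivative F) (at x within D)" by blast
  qed
  have "continuous_on D (dirderiv D c (dirderiv D b (\<lambda>_. 0)))" for b c
    by (subst continuous_on_cong[OF refl dirderiv_zero2[OF D]]) auto
  then show ?thesis using 1 unfolding C2_on_def by (auto simp: differentiable_on_const)
qed

section \<open>From the curve of waves to the linearized problem\<close>

theorem theorem3p1: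
  fixes d g \<sigma> lam1 lam2 :: real
    and I :: "real set"
    and u :: "real \<Rightarrow> real^3 \<Rightarrow> real^3"
    and p :: "real \<Rightarrow> real^3 \<Rightarrow> real"
    and \<eta> :: "real \<Rightarrow> real^2 \<Rightarrow> real"
    and U :: "real \<Rightarrow> real"
    and u1 u2 :: "real^3 \<Rightarrow> real^3"
    and p1 p2 :: "real^3 \<Rightarrow> real"
    and \<eta>1 \<eta>2 :: "real^2 \<Rightarrow> real"
  assumes "d > 0" "g > 0" "\<sigma> > 0" "lam1 > 0" "lam2 > 0"
    and "open I" "0 \<in> I"
    and "C2_curve I (C2p_vector lam1 lam2 (Omega_closed d)) (C2_norm (Omega_closed d)) u"
    and "C2_curve I (C2p_scalar lam1 lam2 (Omega_closed d)) (C2_norm (Omega_closed d)) p"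
    and "C2_curve I (C2p_scalar lam1 lam2 UNIV) (C2_norm UNIV) \<eta>"
    and "\<And>\<epsilon>. \<epsilon> \<in> I \<Longrightarrow> flattened_solution d g \<sigma> (u \<epsilon>) (p \<epsilon>) (\<eta> \<epsilon>)"
    and "C2_on {- d..0} U" "\<not> U constant_on {- d..0}" "\<And>z. z \<in> {- d..0} \<Longrightarrow> U z \<noteq> 0"
    and "\<And>x. x \<in> Omega_closed d \<Longrightarrow> u 0 x = vector [U (x $ 3), 0, 0]"
    and "\<And>x. x \<in> Omega_closed d \<Longrightarrow> p 0 x = 0"
    and "\<And>y. \<eta> 0 y = 0"
    and "\<eta>1 \<in> C2p_scalar lam1 lam2 UNIV" "\<eta>2 \<in> C2p_scalar lam1 lam2 UNIV"
    and "p1 \<in> C2p_scalar lam1 lam2 (Omega_closed d)" "p2 \<in> C2p_scalar lam1 lam2 (Omega_closed d)"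
    and "u1 \<in> C2p_vector lam1 lam2 (Omega_closed d)" "u2 \<in> C2p_vector lam1 lam2 (Omega_closed d)"
    and "expands2 (C2_norm UNIV) \<eta> (\<lambda>_. 0) \<eta>1 \<eta>2"
    and "expands2 (C2_norm (Omega_closed d)) p (\<lambda>_. 0) p1 p2"
    and "expands2 (C2_norm (Omega_closed d)) u (u 0) u1 u2"
  shows "(\<forall>x\<in>Omega_closed d.
            u1 x $ 2 = 0 \<and>
            pd (Omega_closed d) 2 (\<lambda>y. u1 y $ 3) x = 0 \<and>
            pd (Omega_closed d) 2 p1 x = 0) \<and>
         (\<forall>y. pd UNIV 2 \<eta>1 y = 0)"
proof -
  interpret slab d lam1 lam2 using assms(1,4,5) by unfold_locales
  define U' where "U' = dirderiv {-d..0} 1 U"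
  have U_dif: "U differentiable_on {-d..0}" and U'_dif: "U' differentiable_on {-d..0}"
    using assms(12) by (auto simp: C2_on_def U'_def)
  interpret shear_flow d U U'
  proof
    show "(U has_real_derivative U' z) (at z within {-d..0})" if z: "z \<in> {-d..0}" for z
    proof -
      have h: "(U has_derivative (\<lambda>b. dirderiv {-d..0} b U z)) (at z within {-d..0})" by (rule has_dirderiv[OF U_dif z])
      have "dirderiv {-d..0} b U z = U' z * b" for b
        using linear_scale[OF has_derivative_linear[OF h], of b 1] by (simp add: U'_def)
      then show ?thesis using h by (simp add: has_field_derivative_def)
    qed
  qed (use assms d_pos differentiable_imp_continuous_on[OF U'_dif] in auto)
  have pdS: "periodic_domain lam1 lam2 D" and pdP: "periodic_domain lam1 lam2 (UNIV :: (real^2) set)"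
    by (rule periodic_domain_slab[OF d_pos l_pos], rule periodic_domain_plane[OF l_pos])
  have thD: "thick D" by (rule thick_slab[OF d_pos])
  have evI: "\<forall>\<^sub>F t in at 0. t \<in> I"
    using eventually_at_in_open[OF assms(6,7)] by eventually_elim simp
  have uI: "C2_on D (u t)" "periodic_on lam1 lam2 D (u t)" if "t \<in> I" for t
    using assms(8) that unfolding C2_curve_def C2p_vector_def by auto
  have pI: "C2_on D (p t)" "periodic_on lam1 lam2 D (p t)" if "t \<in> I" for t
    using assms(9) that unfolding C2_curve_def C2p_scalar_def by auto
  have \<eta>I: "C2_on UNIV (\<eta> t)" "periodic_on lam1 lam2 UNIV (\<eta> t)" if "t \<in> I" for t
    using assms(10) that unfolding C2_curve_def C2p_scalar_def by auto
  have u12: "C2_on D u1" "periodic_on lam1 lam2 D u1" "C2_on D u2" "periodic_on lam1 lam2 D u2"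
    using assms(22,23) by (auto simp: C2p_vector_def)
  have p12: "C2_on D p1" "periodic_on lam1 lam2 D p1" "C2_on D p2" "periodic_on lam1 lam2 D p2"
    using assms(20,21) by (auto simp: C2p_scalar_def)
  have \<eta>12: "C2_on UNIV \<eta>1" "periodic_on lam1 lam2 UNIV \<eta>1" "C2_on UNIV \<eta>2" "periodic_on lam1 lam2 UNIV \<eta>2"
    using assms(18,19) by (auto simp: C2p_scalar_def)
  have u1_sym: "u1 (reflect 1 x) = - reflect 1 (u1 x)" "u1 (reflect 2 x) = reflect 2 (u1 x)" if "x \<in> D" for x
    using assms(22) that by (auto simp: C2p_vector_def sym_vector_def)
  have p1_sym: "p1 (reflect 1 x) = p1 x" "p1 (reflect 2 x) = p1 x" if "x \<in> D" for x
    using assms(20) that by (auto simp: C2p_scalar_def sym_scalar_def)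
  have \<eta>1_sym: "\<eta>1 (reflect 1 y) = \<eta>1 y" "\<eta>1 (reflect 2 y) = \<eta>1 y" for y
    using assms(18) by (auto simp: C2p_scalar_def sym_scalar_def)
  have evu: "\<forall>\<^sub>F t in at 0. C2_on D (u t) \<and> periodic_on lam1 lam2 D (u t)"
    and evp: "\<forall>\<^sub>F t in at 0. C2_on D (p t) \<and> periodic_on lam1 lam2 D (p t)"
    and ev\<eta>: "\<forall>\<^sub>F t in at 0. C2_on UNIV (\<eta> t) \<and> periodic_on lam1 lam2 UNIV (\<eta> t)"
    using uI pI \<eta>I by (auto intro: eventually_mono[OF evI])
  have zD: "C2_on D (\<lambda>_. 0::real)" "periodic_on lam1 lam2 D (\<lambda>_. 0::real)" and zP: "C2_on UNIV (\<lambda>_::real^2. 0::real)" "periodic_on lam1 lam2 UNIV (\<lambda>_. 0::real)"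
    using C2_on_zero[OF thD] C2_on_zero[OF thick_UNIV] by (auto simp: periodic_on_def)
  note ex_u = ex2_expansion[OF pdS _ evu uI(1)[OF assms(7)] uI(2)[OF assms(7)] u12 assms(26)]
  note ex_p = ex2_expansion[OF pdS _ evp zD p12 assms(25)]
  note ex_\<eta> = ex2_expansion[OF pdP UNIV_I ev\<eta> zP \<eta>12 assms(24)]
  have X\<eta>: "ex2 (\<lambda>t. \<eta> t y) 0 (\<eta>1 y) (\<eta>2 y)"
    and Xe: "ex2 (\<lambda>t. pd UNIV i (\<eta> t) y) 0 (pd UNIV i \<eta>1 y) (pd UNIV i \<eta>2 y)"
    and Xee: "ex2 (\<lambda>t. pd UNIV j (pd UNIV i (\<eta> t)) y) 0 (pd UNIV j (pd UNIV i \<eta>1) y) (pd UNIV j (pd UNIV i \<eta>2) y)" for y i j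
    using ex_\<eta>(1)[of y] ex_\<eta>(2)[of "axis i 1" y] ex_\<eta>(3)[of "axis j 1" "axis i 1" y]
    by (simp_all add: dirderiv_zero[OF thick_UNIV] dirderiv_zero2[OF thick_UNIV])
  have Xp: "ex2 (\<lambda>t. p t x) 0 (p1 x) (p2 x)"
    and Xdp: "ex2 (\<lambda>t. pd D j (p t) x) 0 (pd D j p1 x) (pd D j p2 x)" if "x \<in> D" for x j
    using ex_p(1)[OF that] ex_p(2)[OF that, of "axis j 1"] by (simp_all add: dirderiv_zero[OF thD that])
  have Xu: "ex2 (\<lambda>t. u t x $ i) (u 0 x $ i) (u1 x $ i) (u2 x $ i)"
    and Xdu: "ex2 (\<lambda>t. pd D j (u t) x $ i) (pd D j (u 0) x $ i) (pd D j u1 x $ i) (pd D j u2 x $ i)" if "x \<in> D" for x i j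
    using ex2_nth[OF ex_u(1)[OF that]] ex2_nth[OF ex_u(2)[OF that, of "axis j 1"]] by simp_all
  have CU: "C1 (\<lambda>x. U (x $ 3)) (\<lambda>x. axis 3 (U' (x $ 3)))" by (rule C1_vertical[OF dU cU'])
  have u0: "u 0 x $ 1 = U (x $ 3)" "u 0 x $ 2 = 0" "u 0 x $ 3 = 0" if "x \<in> D" for x
    using assms(15)[OF that] by simp_all
  have du0: "pd D j (u 0) x $ i = (if j = 3 \<and> i = 1 then U' (x $ 3) else 0)" if x: "x \<in> D" for x i j
  proof -
    have "((\<lambda>x. U (x $ 3) *\<^sub>R (axis 1 1 :: real^3)) has_derivative (\<lambda>h. (axis 3 (U' (x $ 3)) \<bullet> h) *\<^sub>R axis 1 1)) (at x within D)"
      using CU x unfolding C1_def by (intro has_derivative_scaleR_left) auto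
    then have "(u 0 has_derivative (\<lambda>h. (axis 3 (U' (x $ 3)) \<bullet> h) *\<^sub>R axis 1 1)) (at x within D)"
      by (rule has_derivative_transform[OF x, rotated]) (simp add: assms(15) vec_eq_iff forall_3 axis_def)
    from dirderiv_eq[OF thD x this, of "axis j 1"]
    have "pd D j (u 0) x $ i = axis 3 (U' (x $ 3)) $ j * (axis 1 1 :: real^3) $ i" by (simp add: inner_axis)
    then show ?thesis by (simp add: axis_def)
  qed
  \<comment> \<open>The shear gives a zeroth-order part to a single derivative, that of the first
    velocity component in x_3.\<close>
  have Xd0: "ex2 (\<lambda>t. pd D j (u t) x $ i) (if j = 3 \<and> i = 1 then U' (x $ 3) else 0) (pd D j u1 x $ i) (pd D j u2 x $ i)"
    if "x \<in> D" for x i j using Xdu[OF that, of j i] unfolding du0[OF that] .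
  have Xd: "ex2 (\<lambda>t. pd D 3 (u t) x $ 1) (U' (x $ 3)) (pd D 3 u1 x $ 1) (pd D 3 u2 x $ 1)"
    "j \<noteq> 3 \<or> i \<noteq> 1 \<Longrightarrow> ex2 (\<lambda>t. pd D j (u t) x $ i) 0 (pd D j u1 x $ i) (pd D j u2 x $ i)" if "x \<in> D" for x i j
    using Xd0[OF that, of 3 1] Xd0[OF that, of j i] by auto
  define e where "e i x = pd UNIV i \<eta>1 (horiz x)" for i :: 2 and x
  define ee where "ee j i x = pd UNIV j (pd UNIV i \<eta>1) (horiz x)" for j i :: 2 and x
  \<comment> \<open>\<open>?E1\<close> to \<open>?E4\<close> are of first order; \<open>?E5\<close>
    and \<open>?E6\<close> are the transverse and the vertical momentum balance at second
    order.\<close>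
  have EQ: "U (x $ 3) * pd D 1 u1 x $ 1 + u1 x $ 3 * U' (x $ 3) - (1/d) * U (x $ 3) * U (x $ 3) * e 1 x + pd D 1 p1 x = 0" (is "?E1")
    "U (x $ 3) * pd D 1 u1 x $ 2 + pd D 2 p1 x = 0" (is "?E2")
    "U (x $ 3) * (U (x $ 3) * (1 + x $ 3 / d) * ee 1 1 x + pd D 1 u1 x $ 3) + pd D 3 p1 x = 0" (is "?E3")
    "pd D 1 u1 x $ 1 + pd D 2 u1 x $ 2 + pd D 3 u1 x $ 3 = 0" (is "?E4")
    "U (x $ 3) * pd D 1 u2 x $ 2 + \<eta>1 (horiz x) * (1/d) * (U (x $ 3) * pd D 1 u1 x $ 2)
       + (u1 x $ 1 * pd D 1 u1 x $ 2 + u1 x $ 2 * pd D 2 u1 x $ 2 + u1 x $ 3 * pd D 3 u1 x $ 2)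
       - u1 x $ 2 * U (x $ 3) * e 1 x * (1/d) - (1 + x $ 3 / d) * e 2 x * pd D 3 p1 x
       + pd D 2 p2 x + 3 * (\<eta>1 (horiz x) * (1/d)) * pd D 2 p1 x = 0" (is "?E5")
    "u1 x $ 1 * (pd D 1 u1 x $ 3 + U (x $ 3) * (1 + x $ 3 / d) * ee 1 1 x)
       + u1 x $ 2 * (pd D 2 u1 x $ 3 + U (x $ 3) * (1 + x $ 3 / d) * ee 2 1 x)
       + u1 x $ 3 * (pd D 3 u1 x $ 3 + U' (x $ 3) * (1 + x $ 3 / d) * e 1 x + U (x $ 3) * (1/d) * e 1 x)
       + pd D 3 p2 x
       + U (x $ 3) * (U (x $ 3) * (1 + x $ 3 / d) * pd UNIV 1 (pd UNIV 1 \<eta>2) (horiz x)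
         + (1 + x $ 3 / d) * (pd D 1 u1 x $ 1 * e 1 x + u1 x $ 1 * ee 1 1 x
            + pd D 1 u1 x $ 2 * e 2 x + u1 x $ 2 * ee 1 2 x)
         + pd D 1 u2 x $ 3
         - (1/d) * (e 1 x * (U (x $ 3) * (1 + x $ 3 / d) * e 1 x)
            + \<eta>1 (horiz x) * (U (x $ 3) * (1 + x $ 3 / d) * ee 1 1 x))) = 0" (is "?E6")
    if x: "x \<in> Omega d" for x
  proof -
    have xD: "x \<in> D" by (rule Omega_interior(3)[OF x])
    note fl = flattened_interior_equations[OF assms(1) assms(11) uI(1) \<eta>I(1) x]
    note Z = expanded_equations[OF Xu[OF xD, of 1, unfolded u0[OF xD]] Xu[OF xD, of 2, unfolded u0[OF xD]] Xu[OF xD, of 3, unfolded u0[OF xD]]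
      Xd(2)[OF xD] Xd(2)[OF xD] Xd(1)[OF xD] Xd(2)[OF xD] Xd(2)[OF xD] Xd(2)[OF xD] Xd(2)[OF xD] Xd(2)[OF xD] Xd(2)[OF xD]
      Xe Xe Xee Xee Xee Xee X\<eta> Xdp[OF xD] Xdp[OF xD] Xdp[OF xD]
      eventually_mono[OF evI fl(1)] eventually_mono[OF evI fl(2)] eventually_mono[OF evI fl(3)] eventually_mono[OF evI fl(4)]]
    show ?E1 unfolding e_def ee_def by (rule Z(1)) simp_all
    show ?E2 unfolding e_def ee_def by (rule Z(2)) simp_all
    show ?E3 unfolding e_def ee_def by (rule Z(3)) simp_all
    show ?E4 unfolding e_def ee_def by (rule Z(4)) simp_all
    show ?E5 unfolding e_def ee_def by (rule Z(5)) simp_all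
    show ?E6 unfolding e_def ee_def by (rule Z(6)) simp_all
  qed
  define h' :: "real^3 \<Rightarrow> real^3" where "h' x = vector [e 1 x, e 2 x, 0]" for x
  define h1' :: "real^3 \<Rightarrow> real^3" where "h1' x = vector [ee 1 1 x, ee 2 1 x, 0]" for x
  define h2' :: "real^3 \<Rightarrow> real^3" where "h2' x = vector [ee 1 2 x, ee 2 2 x, 0]" for x
  have lift1: "C1 (\<lambda>x. f (horiz x)) (\<lambda>x. vector [pd UNIV 1 f (horiz x), pd UNIV 2 f (horiz x), 0])"
    and lift2: "C1 (\<lambda>x. pd UNIV i f (horiz x)) (\<lambda>x. vector [pd UNIV 1 (pd UNIV i f) (horiz x), pd UNIV 2 (pd UNIV i f) (horiz x), 0])"
    if f: "C2_on UNIV f" "periodic_on lam1 lam2 UNIV f" for f i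
    using C1_lift[OF C2_on_pd(1)[OF f(1)] differentiable_imp_continuous_on[OF C2_on_pd(2)[OF f(1)]] f(2)]
      C1_lift[OF C2_on_pd(2)[OF f(1)] C2_on_pd(3)[OF f(1)] periodic_dirderiv[OF pdP f(2) C2_on_pd(1)[OF f(1)]]] by blast+
  have Ch: "C1 (\<lambda>x. \<eta>1 (horiz x)) h'" using lift1[OF \<eta>12(1,2)] by (simp add: h'_def[abs_def] e_def)
  have Ce: "C1 (e 1) h1'" "C1 (e 2) h2'"
    using lift2[OF \<eta>12(1,2), of 1] lift2[OF \<eta>12(1,2), of 2]
    by (simp_all add: h1'_def[abs_def] h2'_def[abs_def] e_def[abs_def] ee_def)
  have h'_nth: "h' x $ 1 = e 1 x" "h' x $ 2 = e 2 x" for x by (simp_all add: h'_def)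
  have h1'_nth: "h1' x $ 1 = ee 1 1 x" "h1' x $ 2 = ee 2 1 x" "h1' x $ 3 = 0" for x by (simp_all add: h1'_def)
  have h2'_nth: "h2' x $ 1 = ee 1 2 x" "h2' x $ 2 = ee 2 2 x" for x by (simp_all add: h2'_def)
  note Cu = C1_component[OF u12(1,2)] and Cu2 = C1_component[OF u12(3,4)]
  note Cp = C1_scalar[OF p12(1,2)] and Cq = C1_scalar[OF p12(3,4)]
  \<comment> \<open>The first-order coefficient of the third component of
    \<open>Mmat d \<eta> x *v u x\<close>. In terms of it the elevation disappears from the linear
    interior equations.\<close>
  let ?v = "\<lambda>x. u1 x $ 3 + U (x $ 3) * ((1 + x $ 3 / d) * e 1 x)"
  obtain v' where Cv: "C1 ?v v'"
    and v'_nth: "\<And>x. v' x $ 1 = pd D 1 u1 x $ 3 + U (x $ 3) * (1 + x $ 3 / d) * ee 1 1 x"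
      "\<And>x. v' x $ 2 = pd D 2 u1 x $ 3 + U (x $ 3) * (1 + x $ 3 / d) * ee 2 1 x"
      "\<And>x. v' x $ 3 = pd D 3 u1 x $ 3 + U' (x $ 3) * (1 + x $ 3 / d) * e 1 x + U (x $ 3) * (1/d) * e 1 x"
    by (rule that[OF C1_add[OF Cu C1_mult[OF CU C1_mult[OF C1_height Ce(1)]]]])
       (simp_all add: axis_def h1'_nth algebra_simps)
  have cont: "continuous_on D (\<lambda>x. U (x $ 3))" "continuous_on D (\<lambda>x. U' (x $ 3))"
    by (rule C1_cont[OF CU]) (rule continuous_on_compose2[OF cU'], auto intro!: continuous_intros simp: in_D)
  have cd: "continuous_on D (\<lambda>x. pd D j p1 x)" "continuous_on D (\<lambda>x. pd D j u1 x $ i)" for i j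
    using C1_cont'[OF Cp, of j] C1_cont'[OF Cu, of i j] by simp_all
  have M1: "- U (x $ 3) * (pd D 2 u1 x $ 2 + v' x $ 3) + U' (x $ 3) * ?v x + pd D 1 p1 x = 0" if x: "x \<in> D" for x
  proof (rule zero_up_to_boundary[OF _ _ x])
    show "continuous_on D (\<lambda>x. - U (x $ 3) * (pd D 2 u1 x $ 2 + v' x $ 3) + U' (x $ 3) * ?v x + pd D 1 p1 x)"
      by (intro continuous_intros cont cd C1_cont[OF Cv] C1_cont'[OF Cv])
    fix x assume x: "x \<in> Omega d"
    have a1: "pd D 1 u1 x $ 1 = - pd D 2 u1 x $ 2 - pd D 3 u1 x $ 3" using EQ(4)[OF x] by simp
    show "- U (x $ 3) * (pd D 2 u1 x $ 2 + v' x $ 3) + U' (x $ 3) * ?v x + pd D 1 p1 x = 0"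
      using EQ(1)[OF x] unfolding a1 v'_nth by (simp add: algebra_simps)
  qed
  have M2: "U (x $ 3) * pd D 1 u1 x $ 2 + pd D 2 p1 x = 0" if x: "x \<in> D" for x
    by (rule zero_up_to_boundary[OF _ _ x]) (intro continuous_intros cont cd, rule EQ(2))
  have M3: "U (x $ 3) * v' x $ 1 + pd D 3 p1 x = 0" if x: "x \<in> D" for x
  proof (rule zero_up_to_boundary[OF _ _ x])
    show "continuous_on D (\<lambda>x. U (x $ 3) * v' x $ 1 + pd D 3 p1 x)"
      by (intro continuous_intros cont cd C1_cont'[OF Cv])
    show "U (x $ 3) * v' x $ 1 + pd D 3 p1 x = 0" if "x \<in> Omega d" for x
      using EQ(3)[OF that] unfolding v'_nth by (simp add: algebra_simps)
  qed
  have wall: "u1 x $ 3 = 0" if "x $ 3 = 0 \<or> x $ 3 = -d" for x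
  proof -
    have xD: "x \<in> D" using that d_pos by (auto simp: in_D)
    have "\<forall>\<^sub>F t in at 0. u t x $ 3 = 0"
      using evI by eventually_elim (use assms(11) that in \<open>auto simp: flattened_solution_def\<close>)
    from ex2_zero(2)[OF Xu[OF xD] this] show ?thesis .
  qed
  have top: "p1 x = g * \<eta>1 (horiz x) - \<sigma> * (ee 1 1 x + ee 2 2 x)" if x3: "x $ 3 = 0" for x
  proof -
    have xD: "x \<in> D" using x3 d_pos by (simp add: in_D)
    have \<eta>0: "\<eta> 0 = (\<lambda>_. 0)" using assms(17) by auto
    have z: "pd UNIV i (\<eta> 0) (horiz x) = 0" "pd UNIV j (pd UNIV i (\<eta> 0)) (horiz x) = 0" for i j
      unfolding \<eta>0 by (simp_all add: dirderiv_zero[OF thick_UNIV] dirderiv_zero2[OF thick_UNIV])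
    let ?e = "\<lambda>i t. pd UNIV i (\<eta> t) (horiz x)" and ?ee = "\<lambda>j i t. pd UNIV j (pd UNIV i (\<eta> t)) (horiz x)"
    let ?K = "\<lambda>t. (?ee 1 1 t + ?ee 2 2 t) / sqrt (1 + (?e 1 t * ?e 1 t + ?e 2 t * ?e 2 t))
     - (?e 1 t * (?e 1 t * ?ee 1 1 t + ?e 2 t * ?ee 1 2 t) + ?e 2 t * (?e 1 t * ?ee 2 1 t + ?e 2 t * ?ee 2 2 t))
        / ((1 + (?e 1 t * ?e 1 t + ?e 2 t * ?e 2 t)) * sqrt (1 + (?e 1 t * ?e 1 t + ?e 2 t * ?e 2 t)))"
    have dK: "(?K has_real_derivative ee 1 1 x + ee 2 2 x) (at 0)"
      unfolding ee_def by (rule linearized_curvature) (rule ex2_derivative[OF Xe z(1)] ex2_derivative[OF Xee z(2)] z)+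
    have dp: "((\<lambda>t. p t x) has_real_derivative p1 x) (at 0)" by (rule ex2_derivative[OF Xp[OF xD] assms(16)[OF xD]])
    have d\<eta>: "((\<lambda>t. \<eta> t (horiz x)) has_real_derivative \<eta>1 (horiz x)) (at 0)" by (rule ex2_derivative[OF X\<eta> assms(17)])
    \<comment> \<open>The dynamic condition holds identically for \<open>t\<close> near 0; the
      vanishing of its derivative at \<open>t = 0\<close> is the linearized condition.\<close>
    let ?F = "\<lambda>t. p t x - g * \<eta> t (horiz x) + \<sigma> * ?K t"
    have dF: "(?F has_real_derivative p1 x - g * \<eta>1 (horiz x) + \<sigma> * (ee 1 1 x + ee 2 2 x)) (at 0)"
      by (intro DERIV_add DERIV_diff DERIV_cmult dp d\<eta> dK)
    have F0: "?F t = 0" if "t \<in> I" for t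
      using assms(11)[OF that] x3 unfolding flattened_solution_def curvature_expansion[OF \<eta>I(1)[OF that]] by blast
    have "\<forall>\<^sub>F t in nhds 0. ?F t = 0"
      by (rule eventually_mono[OF eventually_nhds_in_open[OF assms(6,7)]]) (rule F0)
    then have "(?F has_real_derivative 0) (at 0)"
      using DERIV_cong_ev[OF refl, of ?F "\<lambda>_. 0" 0 0 0] by simp
    then have "p1 x - g * \<eta>1 (horiz x) + \<sigma> * (ee 1 1 x + ee 2 2 x) = 0" by (rule DERIV_unique[OF dF])
    then show ?thesis by simp
  qed
  have e_sym: "e 1 (reflect 1 x) = - e 1 x" "e 1 (reflect 2 x) = e 1 x" for x
  proof -
    have "horiz (reflect 1 x) = reflect 1 (horiz x)" "horiz (reflect 2 x) = reflect 2 (horiz x)"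
      by (simp_all add: vec_eq_iff forall_2 reflect_def)
    then show "e 1 (reflect 1 x) = - e 1 x" "e 1 (reflect 2 x) = e 1 x"
      using pd_reflect[OF C2_on_pd(1)[OF \<eta>12(1)] \<eta>1_sym(1), of 1 "horiz x"] pd_reflect[OF C2_on_pd(1)[OF \<eta>12(1)] \<eta>1_sym(2), of 1 "horiz x"]
      by (simp_all add: e_def)
  qed
  have refl3: "reflect 1 x $ 3 = x $ 3" "reflect 2 x $ 3 = x $ 3" for x :: "real^3" by (simp_all add: reflect_def)
  interpret W: linear_wave d lam1 lam2 U U' g \<sigma> p1 "\<lambda>x. u1 x $ 2" ?v "\<lambda>x. \<eta>1 (horiz x)"
      "\<lambda>x. \<chi> j. pd D j p1 x" "\<lambda>x. \<chi> j. pd D j u1 x $ 2" v' h' h1' h2'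
  proof
    show "C1 (\<lambda>x. h' x $ 1) h1'" "C1 (\<lambda>x. h' x $ 2) h2'" using Ce unfolding h'_nth by simp_all
    show "\<eta>1 (horiz (reflect 1 x)) = \<eta>1 (horiz x)" "\<eta>1 (horiz (reflect 2 x)) = \<eta>1 (horiz x)" for x
    proof -
      have "horiz (reflect 1 x) = reflect 1 (horiz x)" "horiz (reflect 2 x) = reflect 2 (horiz x)"
        by (simp_all add: vec_eq_iff forall_2 reflect_def)
      then show "\<eta>1 (horiz (reflect 1 x)) = \<eta>1 (horiz x)" "\<eta>1 (horiz (reflect 2 x)) = \<eta>1 (horiz x)" using \<eta>1_sym by simp_all
    qed
    show "u1 (reflect 1 x) $ 2 = - u1 x $ 2" "u1 (reflect 2 x) $ 2 = - u1 x $ 2" if "x \<in> D" for x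
      using u1_sym[OF that] by (simp_all add: reflect_def)
    show "?v (reflect 1 x) = - ?v x" "?v (reflect 2 x) = ?v x" if "x \<in> D" for x
      unfolding u1_sym[OF that] e_sym refl3 by (simp_all add: reflect_def)
    \<comment> \<open>\<open>u1 x $ 3\<close> vanishes on both walls, and the factor
      \<open>1 + x $ 3 / d\<close> is 0 at the bottom and 1 at the top.\<close>
    show "?v x = 0" if "x $ 3 = -d" for x using wall[of x] that d_pos by simp
    show "?v x = U 0 * h' x $ 1" if "x $ 3 = 0" for x using wall[of x] that by (simp add: h'_nth)
    show "p1 x = g * \<eta>1 (horiz x) - \<sigma> * (h1' x $ 1 + h2' x $ 2)" if "x $ 3 = 0" for x
      using top[OF that] by (simp add: h1'_nth h2'_nth)
  qed (use assms(2,3) Cp Cu Cv Ch p1_sym M1 M2 M3 in \<open>simp_all add: vec_lambda_beta\<close>)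
  \<comment> \<open>The second-order coefficient of the third component of
    \<open>Mmat d \<eta> x *v u x\<close>. It occurs in \<open>?E6\<close> as \<open>U\<close> times
    its x_1-derivative and so disappears from means over x_1.\<close>
  let ?X = "\<lambda>x. U (x $ 3) * ((1 + x $ 3 / d) * pd UNIV 1 \<eta>2 (horiz x)) + u1 x $ 1 * ((1 + x $ 3 / d) * e 1 x)
     + u1 x $ 2 * ((1 + x $ 3 / d) * e 2 x) + u2 x $ 3 - 1/d * (\<eta>1 (horiz x) * (U (x $ 3) * ((1 + x $ 3 / d) * e 1 x)))"
  obtain X' where CX: "C1 ?X X'" and X'_nth: "\<And>x. X' x $ 1 = U (x $ 3) * (1 + x $ 3 / d) * pd UNIV 1 (pd UNIV 1 \<eta>2) (horiz x)
         + (1 + x $ 3 / d) * (pd D 1 u1 x $ 1 * e 1 x + u1 x $ 1 * ee 1 1 x + pd D 1 u1 x $ 2 * e 2 x + u1 x $ 2 * ee 1 2 x)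
         + pd D 1 u2 x $ 3
         - (1/d) * (e 1 x * (U (x $ 3) * (1 + x $ 3 / d) * e 1 x) + \<eta>1 (horiz x) * (U (x $ 3) * (1 + x $ 3 / d) * ee 1 1 x))"
    by (rule that[OF C1_diff[OF C1_add[OF C1_add[OF C1_add[OF
            C1_mult[OF CU C1_mult[OF C1_height lift2[OF \<eta>12(3,4)]]] C1_mult[OF Cu C1_mult[OF C1_height Ce(1)]]]
            C1_mult[OF Cu C1_mult[OF C1_height Ce(2)]]] Cu2]
            C1_cmult[OF C1_mult[OF Ch C1_mult[OF CU C1_mult[OF C1_height Ce(1)]]]]]])
       (simp add: axis_def h'_nth h1'_nth h2'_nth algebra_simps)
  have slope: "W.slope1 x = (1 + x $ 3 / d) * e 1 x" "W.slope2 x = (1 + x $ 3 / d) * e 2 x" for x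
    by (simp_all add: W.slope1_def W.slope2_def h'_nth)
  note unf = slope v'_nth X'_nth h'_nth vec_lambda_beta
  have E: W.no_transverse_energy
  proof (rule W.second_order_solvability[OF Cu[of 1] Cu2[of 2] Cq CX], goal_cases)
    case 1
    show ?case by (rule h1'_nth)
  next
    case (2 x)
    then show ?case using EQ(4)[of x] unfolding unf by (simp add: algebra_simps)
  next
    case (3 x)
    then show ?case using EQ(5)[of x] unfolding unf by simp
  next
    case (4 x)
    then show ?case using EQ(6)[of x] unfolding unf by simp
  qed
  note conc = W.two_dimensional[OF E assms(13)]
  have eta: "pd UNIV 2 \<eta>1 y = 0" for y
  proof -
    have "pt (y $ 1) (y $ 2) 0 \<in> D" using d_pos by (simp add: in_D)
    moreover have "horiz (pt (y $ 1) (y $ 2) 0) = y" by (simp add: vec_eq_iff forall_2)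
    ultimately show ?thesis using conc(4)[of "pt (y $ 1) (y $ 2) 0"] by (simp add: h'_nth e_def)
  qed
  have "u1 x $ 2 = 0 \<and> pd D 2 (\<lambda>y. u1 y $ 3) x = 0 \<and> pd D 2 p1 x = 0" if x: "x \<in> D" for x
  proof -
    \<comment> \<open>The field \<open>?v\<close> differs from the third component of
      \<open>u1\<close> by a multiple of the x_1-slope of the surface. The x_2-derivative of that
      slope is the x_1-derivative of the vanishing x_2-slope.\<close>
    have "pd UNIV 2 \<eta>1 = (\<lambda>_. 0)" using eta by auto
    then have "ee 1 2 x = 0" by (simp add: ee_def dirderiv_zero[OF thick_UNIV])
    moreover have "ee 2 1 x = ee 1 2 x"
      using mixed_derivatives[OF Ch W.h1 W.h2 x] by (simp add: h1'_nth h2'_nth)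
    ultimately have "pd D 2 u1 x $ 3 = 0" using conc(3)[OF x] by (simp add: v'_nth)
    moreover have "pd D 2 (\<lambda>y. u1 y $ 3) x = pd D 2 u1 x $ 3" using C1_pd[OF Cu x, of 2 3] by simp
    ultimately show ?thesis using conc(1,2)[OF x] by simp
  qed
  then show ?thesis using eta by blast
qed

end
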